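(* Let $(X_t)_{t\in\mathbb Z}$ be a strictly stationary sequence of $\mathbb R^d$-valued random vectors which is regularly varying with index $\alpha>0$, with spectral tail process $(\Theta_t)_{t\in\mathbb Z}$, and let $(a_n)$ satisfy $n\,\mathbb P(|X_0|>a_n)\to1$. Let $N_{nj}=\sum_{t=1}^j\varepsilon_{a_n^{-1}X_t}$ for $j=1,\ldots,n$ and $N_n=N_{nn}$, regarded as point processes on $\overline{\mathbb R}^d_0$. Assume that there is an integer sequence $m_n\to\infty$ with $m_n=o(n)$ such that, with $k_n=[n/m_n]$: 1. (mixing) $\mathbb E e^{-\int g\,dN_n}-\big(\mathbb E e^{-\int g\,dN_{n,m_n}}\big)^{k_n}\to0$ for every $g\in\mathbb C_K^+$; 2. (anti-clustering) $\displaystyle\lim_{k\to\infty}\limsup_{n\to\infty}\mathbb P\Big(\max_{k\le i\le m_n}|X_i|>\delta a_n\ \Big|\ |X_0|>\delta a_n\Big)=0$ for every $\delta>0$. Then $N_n\to N$ in distribution (in the space of point measures on $\overline{\mathbb R}^d_0$ with the vague topology), where the point process $N$ has Laplace functional $$\mathbb E e^{-\int_{\overline{\mathbb R}_0^d}g\,dN}=\exp\Big(-\int_0^\infty\mathbb E\Big(e^{-\sum_{j=1}^\infty g(y\Theta_j)}-e^{-\sum_{j=0}^\infty g(y\Theta_j)}\Big)\,d(-y^{-\alpha})\Big),\qquad g\in\mathbb C_K^+ .$$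
   Context: $|\cdot|$ is the Euclidean norm; $\varepsilon_x$ is the Dirac measure at $x$; $[\cdot]$ is the integer part; $d(-y^{-\alpha})=\alpha y^{-\alpha-1}dy$. $\overline{\mathbb R}^d_0=\overline{\mathbb R}^d\setminus\{0\}$ with $\overline{\mathbb R}=\mathbb R\cup\{\pm\infty\}$; compact sets in $\overline{\mathbb R}^d_0$ are bounded away from the origin. $\mathbb C_K^+$ is the set of non-negative continuous functions on $\overline{\mathbb R}^d_0$ with compact support (extended by $g(0)=0$). Regular variation. A random vector $V$ is regularly varying with index $\alpha>0$ if there is a random vector $\Theta$ on the unit sphere such that for every $u>0$, $\mathbb P(|V|>ux,\,V/|V|\in\cdot)/\mathbb P(|V|>x)\to u^{-\alpha}\mathbb P(\Theta\in\cdot)$ weakly as $x\to\infty$. A strictly stationary sequence $(X_t)$ is regularly varying with index $\alpha$ if $(X_1,\ldots,X_k)$ is regularly varying with index $\alpha$ for every $k\ge1$. Equivalently, there is a sequence $(Y_t)_{t\in\mathbb Z}$ (the tail process) with $\mathbb P(|Y_0|>y)=y^{-\alpha}$ for $y>1$ and, for every $k\ge0$, $\mathbb P(x^{-1}(X_{-k},\ldots,X_k)\in\cdot\mid|X_0|>x)\to\mathbb P((Y_{-k},\ldots,Y_k)\in\cdot)$ weakly as $x\to\infty$. The spectral tail process is $\Theta_t=Y_t/|Y_0|$, $t\in\mathbb Z$; it is independent of $|Y_0|$, and $|\Theta_0|=1$. *)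

theory Defs
  imports "HOL-Probability.Probability"
begin

subsection \<open>Weak convergence\<close>

definition borel_of_topology :: "'a topology \<Rightarrow> 'a measure" where
  "borel_of_topology T = sigma (topspace T) {U. openin T U}"

text \<open>
  Weak convergence of a family of (finite) measures on the Borel sets of a topological space
  to a measure \<open>\<nu>\<close>, along an arbitrary filter on the index.
\<close>

definition weakly_converges ::
  "'a topology \<Rightarrow> ('i \<Rightarrow> 'a measure) \<Rightarrow> 'a measure \<Rightarrow> 'i filter \<Rightarrow> bool" where
  "weakly_converges T \<mu> \<nu> F \<longleftrightarrow>
     (\<forall>f. continuous_map T euclideanreal f \<longrightarrow> bounded (f ` topspace T) \<longrightarrow>
        ((\<lambda>i. \<integral>x. f x \<partial>\<mu> i) \<longlongrightarrow> (\<integral>x. f x \<partial>\<nu>)) F)"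

definition converges_in_distribution ::
  "'a topology \<Rightarrow> 'w measure \<Rightarrow> (nat \<Rightarrow> 'w \<Rightarrow> 'a) \<Rightarrow> 'v measure \<Rightarrow> ('v \<Rightarrow> 'a) \<Rightarrow> bool" where
  "converges_in_distribution T M Z P W \<longleftrightarrow>
     (\<forall>n. Z n \<in> measurable M (borel_of_topology T)) \<and>
     W \<in> measurable P (borel_of_topology T) \<and>
     weakly_converges T (\<lambda>n. distr M (borel_of_topology T) (Z n))
       (distr P (borel_of_topology T) W) sequentially"


subsection \<open>Stationarity, regular variation, tail process\<close>

definition strictly_stationary :: "'w measure \<Rightarrow> (int \<Rightarrow> 'w \<Rightarrow> real ^ 'd) \<Rightarrow> bool" where
  "strictly_stationary M X \<longleftrightarrow>
     (\<forall>h. distr M (PiM UNIV (\<lambda>_. borel)) (\<lambda>\<omega> t. X (t + h) \<omega>) =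
          distr M (PiM UNIV (\<lambda>_. borel)) (\<lambda>\<omega> t. X t \<omega>))"

text \<open>
  The number of blocks varies within the definition of a regularly varying sequence, so the
  vector formed by the blocks \<open>V i\<close>, \<open>i \<in> I\<close>, is an element of the finite product
  over \<open>I\<close>, i.e. an extensional function.  Its Euclidean norm is the \<open>L2_set\<close> norm of the
  norms of the blocks.
\<close>

definition block_norm :: "'i set \<Rightarrow> ('i \<Rightarrow> real ^ 'd) \<Rightarrow> real" where
  "block_norm I v = L2_set (\<lambda>i. norm (v i)) I"

abbreviation block_topology :: "'i set \<Rightarrow> ('i \<Rightarrow> real ^ 'd) topology" where
  "block_topology I \<equiv> product_topology (\<lambda>_. euclidean) I"

abbreviation block_borel :: "'i set \<Rightarrow> ('i \<Rightarrow> real ^ 'd) measure" where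
  "block_borel I \<equiv> PiM I (\<lambda>_. borel)"

text \<open>
  The measure below assigns to \<open>A\<close> the value
  \<open>P(|V| > u x, V / |V| \<in> A) / P(|V| > x)\<close>; \<open>\<nu>\<close> is the law of the
  limiting random vector on the unit sphere.
\<close>

definition regularly_varying_vector ::
  "'w measure \<Rightarrow> 'i set \<Rightarrow> ('w \<Rightarrow> 'i \<Rightarrow> real ^ 'd) \<Rightarrow> real \<Rightarrow> bool" where
  "regularly_varying_vector M I V \<alpha> \<longleftrightarrow>
     (\<exists>\<nu>. prob_space \<nu> \<and> sets \<nu> = sets (block_borel I) \<and> (AE \<theta> in \<nu>. block_norm I \<theta> = 1) \<and>
        (\<forall>u>0. weakly_converges (block_topology I)
           (\<lambda>x. distr
              (density M (\<lambda>\<omega>. indicator {\<omega> \<in> space M. block_norm I (V \<omega>) > u * x} \<omega> /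
                               emeasure M {\<omega> \<in> space M. block_norm I (V \<omega>) > x}))
              (block_borel I) (\<lambda>\<omega>. \<lambda>i\<in>I. V \<omega> i /\<^sub>R block_norm I (V \<omega>)))
           (scale_measure (ennreal (u powr (-\<alpha>))) \<nu>)
           at_top))"

definition regularly_varying :: "'w measure \<Rightarrow> (int \<Rightarrow> 'w \<Rightarrow> real ^ 'd) \<Rightarrow> real \<Rightarrow> bool" where
  "regularly_varying M X \<alpha> \<longleftrightarrow>
     (\<forall>k\<ge>1. regularly_varying_vector M {1..k} (\<lambda>\<omega>. \<lambda>t\<in>{1..k}. X t \<omega>) \<alpha>)"

text \<open>The tail process \<open>Y\<close> may live on a probability space \<open>Q\<close> of its own.\<close>

definition tail_process ::
  "'w measure \<Rightarrow> (int \<Rightarrow> 'w \<Rightarrow> real ^ 'd) \<Rightarrow> real \<Rightarrow> 'v measure \<Rightarrow> (int \<Rightarrow> 'v \<Rightarrow> real ^ 'd) \<Rightarrow> bool" where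
  "tail_process M X \<alpha> Q Y \<longleftrightarrow>
     prob_space Q \<and> (\<forall>t. Y t \<in> borel_measurable Q) \<and>
     (\<forall>y>1. \<P>(\<omega> in Q. norm (Y 0 \<omega>) > y) = y powr (-\<alpha>)) \<and>
     (\<forall>k\<ge>0. weakly_converges (block_topology {-k..k})
        (\<lambda>x. distr (uniform_measure M {\<omega> \<in> space M. norm (X 0 \<omega>) > x})
               (block_borel {-k..k}) (\<lambda>\<omega>. \<lambda>t\<in>{-k..k}. X t \<omega> /\<^sub>R x))
        (distr Q (block_borel {-k..k}) (\<lambda>\<omega>. \<lambda>t\<in>{-k..k}. Y t \<omega>))
        at_top)"

definition spectral_tail :: "(int \<Rightarrow> 'v \<Rightarrow> real ^ 'd) \<Rightarrow> int \<Rightarrow> 'v \<Rightarrow> real ^ 'd" where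
  "spectral_tail Y t \<omega> = Y t \<omega> /\<^sub>R norm (Y 0 \<omega>)"


subsection \<open>Point processes on the punctured compactified space\<close>

definition emb :: "real ^ 'd \<Rightarrow> ereal ^ 'd" where
  "emb x = (\<chi> i. ereal (x $ i))"

definition punctured_borel :: "(ereal ^ 'd) measure" where
  "punctured_borel = restrict_space borel (- {0})"

text \<open>
  The class of test functions; a subset of the punctured space is compact there iff it is compact
  in the whole space and does not contain the origin.
\<close>

definition CK_plus :: "(ereal ^ 'd \<Rightarrow> real) set" where
  "CK_plus = {g. continuous_on (- {0}) g \<and> (\<forall>z. 0 \<le> g z) \<and> g 0 = 0 \<and>
                 (\<exists>K. compact K \<and> 0 \<notin> K \<and> (\<forall>z. z \<notin> K \<longrightarrow> g z = 0))}"

text \<open>Point measures: integer-valued measures that are finite on compact sets.\<close>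

definition point_measures :: "(ereal ^ 'd) measure set" where
  "point_measures = {\<mu>. sets \<mu> = sets punctured_borel \<and>
     (\<forall>K. compact K \<longrightarrow> 0 \<notin> K \<longrightarrow> emeasure \<mu> K < \<infinity>) \<and>
     (\<forall>A\<in>sets \<mu>. emeasure \<mu> A = \<infinity> \<or> (\<exists>n::nat. emeasure \<mu> A = of_nat n))}"

text \<open>The coarsest topology making \<open>\<mu> \<mapsto> \<integral>g d\<mu>\<close> continuous for all test functions \<open>g\<close>.\<close>

definition vague_topology :: "(ereal ^ 'd) measure topology" where
  "vague_topology = topology_generated_by
     {{\<mu> \<in> point_measures. (\<integral>z. g z \<partial>\<mu>) \<in> U} | g U. g \<in> CK_plus \<and> open U}"

definition point_process :: "'w measure \<Rightarrow> ('w \<Rightarrow> (ereal ^ 'd) measure) \<Rightarrow> bool" where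
  "point_process M N \<longleftrightarrow> N \<in> measurable M (borel_of_topology vague_topology)"

definition laplace_functional ::
  "'w measure \<Rightarrow> ('w \<Rightarrow> (ereal ^ 'd) measure) \<Rightarrow> (ereal ^ 'd \<Rightarrow> real) \<Rightarrow> real" where
  "laplace_functional M N g = (\<integral>\<omega>. exp (- (\<integral>z. g z \<partial>N \<omega>)) \<partial>M)"

text \<open>
  The sum of the Dirac measures at \<open>X t \<omega> / a n\<close>, \<open>t = 1, \<dots>, j\<close>, restricted to the
  punctured space: points at the origin are not counted.
\<close>

definition sample_process ::
  "(int \<Rightarrow> 'w \<Rightarrow> real ^ 'd) \<Rightarrow> (nat \<Rightarrow> real) \<Rightarrow> nat \<Rightarrow> nat \<Rightarrow> 'w \<Rightarrow> (ereal ^ 'd) measure" where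
  "sample_process X a n j \<omega> =
     measure_of (space punctured_borel) (sets punctured_borel)
       (\<lambda>A. \<Sum>t=1..j. indicator A (emb (X (int t) \<omega> /\<^sub>R a n)))"

end

theory Submission
  imports Defs
begin

text \<open>
  By mixing, the limit of the Laplace functionals of \<open>N\<^sub>n\<close> is governed by
  \<open>k\<^sub>n (1 - E exp (- \<Sum>\<^sub>t g (X\<^sub>t / a\<^sub>n)))\<close> for a single block \<open>t \<le> m\<^sub>n\<close>.  Telescoping and
  stationarity turn the bracket into the sum over \<open>l < m\<^sub>n\<close> of
  \<open>E (1 - exp (- g (X\<^sub>0 / a\<^sub>n))) exp (- \<Sum>\<^bsub>1 \<le> t \<le> l\<^esub> g (X\<^sub>t / a\<^sub>n))\<close>.  Anti-clustering permits replacing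
  \<open>l\<close> by a fixed large \<open>k\<close>, the tail process gives the limit for fixed \<open>k\<close>, and since \<open>|Y\<^sub>0|\<close>
  is Pareto and independent of the spectral tail process, this limit is the integral of the
  statement.

  For the existence of \<open>N\<close>, the points of \<open>N\<^sub>n\<close> are encoded by a sequence of bits.  The laws of
  these sequences converge along a subsequence (Helly and Skorohod, applied to the Cantor code of
  the bits), and decoding the limit yields \<open>N\<close>, because
  \<open>n P (|X\<^sub>0| > \<epsilon> a\<^sub>n)\<close> stays bounded for every \<open>\<epsilon> > 0\<close>.  Convergence in distribution of the whole
  sequence then follows from that of the Laplace functionals by the Stone--Weierstrass theorem on
  compact sets of configurations, for the algebra generated by the functions
  \<open>\<mu> \<mapsto> exp (- \<integral>g d\<mu>)\<close>.
\<close>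

section \<open>Limits of random bit sequences\<close>

text \<open>Two obstacles shape the proof. Convergence in law of point processes needs compactness.
  Bits provide it: the space of all codes is compact, so a limit law of codes exists, and only the
  decoding has to be controlled. It is continuous merely on the sets \<open>bounded_codes c\<close>,
  where each level around the origin holds a bounded number of points; the bound on expected
  exceedances enters here. Two digit systems serve different needs: coordinates of points must take
  every value of an interval, hence binary digits, whose decoding is continuous though not
  injective; a whole bit sequence must be readable from a limit of codes, hence ternary digits
  without 1. The tail process, on the other hand, is given by conditional limits above the level x,
  while a test function sees all points of norm above some small \<delta>. Conditioning at \<delta>
  times the normalisation costs a factor \<open>\<delta> powr (-\<alpha>)\<close>, which a
  substitution in the final integral absorbs. The independence of the norm of \<open>Y 0\<close> and
  the spectral process is not part of \<open>tail_process\<close>; it is derived by computing one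
  limit at two scales.\<close>

lemma continuous_on_of_bool_coordinate:
  "continuous_on A (\<lambda>b::'i \<Rightarrow> bool. (of_bool (b i) :: 'b::{real_normed_vector, zero_neq_one}))"
  by (rule continuous_on_subset[OF continuous_on_compose2[of UNIV of_bool UNIV "\<lambda>b. b i"]])
     (auto intro: continuous_on_product_coordinates)

text \<open>Digit 0 is the coefficient of 1/2: doubling k + 1 times moves digit k to the units
  place, where parity reads it off.\<close>

definition bindig :: "real \<Rightarrow> nat \<Rightarrow> bool" where
  "bindig v k \<longleftrightarrow> odd \<lfloor>2 ^ Suc k * v\<rfloor>"

definition binval :: "(nat \<Rightarrow> bool) \<Rightarrow> real" where
  "binval b = (\<Sum>k. of_bool (b k) * (1/2) ^ Suc k)"

lemma summable_binval: "summable (\<lambda>k. of_bool (b k) * (1/2 :: real) ^ Suc k)"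
  by (rule summable_comparison_test'[of "\<lambda>k. (1/2::real) ^ Suc k" 0])
     (auto intro!: summable_mult summable_geometric)

lemma suminf_half_powers: "(\<Sum>k. (1/2::real) ^ Suc k) = 1"
  using power_half_series by (simp add: sums_iff)

lemma binval_ge_0: "0 \<le> binval b"
  unfolding binval_def by (intro suminf_nonneg summable_binval) auto

lemma binval_le_1: "binval b \<le> 1"
proof -
  have "binval b \<le> (\<Sum>k. (1/2::real) ^ Suc k)"
    unfolding binval_def using power_half_series
    by (intro suminf_le summable_binval) (auto simp: sums_iff)
  then show ?thesis by (simp only: suminf_half_powers)
qed

lemma continuous_binval: "continuous_on A binval"
proof -
  have "uniform_limit UNIV (\<lambda>n b. \<Sum>k<n. of_bool (b k) * (1/2 :: real) ^ Suc k)
          (\<lambda>b. \<Sum>k. of_bool (b k) * (1/2) ^ Suc k) sequentially"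
    using power_half_series by (intro Weierstrass_m_test[where M="\<lambda>k. (1/2)^Suc k"]) (auto simp: sums_iff)
  then have "continuous_on UNIV (\<lambda>b. \<Sum>k. of_bool (b k) * (1/2 :: real) ^ Suc k)"
    by (rule uniform_limit_theorem[rotated])
       (auto intro!: always_eventually continuous_intros continuous_on_of_bool_coordinate)
  then have "continuous_on UNIV binval"
    by (simp add: binval_def[abs_def])
  then show ?thesis
    by (rule continuous_on_subset) auto
qed

lemma floor_double: "\<lfloor>2 * x\<rfloor> = 2 * \<lfloor>x :: real\<rfloor> + of_bool (odd \<lfloor>2 * x\<rfloor>)"
proof -
  have "\<lfloor>2 * x\<rfloor> = 2 * \<lfloor>x\<rfloor> \<or> \<lfloor>2 * x\<rfloor> = 2 * \<lfloor>x\<rfloor> + 1"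
    by linarith
  then show ?thesis by auto
qed

text \<open>The first n digits sum to the dyadic truncation
  \<open>\<lfloor>2 ^ n * v\<rfloor> / 2 ^ n\<close>, which is within \<open>(1/2) ^ n\<close> of v.
  At v = 1 all digits read off in this way vanish, hence the strict upper bound.\<close>

lemma binval_bindig:
  assumes "0 \<le> v" "v < 1"
  shows "binval (bindig v) = v"
proof -
  have partial: "(\<Sum>k<n. of_bool (bindig v k) * (1/2) ^ Suc k) = real_of_int \<lfloor>2 ^ n * v\<rfloor> / 2 ^ n" for n
  proof (induction n)
    case 0
    have "\<lfloor>v\<rfloor> = 0" using assms by linarith
    then show ?case by simp
  next
    case (Suc n)
    have "real_of_int \<lfloor>2 ^ Suc n * v\<rfloor> = 2 * real_of_int \<lfloor>2 ^ n * v\<rfloor> + of_bool (bindig v n)"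
      using arg_cong[OF floor_double[of "2 ^ n * v"], of real_of_int]
      by (simp only: bindig_def power_Suc mult.assoc of_int_add of_int_mult of_int_numeral of_int_of_bool)
    then have "real_of_int \<lfloor>2 ^ Suc n * v\<rfloor> / 2 ^ Suc n =
        real_of_int \<lfloor>2 ^ n * v\<rfloor> / 2 ^ n + of_bool (bindig v n) * (1/2) ^ Suc n"
      by (simp only: add_divide_distrib power_one_over) simp
    then show ?case
      using Suc.IH by simp
  qed
  have "(\<lambda>n. real_of_int \<lfloor>2 ^ n * v\<rfloor> / 2 ^ n) \<longlonglongrightarrow> v"
  proof (rule LIM_zero_cancel, rule Lim_null_comparison[OF always_eventually, rule_format])
    show "norm (real_of_int \<lfloor>2 ^ n * v\<rfloor> / 2 ^ n - v) \<le> (1/2) ^ n" for n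
    proof -
      have "\<bar>real_of_int \<lfloor>2 ^ n * v\<rfloor> - 2 ^ n * v\<bar> \<le> 1" by linarith
      then have "\<bar>real_of_int \<lfloor>2 ^ n * v\<rfloor> - 2 ^ n * v\<bar> / 2 ^ n \<le> 1 / 2 ^ n"
        by (intro divide_right_mono) auto
      also have "\<bar>real_of_int \<lfloor>2 ^ n * v\<rfloor> - 2 ^ n * v\<bar> / 2 ^ n = \<bar>(real_of_int \<lfloor>2 ^ n * v\<rfloor> - 2 ^ n * v) / 2 ^ n\<bar>"
        by simp
      also have "(real_of_int \<lfloor>2 ^ n * v\<rfloor> - 2 ^ n * v) / 2 ^ n = real_of_int \<lfloor>2 ^ n * v\<rfloor> / 2 ^ n - v"
        by (simp add: field_simps)
      finally show ?thesis by (simp add: power_one_over)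
    qed
    show "(\<lambda>n. (1/2::real) ^ n) \<longlonglongrightarrow> 0" by (simp add: LIMSEQ_power_zero)
  qed
  then have "(\<lambda>k. of_bool (bindig v k) * (1/2) ^ Suc k) sums v"
    unfolding sums_def partial .
  then show ?thesis by (simp add: binval_def sums_iff)
qed

text \<open>Avoiding the ternary digit 1 makes the digits continuous on the closed set of codes.\<close>

definition cval :: "(nat \<Rightarrow> bool) \<Rightarrow> real" where
  "cval b = (\<Sum>k. of_bool (b k) * (2 * (1/3) ^ Suc k))"

text \<open>On the Cantor set this step deletes the leading ternary digit, 0 or 2. It acts on the
  argument, so that induction over k for arbitrary codes shifts the bit sequence. The threshold 1/2
  lies in the gap between 1/3 and 2/3.\<close>

primrec cstate :: "nat \<Rightarrow> real \<Rightarrow> real" where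
  "cstate 0 y = y"
| "cstate (Suc k) y = cstate k (if y > 1/2 then 3 * y - 2 else 3 * y)"

definition cdig :: "real \<Rightarrow> nat \<Rightarrow> bool" where
  "cdig y k \<longleftrightarrow> cstate k y > 1/2"

lemma third_powers_sums: "(\<lambda>k. 2 * (1/3::real) ^ Suc k) sums 1"
  using sums_mult[OF geometric_sums[of "1/3::real"], of "2/3"] by (simp add: field_simps)

lemma summable_cval: "summable (\<lambda>k. of_bool (b k) * (2 * (1/3 :: real) ^ Suc k))"
  by (rule summable_comparison_test'[OF sums_summable[OF third_powers_sums], of 0]) simp

lemma cval_ge_0: "0 \<le> cval b"
  unfolding cval_def by (intro suminf_nonneg summable_cval) auto

lemma cval_le_1: "cval b \<le> 1"
proof -
  have "cval b \<le> (\<Sum>k. 2 * (1/3::real) ^ Suc k)"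
    unfolding cval_def
    by (intro suminf_le summable_cval sums_summable[OF third_powers_sums]) simp
  then show ?thesis by (simp only: sums_unique[OF third_powers_sums, symmetric])
qed

lemma cval_step: "cval b = (2 * of_bool (b 0) + cval (\<lambda>k. b (Suc k))) / 3"
proof -
  have "cval b = (\<Sum>k. of_bool (b (Suc k)) * (2 * (1/3::real) ^ Suc (Suc k))) + of_bool (b 0) * (2 * (1/3) ^ Suc 0)"
    unfolding cval_def using suminf_split_head[OF summable_cval[of b]] by simp
  also have "(\<Sum>k. of_bool (b (Suc k)) * (2 * (1/3::real) ^ Suc (Suc k))) = cval (\<lambda>k. b (Suc k)) / 3"
    unfolding cval_def using suminf_divide[OF summable_cval[of "\<lambda>k. b (Suc k)"], of 3]
    by (simp add: field_simps)
  finally show ?thesis by simp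
qed

lemma cval_cases:
  "(b 0 \<longrightarrow> 2/3 \<le> cval b) \<and> (\<not> b 0 \<longrightarrow> cval b \<le> 1/3)"
  using cval_step[of b] cval_ge_0[of "\<lambda>k. b (Suc k)"] cval_le_1[of "\<lambda>k. b (Suc k)"] by auto

lemma cval_shift:
  "(if cval b > 1/2 then 3 * cval b - 2 else 3 * cval b) = cval (\<lambda>j. b (Suc j))"
  using cval_cases[of b] cval_step[of b] by (cases "b 0") auto

lemma cstate_cval: "cstate k (cval b) = cval (\<lambda>j. b (j + k))"
proof (induction k arbitrary: b)
  case (Suc k)
  show ?case using Suc[of "\<lambda>j. b (Suc j)"] by (simp only: cstate.simps cval_shift add_Suc_right add_Suc)
qed simp

lemma cdig_cval [simp]: "cdig (cval b) = b"
proof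
  show "cdig (cval b) k = b k" for k
    using cval_cases[of "\<lambda>j. b (j + k)"] by (auto simp: cdig_def cstate_cval)
qed

text \<open>The test at 1/2 is discontinuous, but no code lies strictly between 1/3 and 2/3, so a
  convergent sequence of codes cannot cross the threshold infinitely often.\<close>

lemma cval_limit_half:
  assumes "y \<longlonglongrightarrow> l" and "\<And>n. y n \<in> range cval"
  shows "\<forall>\<^sub>F n in sequentially. (y n > 1/2) = (l > 1/2)"
proof (cases "l > 1/2")
  case True
  show ?thesis
    using order_tendstoD(1)[OF assms(1) True] by (rule eventually_mono) (use True in simp)
next
  case False
  then have "l < 2/3" by simp
  from order_tendstoD(2)[OF assms(1) this] show ?thesis
  proof (rule eventually_mono)
    fix n assume n: "y n < 2/3"
    obtain b where b: "y n = cval b" using assms(2)[of n] by (rule rangeE)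
    have "cval b \<le> 1/3"
      using cval_cases[of b] n b by (cases "b 0") auto
    then show "(y n > 1/2) = (l > 1/2)" using False b by simp
  qed
qed

text \<open>Deleting the leading digit is continuous along the sequence because its branch is
  eventually constant, and it maps codes to codes. Digit k thus reduces to digit 0 of a shifted
  sequence; the induction varies the sequence and its limit.\<close>

lemma cdig_eventually_eq:
  assumes "y \<longlonglongrightarrow> l" and "\<And>n. y n \<in> range cval"
  shows "\<forall>\<^sub>F n in sequentially. cdig (y n) k = cdig l k"
  using assms
proof (induction k arbitrary: y l)
  case 0
  then show ?case using cval_limit_half by (simp add: cdig_def)
next
  case (Suc k)
  define s where "s y = (if y > 1/2 then 3 * y - 2 else 3 * y)" for y :: real
  have ev: "\<forall>\<^sub>F n in sequentially. (y n > 1/2) = (l > 1/2)"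
    by (rule cval_limit_half) (fact Suc.prems)+
  have "(\<lambda>n. if l > 1/2 then 3 * y n - 2 else 3 * y n) \<longlonglongrightarrow> s l"
    using Suc.prems(1) by (cases "l > 1/2") (simp_all add: s_def tendsto_diff tendsto_mult_left)
  moreover have "\<forall>\<^sub>F n in sequentially. (if l > 1/2 then 3 * y n - 2 else 3 * y n) = s (y n)"
    using ev by (rule eventually_mono) (simp only: s_def)
  ultimately have "(\<lambda>n. s (y n)) \<longlonglongrightarrow> s l"
    by (rule Lim_transform_eventually)
  moreover have "s (y n) \<in> range cval" for n
  proof -
    obtain b where b: "y n = cval b" using Suc.prems(2)[of n] by (rule rangeE)
    show ?thesis unfolding b s_def cval_shift by (rule rangeI)
  qed
  ultimately have "\<forall>\<^sub>F n in sequentially. cdig (s (y n)) k = cdig (s l) k"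
    by (rule Suc.IH)
  then show ?case by (simp add: cdig_def s_def)
qed

lemma measurable_cstate [measurable]: "cstate k \<in> borel_measurable borel"
proof (induction k)
  case (Suc k)
  note Suc[measurable]
  show ?case by simp
qed simp

lemma measurable_cdig [measurable]: "Measurable.pred borel (\<lambda>y. cdig y k)"
  unfolding cdig_def by measurable

lemma measurable_cval:
  assumes [measurable]: "\<And>k. Measurable.pred M (\<lambda>\<omega>. b \<omega> k)"
  shows "(\<lambda>\<omega>. cval (b \<omega>)) \<in> borel_measurable M"
  unfolding cval_def by measurable

text \<open>Second countability makes a coordinatewise measurable map into a countable product of
  bits Borel measurable.\<close>

instance bool :: second_countable_topology
proof
  have "generate_topology UNIV S" for S :: "bool set"
    by (rule generate_topology.Basis) simp
  then have "open = generate_topology (UNIV :: bool set set)"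
    by (intro ext) (simp add: discrete_topology_class.open_discrete)
  then show "\<exists>B :: bool set set. countable B \<and> open = generate_topology B"
    by (intro exI[of _ UNIV]) (auto intro: countable_finite)
qed

lemma tendsto_fun_coordinatewise:
  fixes f :: "'a \<Rightarrow> 'i \<Rightarrow> 'b::topological_space"
  assumes "\<And>i. ((\<lambda>x. f x i) \<longlongrightarrow> l i) F"
  shows "(f \<longlongrightarrow> l) F"
  using assms limitin_componentwise[of "\<lambda>_::'i. euclidean :: 'b topology" UNIV f l F]
  by (simp add: euclidean_product_topology)

lemma compact_UNIV_bool_fun: "compact (UNIV :: ('i \<Rightarrow> bool) set)"
proof -
  have "compact_space (product_topology (\<lambda>_::'i. euclidean :: bool topology) UNIV)"
    by (subst compact_space_product_topology) (simp add: compact_space_def finite_imp_compact)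
  then show ?thesis
    by (simp add: compact_space_def euclidean_product_topology)
qed

lemma bounded_continuous_bool_fun:
  fixes F :: "('i \<Rightarrow> bool) \<Rightarrow> real"
  assumes "continuous_on UNIV F"
  obtains B where "0 \<le> B" "\<And>b. \<bar>F b\<bar> \<le> B"
proof -
  have "bounded (range F)"
    by (intro compact_imp_bounded compact_continuous_image assms compact_UNIV_bool_fun)
  then obtain B where "\<And>b. \<bar>F b\<bar> \<le> B" by (auto simp: bounded_iff)
  moreover from this[of undefined] have "0 \<le> B" by linarith
  ultimately show ?thesis by (rule that[rotated])
qed

lemma borel_measurable_bool_fun:
  fixes f :: "'a \<Rightarrow> 'i::countable \<Rightarrow> bool"
  assumes "\<And>i. Measurable.pred M (\<lambda>\<omega>. f \<omega> i)"
  shows "f \<in> borel_measurable M"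
proof (rule measurable_coordinatewise_then_product)
  fix i
  have "(\<lambda>\<omega>. f \<omega> i) \<in> measurable M (count_space UNIV)" using assms by simp
  then show "(\<lambda>\<omega>. f \<omega> i) \<in> borel_measurable M"
    by (rule measurable_compose) simp
qed

text \<open>All bits are packed into one number of the Cantor set, where tightness is free. The
  Skorohod representation gives pointwise convergence of these numbers, and every digit stabilises
  along a convergent sequence of codes. Continuous functions of the bits are bounded, so their
  expectations follow by dominated convergence.\<close>

theorem bool_fun_convergent_subsequence:
  fixes \<xi> :: "nat \<Rightarrow> 'w \<Rightarrow> 'i::countable \<Rightarrow> bool"
  assumes "prob_space M" and meas: "\<And>n i. Measurable.pred M (\<lambda>\<omega>. \<xi> n \<omega> i)"
  obtains r P \<zeta> where "strict_mono r" "prob_space (P :: real measure)"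
    "\<And>i. Measurable.pred P (\<lambda>\<omega>. \<zeta> \<omega> i)"
    "\<And>F. continuous_on UNIV F \<Longrightarrow>
       (\<lambda>n. \<integral>\<omega>. F (\<xi> (r n) \<omega>) \<partial>M) \<longlonglongrightarrow> (\<integral>\<omega>. (F (\<zeta> \<omega>) :: real) \<partial>P)"
proof -
  interpret M: prob_space M by fact
  define W where "W n \<omega> = cval (\<lambda>k. \<xi> n \<omega> (from_nat k))" for n \<omega>
  have W[measurable]: "W n \<in> borel_measurable M" for n
    unfolding W_def using meas by (rule measurable_cval)
  define \<mu> where "\<mu> n = distr M borel (W n)" for n
  have \<mu>: "real_distribution (\<mu> n)" for n
    unfolding \<mu>_def by (rule M.real_distribution_distr) (rule W)
  have "tight \<mu>"
    unfolding tight_def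
  proof (intro conjI allI impI \<mu>)
    fix e :: real assume "e > 0"
    \<comment> \<open>Tightness speaks of intervals open on the left, and \<open>cval\<close>
      attains 0.\<close>
    have "measure (\<mu> n) {-1<..1} = 1" for n
    proof -
      have *: "W n -` {-1<..1} \<inter> space M = space M"
        using cval_le_1 less_le_trans[OF _ cval_ge_0, of "-1"] by (auto simp: W_def)
      show ?thesis by (simp add: \<mu>_def measure_distr * M.prob_space)
    qed
    then show "\<exists>a b. a < b \<and> (\<forall>n. 1 - e < measure (\<mu> n) {a<..b})"
      using \<open>e > 0\<close> by (intro exI[of _ "-1"] exI[of _ 1]) auto
  qed
  from tight_imp_convergent_subsubsequence[OF this, of "\<lambda>n. n"]
  obtain r L where r: "strict_mono r" "real_distribution L" "weak_conv_m (\<lambda>n. \<mu> (r n)) L"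
    by (auto simp: o_def strict_mono_def)
  from Skorohod[OF \<mu> r(2,3)] obtain P :: "real measure" and U V where P: "prob_space P"
    and U[measurable]: "\<And>n. U n \<in> borel_measurable P" and dU: "\<And>n. distr P borel (U n) = \<mu> (r n)"
    and V: "V \<in> measurable P lborel" and conv: "\<And>x. x \<in> space P \<Longrightarrow> (\<lambda>n. U n x) \<longlonglongrightarrow> V x"
    by blast
  interpret P: prob_space P by fact
  have V[measurable]: "V \<in> borel_measurable P" using V by simp
  define \<zeta> where "\<zeta> \<omega> i = cdig (V \<omega>) (to_nat i)" for \<omega> and i :: 'i
  \<comment> \<open>The Skorohod copies agree with the codes only in law, so being a code is known
    almost surely; the equation \<open>cval (cdig y) = y\<close> states it as a Borel
    condition.\<close>
  have U_cval: "AE \<omega> in P. \<forall>n. U n \<omega> \<in> {y. cval (cdig y) = y}"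
  proof (subst AE_all_countable, intro allI)
    fix n
    have [measurable]: "Measurable.pred borel (\<lambda>y. cval (cdig y) = y)"
      using measurable_cval[where M=borel and b=cdig] by simp
    have "AE y in \<mu> (r n). cval (cdig y) = y"
      unfolding \<mu>_def by (subst AE_distr_iff) (auto simp: W_def)
    then have "AE y in distr P borel (U n). cval (cdig y) = y" by (simp only: dU)
    then show "AE \<omega> in P. U n \<omega> \<in> {y. cval (cdig y) = y}"
      by (subst (asm) AE_distr_iff) auto
  qed
  show ?thesis
  proof (rule that[OF r(1) P])
    show "Measurable.pred P (\<lambda>\<omega>. \<zeta> \<omega> i)" for i
      unfolding \<zeta>_def by measurable
  next
    fix F :: "('i \<Rightarrow> bool) \<Rightarrow> real" assume F: "continuous_on UNIV F"
    obtain B where B: "0 \<le> B" "\<And>b. \<bar>F b\<bar> \<le> B" using F by (rule bounded_continuous_bool_fun) auto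
    define D where "D y i = cdig y (to_nat i)" for y and i :: 'i
    have D[measurable]: "(\<lambda>y. F (D y)) \<in> borel_measurable borel"
      by (rule measurable_compose[OF _ borel_measurable_continuous_onI[OF F]],
          rule borel_measurable_bool_fun) (simp add: D_def)
    have eq: "(\<integral>\<omega>. F (\<xi> (r n) \<omega>) \<partial>M) = (\<integral>\<omega>. F (D (U n \<omega>)) \<partial>P)" for n
    proof -
      have "(\<integral>\<omega>. F (D (U n \<omega>)) \<partial>P) = (\<integral>y. F (D y) \<partial>\<mu> (r n))"
        unfolding dU[symmetric] by (rule integral_distr[symmetric]) measurable
      also have "\<dots> = (\<integral>\<omega>. F (D (W (r n) \<omega>)) \<partial>M)"
        unfolding \<mu>_def by (rule integral_distr) measurable
      also have "\<dots> = (\<integral>\<omega>. F (\<xi> (r n) \<omega>) \<partial>M)"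
        by (simp add: D_def[abs_def] W_def)
      finally show ?thesis by simp
    qed
    have "(\<lambda>n. \<integral>\<omega>. F (D (U n \<omega>)) \<partial>P) \<longlonglongrightarrow> (\<integral>\<omega>. F (D (V \<omega>)) \<partial>P)"
    proof (rule integral_dominated_convergence[where w="\<lambda>_. B"])
      show "AE \<omega> in P. (\<lambda>n. F (D (U n \<omega>))) \<longlonglongrightarrow> F (D (V \<omega>))"
        using U_cval AE_space
      proof eventually_elim
        case (elim \<omega>)
        have "U n \<omega> \<in> range cval" for n
          using elim(1) by (metis (mono_tags) mem_Collect_eq rangeI)
        from cdig_eventually_eq[OF conv[OF elim(2)] this]
        have "(\<lambda>n. D (U n \<omega>) i) \<longlonglongrightarrow> D (V \<omega>) i" for i
          by (simp add: D_def tendsto_discrete)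
        then have "(\<lambda>n. D (U n \<omega>)) \<longlonglongrightarrow> D (V \<omega>)"
          by (rule tendsto_fun_coordinatewise)
        with F show ?case
          by (metis UNIV_I continuous_on_tendsto_compose eventually_sequentiallyI)
      qed
    qed (auto simp: B)
    then show "(\<lambda>n. \<integral>\<omega>. F (\<xi> (r n) \<omega>) \<partial>M) \<longlonglongrightarrow> (\<integral>\<omega>. F (\<zeta> \<omega>) \<partial>P)"
      unfolding eq by (simp add: D_def[abs_def] \<zeta>_def[abs_def])
  qed
qed

section \<open>The vague topology\<close>

text \<open>These instances lead to the Hausdorff property. It makes compact sets of codes and of
  points of \<open>ereal ^ 'd\<close> closed, and Stone-Weierstrass is applied on the function space
  in which \<open>evals\<close> takes its values.\<close>

instance "fun" :: (type, t0_space) t0_space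
proof
  fix x y :: "'a \<Rightarrow> 'b" assume "x \<noteq> y"
  then obtain i where i: "x i \<noteq> y i" by (metis ext)
  obtain U where U: "open U" "\<not> (x i \<in> U \<longleftrightarrow> y i \<in> U)"
    using separation_t0[THEN iffD1, OF i] by blast
  have "open ((\<lambda>z::'a\<Rightarrow>'b. z i) -` U)"
    using U(1) by (auto intro!: open_vimage)
  then show "\<exists>U. open U \<and> \<not> (x \<in> U \<longleftrightarrow> y \<in> U)"
    using U by (intro exI[of _ "(\<lambda>z. z i) -` U"]) auto
qed

instance "fun" :: (type, t1_space) t1_space
proof
  fix x y :: "'a \<Rightarrow> 'b" assume "x \<noteq> y"
  then obtain i where i: "x i \<noteq> y i" by (metis ext)
  obtain U where U: "open U" "x i \<in> U" "y i \<notin> U"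
    using separation_t1[THEN iffD1, OF i] by blast
  have "open ((\<lambda>z::'a\<Rightarrow>'b. z i) -` U)"
    using U(1) by (auto intro!: open_vimage)
  then show "\<exists>U. open U \<and> x \<in> U \<and> y \<notin> U"
    using U by (intro exI[of _ "(\<lambda>z. z i) -` U"]) auto
qed

instance "fun" :: (type, t2_space) t2_space
proof
  fix x y :: "'a \<Rightarrow> 'b" assume "x \<noteq> y"
  then obtain i where "x i \<noteq> y i" by (metis ext)
  then obtain U V where UV: "open U" "open V" "x i \<in> U" "y i \<in> V" "U \<inter> V = {}"
    using hausdorff[OF \<open>x i \<noteq> y i\<close>] by blast
  have "open ((\<lambda>z. z i) -` U)" "open ((\<lambda>z::'a\<Rightarrow>'b. z i) -` V)"
    using UV(1,2) by (auto intro!: open_vimage)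
  then show "\<exists>U V. open U \<and> open V \<and> x \<in> U \<and> y \<in> V \<and> U \<inter> V = {}"
    using UV by (intro exI[of _ "(\<lambda>z. z i) -` U"] exI[of _ "(\<lambda>z. z i) -` V"]) auto
qed

instance vec :: (t0_space, finite) t0_space
proof
  fix x y :: "('a, 'b) vec" assume "x \<noteq> y"
  then obtain i where i: "x $ i \<noteq> y $ i" by (auto simp: vec_eq_iff)
  obtain U where U: "open U" "\<not> (x $ i \<in> U \<longleftrightarrow> y $ i \<in> U)"
    using separation_t0[THEN iffD1, OF i] by blast
  have "open ((\<lambda>z::('a, 'b) vec. z $ i) -` U)"
    using U(1) by (auto intro!: open_vimage_vec_nth)
  then show "\<exists>U. open U \<and> \<not> (x \<in> U \<longleftrightarrow> y \<in> U)"
    using U by (intro exI[of _ "(\<lambda>z. z $ i) -` U"]) auto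
qed

instance vec :: (t1_space, finite) t1_space
proof
  fix x y :: "('a, 'b) vec" assume "x \<noteq> y"
  then obtain i where i: "x $ i \<noteq> y $ i" by (auto simp: vec_eq_iff)
  obtain U where U: "open U" "x $ i \<in> U" "y $ i \<notin> U"
    using separation_t1[THEN iffD1, OF i] by blast
  have "open ((\<lambda>z::('a, 'b) vec. z $ i) -` U)"
    using U(1) by (auto intro!: open_vimage_vec_nth)
  then show "\<exists>U. open U \<and> x \<in> U \<and> y \<notin> U"
    using U by (intro exI[of _ "(\<lambda>z. z $ i) -` U"]) auto
qed

instance vec :: (t2_space, finite) t2_space
proof
  fix x y :: "('a, 'b) vec" assume "x \<noteq> y"
  then obtain i where "x $ i \<noteq> y $ i" by (auto simp: vec_eq_iff)
  then obtain U V where UV: "open U" "open V" "x $ i \<in> U" "y $ i \<in> V" "U \<inter> V = {}"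
    using hausdorff[OF \<open>x $ i \<noteq> y $ i\<close>] by blast
  have "open ((\<lambda>z. z $ i) -` U)" "open ((\<lambda>z::('a, 'b) vec. z $ i) -` V)"
    using UV(1,2) by (auto intro!: open_vimage_vec_nth)
  then show "\<exists>U V. open U \<and> open V \<and> x \<in> U \<and> y \<in> V \<and> U \<inter> V = {}"
    using UV by (intro exI[of _ "(\<lambda>z. z $ i) -` U"] exI[of _ "(\<lambda>z. z $ i) -` V"]) auto
qed

section \<open>Test functions and the integrals they define on point measures\<close>

lemma CK_plus_nonneg: "g \<in> CK_plus \<Longrightarrow> 0 \<le> g z"
  by (simp add: CK_plus_def)

lemma CK_plus_zero: "g \<in> CK_plus \<Longrightarrow> g 0 = 0"
  by (simp add: CK_plus_def)

text \<open>Continuity is given away from the origin only. Around the origin g vanishes on the open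
  complement of its compact support, and the two open pieces cover the space.\<close>

lemma CK_plus_continuous:
  assumes "g \<in> CK_plus"
  shows "continuous_on A g"
proof -
  obtain K where K: "compact K" "0 \<notin> K" "\<And>z. z \<notin> K \<Longrightarrow> g z = 0"
    and g: "continuous_on (-{0}) g"
    using assms by (auto simp: CK_plus_def)
  have "closed K" using K(1) by (rule compact_imp_closed)
  have "continuous_on (-K) g"
    using K(3) by (subst continuous_on_cong[OF refl, of _ _ "\<lambda>_. 0"]) auto
  with g have "continuous_on (-{0} \<union> -K) g"
    using \<open>closed K\<close> by (intro continuous_on_open_Un) auto
  moreover have "-{0} \<union> -K = UNIV" using K(2) by auto
  ultimately show ?thesis by (metis continuous_on_subset subset_UNIV)
qed

lemma CK_plus_support:
  assumes "g \<in> CK_plus"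
  obtains U where "open U" "0 \<in> U" "\<And>z. z \<in> U \<Longrightarrow> g z = 0"
proof -
  obtain K where K: "compact K" "0 \<notin> K" "\<And>z. z \<notin> K \<Longrightarrow> g z = 0"
    using assms by (auto simp: CK_plus_def)
  show ?thesis
    by (rule that[of "- K"]) (use K in \<open>auto intro: compact_imp_closed\<close>)
qed

lemma CK_plus_0: "(\<lambda>_. 0) \<in> CK_plus"
  by (auto simp: CK_plus_def intro!: exI[of _ "{}"])

lemma CK_plus_add:
  assumes "g \<in> CK_plus" "h \<in> CK_plus"
  shows "(\<lambda>z. g z + h z) \<in> CK_plus"
proof -
  obtain K L where "compact K" "0 \<notin> K" "\<And>z. z \<notin> K \<Longrightarrow> g z = 0"
    "compact L" "0 \<notin> L" "\<And>z. z \<notin> L \<Longrightarrow> h z = 0"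
    using assms by (auto simp: CK_plus_def)
  then have "compact (K \<union> L)" "0 \<notin> K \<union> L" "\<forall>z. z \<notin> K \<union> L \<longrightarrow> g z + h z = 0"
    by (auto intro: compact_Un)
  with assms show ?thesis
    by (auto simp: CK_plus_def intro!: continuous_on_add exI[of _ "K \<union> L"])
qed

lemma CK_plus_bounded:
  assumes "g \<in> CK_plus"
  obtains B where "0 \<le> B" "\<And>z. g z \<le> B"
proof -
  obtain K where K: "compact K" "\<And>z. z \<notin> K \<Longrightarrow> g z = 0"
    using assms by (auto simp: CK_plus_def)
  have "bounded (g ` K)"
    by (intro compact_imp_bounded compact_continuous_image CK_plus_continuous assms K)
  then obtain B where "\<forall>z\<in>K. \<bar>g z\<bar> \<le> B" by (auto simp: bounded_iff)
  then have "g z \<le> max B 0" for z using K(2)[of z] by (cases "z \<in> K") auto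
  then show ?thesis by (intro that[of "max B 0"]) auto
qed

lemma space_punctured_borel: "space punctured_borel = -{0}"
  by (simp add: punctured_borel_def space_restrict_space)

lemma CK_plus_borel: "g \<in> CK_plus \<Longrightarrow> g \<in> borel_measurable borel"
  by (rule borel_measurable_continuous_onI) (rule CK_plus_continuous)

lemma CK_plus_measurable: "g \<in> CK_plus \<Longrightarrow> g \<in> borel_measurable punctured_borel"
  unfolding punctured_borel_def by (intro measurable_restrict_space1 CK_plus_borel)

lemma point_measures_integrable:
  assumes "\<mu> \<in> point_measures" "g \<in> CK_plus"
  shows "integrable \<mu> g"
proof -
  obtain K where K: "compact K" "0 \<notin> K" "\<And>z. z \<notin> K \<Longrightarrow> g z = 0"
    using assms by (auto simp: CK_plus_def)
  have sets: "sets \<mu> = sets punctured_borel" and fin: "emeasure \<mu> K < \<infinity>"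
    using assms(1) K by (auto simp: point_measures_def)
  have sp: "space \<mu> = -{0}" using sets_eq_imp_space_eq[OF sets] space_punctured_borel by simp
  have "K \<in> sets borel" using K(1) by (intro borel_closed compact_imp_closed)
  then have "K \<in> sets punctured_borel"
    using K(2) by (auto simp: punctured_borel_def sets_restrict_space image_iff)
  then have KM: "K \<in> sets \<mu>" by (simp add: sets)
  obtain B where B: "0 \<le> B" "\<And>z. g z \<le> B" using CK_plus_bounded[OF assms(2)] by auto
  have [measurable]: "g \<in> borel_measurable \<mu>"
    using CK_plus_measurable[OF assms(2)] measurable_cong_sets[OF sets refl] by blast
  show ?thesis
  proof (rule Bochner_Integration.integrable_bound)
    show "integrable \<mu> (\<lambda>z. B * indicator K z)"
      using KM fin by (intro integrable_mult_right) auto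
    show "AE z in \<mu>. norm (g z) \<le> norm (B * indicator K z)"
      using B K(3) CK_plus_nonneg[OF assms(2)] by (intro AE_I2) (auto simp: indicator_def abs_of_nonneg)
  qed measurable
qed

text \<open>A measure becomes a point of a product of real lines, one for each test function; the
  vague topology is induced by this map. The value 0 elsewhere makes the other coordinates carry no
  information.\<close>

definition evals :: "(ereal ^ 'd) measure \<Rightarrow> (ereal ^ 'd \<Rightarrow> real) \<Rightarrow> real" where
  "evals \<mu> g = (if g \<in> CK_plus then \<integral>z. g z \<partial>\<mu> else 0)"

lemma evals_nonneg: "0 \<le> evals \<mu> g"
  by (auto simp: evals_def CK_plus_nonneg)

lemma evals_add:
  assumes "\<mu> \<in> point_measures" "g \<in> CK_plus" "h \<in> CK_plus"
  shows "evals \<mu> (\<lambda>z. g z + h z) = evals \<mu> g + evals \<mu> h"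
  using assms by (simp add: evals_def CK_plus_add point_measures_integrable)

lemma topspace_vague: "topspace vague_topology = point_measures"
  unfolding vague_topology_def topology_generated_by_topspace
  by (auto intro!: exI[of _ UNIV] CK_plus_0)

text \<open>By induction over the generation of the topology. Continuity and measurability can then
  be checked in a function space with the product topology instead of in the abstract
  topology.\<close>

lemma openin_vague:
  assumes "openin vague_topology U"
  obtains V where "open V" "U = {\<mu> \<in> point_measures. evals \<mu> \<in> V}"
proof -
  have "\<exists>V. open V \<and> U = {\<mu> \<in> point_measures. evals \<mu> \<in> V}"
    using assms unfolding vague_topology_def openin_topology_generated_by_iff
  proof (induction rule: generate_topology_on.induct)
    case Empty
    then show ?case by (intro exI[of _ "{}"]) auto
  next
    case (Int a b)
    then obtain V W where "open V" "a = {\<mu> \<in> point_measures. evals \<mu> \<in> V}"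
      "open W" "b = {\<mu> \<in> point_measures. evals \<mu> \<in> W}" by auto
    then show ?case by (intro exI[of _ "V \<inter> W"]) auto
  next
    case (UN K)
    from bchoice[OF ballI, OF UN.IH] obtain V
      where V: "\<forall>k\<in>K. open (V k) \<and> k = {\<mu> \<in> point_measures. evals \<mu> \<in> V k}"
      by (rule exE)
    have "open (\<Union>k\<in>K. V k)" using V by auto
    moreover have "\<Union> K = {\<mu> \<in> point_measures. evals \<mu> \<in> (\<Union>k\<in>K. V k)}"
    proof -
      have "\<mu> \<in> k \<longleftrightarrow> \<mu> \<in> point_measures \<and> evals \<mu> \<in> V k" if "k \<in> K" for k \<mu>
        using V[rule_format, OF that] by (metis (no_types, lifting) mem_Collect_eq)
      then show ?thesis
        unfolding set_eq_iff Union_iff mem_Collect_eq UN_iff by blast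
    qed
    ultimately show ?case by (intro exI[of _ "\<Union>k\<in>K. V k"] conjI)
  next
    case (Basis s)
    then obtain g W where gW: "g \<in> CK_plus" "open W" "s = {\<mu> \<in> point_measures. (\<integral>z. g z \<partial>\<mu>) \<in> W}"
      by auto
    have "open ((\<lambda>x. x g) -` W)" using gW(2) by (auto intro!: open_vimage)
    then show ?case using gW by (intro exI[of _ "(\<lambda>x. x g) -` W"]) (auto simp: evals_def)
  qed
  then show ?thesis using that by auto
qed

lemma space_borel_of_vague: "space (borel_of_topology vague_topology) = point_measures"
  by (simp add: borel_of_topology_def topspace_vague space_measure_of_conv)

text \<open>There are uncountably many test functions, so measurability of single integrals need not
  cover an arbitrary open V. The applications obtain the preimage of V from continuity on a space
  with a countable base.\<close>

lemma measurable_vagueI: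
  fixes N :: "'a \<Rightarrow> (ereal ^ 'd) measure"
  assumes "\<And>\<omega>. \<omega> \<in> space M \<Longrightarrow> N \<omega> \<in> point_measures"
    and "\<And>V. open V \<Longrightarrow> {\<omega> \<in> space M. evals (N \<omega>) \<in> V} \<in> sets M"
  shows "N \<in> measurable M (borel_of_topology vague_topology)"
  unfolding borel_of_topology_def
proof (rule measurable_measure_of)
  show "{U. openin vague_topology U} \<subseteq> Pow (topspace vague_topology)"
    using openin_subset by auto
  show "N \<in> space M \<rightarrow> topspace vague_topology" using assms(1) by (auto simp: topspace_vague)
  fix U :: "(ereal ^ 'd) measure set" assume "U \<in> {U. openin vague_topology U}"
  then obtain V where "open V" "U = {\<mu> \<in> point_measures. evals \<mu> \<in> V}"
    using openin_vague by auto
  moreover from this have "N -` U \<inter> space M = {\<omega> \<in> space M. evals (N \<omega>) \<in> V}"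
    using assms(1) by auto
  ultimately show "N -` U \<inter> space M \<in> sets M" using assms(2) by simp
qed

lemma openin_in_borel_of_topology: "openin T U \<Longrightarrow> U \<in> sets (borel_of_topology T)"
  unfolding borel_of_topology_def by (rule in_measure_of) (auto dest: openin_subset)

lemma continuous_vague_borel:
  assumes "continuous_map vague_topology euclideanreal f"
  shows "f \<in> borel_measurable (borel_of_topology vague_topology)"
proof (rule borel_measurableI)
  fix S :: "real set" assume "open S"
  then have "openin vague_topology {x \<in> topspace vague_topology. f x \<in> S}"
    using assms by (auto simp: continuous_map_def)
  moreover have "f -` S \<inter> space (borel_of_topology vague_topology) = {x \<in> topspace vague_topology. f x \<in> S}"
    by (auto simp: space_borel_of_vague topspace_vague)
  ultimately show "f -` S \<inter> space (borel_of_topology vague_topology) \<in> sets (borel_of_topology vague_topology)"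
    by (simp only: openin_in_borel_of_topology)
qed

lemma evals_measurable:
  assumes "g \<in> CK_plus"
  shows "(\<lambda>\<mu>. evals \<mu> g) \<in> borel_measurable (borel_of_topology vague_topology)"
proof (rule continuous_vague_borel)
  show "continuous_map vague_topology euclideanreal (\<lambda>\<mu>. evals \<mu> g)"
    unfolding continuous_map_def topspace_vague
  proof (intro conjI allI impI)
    fix W :: "real set" assume "openin euclideanreal W"
    then show "openin vague_topology {\<mu> \<in> point_measures. evals \<mu> g \<in> W}"
      unfolding vague_topology_def openin_topology_generated_by_iff
      using assms by (intro generate_topology_on.Basis) (auto simp: evals_def)
  qed simp
qed

section \<open>The algebra generated by the exponential functionals\<close>

inductive exp_algebra :: "(((ereal ^ 'd \<Rightarrow> real) \<Rightarrow> real) \<Rightarrow> real) \<Rightarrow> bool" where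
  const: "exp_algebra (\<lambda>_. c)"
| exp: "g \<in> CK_plus \<Longrightarrow> exp_algebra (\<lambda>x. exp (- x g))"
| add: "exp_algebra F \<Longrightarrow> exp_algebra G \<Longrightarrow> exp_algebra (\<lambda>x. F x + G x)"
| mult: "exp_algebra F \<Longrightarrow> exp_algebra G \<Longrightarrow> exp_algebra (\<lambda>x. F x * G x)"

text \<open>A product of exponentials is the exponential of the sum of the test functions, so the
  algebra is already a linear span. This rewriting holds on point measures, where the integrals are
  finite and hence additive.\<close>

lemma exp_algebra_sum:
  fixes F :: "((ereal ^ 'd \<Rightarrow> real) \<Rightarrow> real) \<Rightarrow> real"
  assumes "exp_algebra F"
  obtains n :: nat and c h where "\<And>i. h i \<in> CK_plus"
    "\<And>\<mu>. \<mu> \<in> point_measures \<Longrightarrow> F (evals \<mu>) = (\<Sum>i<n. c i * exp (- evals \<mu> (h i)))"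
proof -
  have "\<exists>L :: (real \<times> (ereal ^ 'd \<Rightarrow> real)) list. snd ` set L \<subseteq> CK_plus \<and>
      (\<forall>\<mu>\<in>point_measures. F (evals \<mu>) = (\<Sum>(c, g)\<leftarrow>L. c * exp (- evals \<mu> g)))"
    using assms
  proof induction
    case (const c)
    show ?case
      by (rule exI[of _ "[(c, \<lambda>_. 0)]"]) (simp add: CK_plus_0 evals_def)
  next
    case (exp g)
    then show ?case by (intro exI[of _ "[(1, g)]"]) simp
  next
    case (add F G)
    then obtain L L' where "snd ` set L \<subseteq> CK_plus" "snd ` set L' \<subseteq> CK_plus"
      "\<forall>\<mu>\<in>point_measures. F (evals \<mu>) = (\<Sum>(c, g)\<leftarrow>L. c * exp (- evals \<mu> g))"
      "\<forall>\<mu>\<in>point_measures. G (evals \<mu>) = (\<Sum>(c, g)\<leftarrow>L'. c * exp (- evals \<mu> g))" by auto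
    then show ?case by (intro exI[of _ "L @ L'"]) auto
  next
    case (mult F G)
    then obtain L L' where L: "snd ` set L \<subseteq> CK_plus" "snd ` set L' \<subseteq> CK_plus"
      "\<forall>\<mu>\<in>point_measures. F (evals \<mu>) = (\<Sum>(c, g)\<leftarrow>L. c * exp (- evals \<mu> g))"
      "\<forall>\<mu>\<in>point_measures. G (evals \<mu>) = (\<Sum>(c, g)\<leftarrow>L'. c * exp (- evals \<mu> g))" by auto
    define prod where "prod L L' = concat (map (\<lambda>(c, g). map (\<lambda>(c', g'). (c * c', \<lambda>z. g z + g' z)) L') L)"
      for L L' :: "(real \<times> (ereal ^ 'd \<Rightarrow> real)) list"
    have single: "(\<Sum>(c', g')\<leftarrow>map (\<lambda>(c', g'). (c * c', \<lambda>z. g z + g' z)) L'. c' * exp (- evals \<mu> g'))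
        = c * exp (- evals \<mu> g) * (\<Sum>(c', g')\<leftarrow>L'. c' * exp (- evals \<mu> g'))"
      if "\<mu> \<in> point_measures" "g \<in> CK_plus" "snd ` set L' \<subseteq> CK_plus" for \<mu> c g L'
      using that(3)
    proof (induction L')
      case (Cons p L')
      then show ?case
        using that(1,2)
        by (cases p) (simp add: evals_add algebra_simps exp_minus exp_add)
    qed simp
    have "snd ` set (prod L L') \<subseteq> CK_plus"
      using L(1,2) by (force simp: prod_def intro!: CK_plus_add)
    moreover have "(\<Sum>(c, g)\<leftarrow>prod L L'. c * exp (- evals \<mu> g)) =
        (\<Sum>(c, g)\<leftarrow>L. c * exp (- evals \<mu> g)) * (\<Sum>(c, g)\<leftarrow>L'. c * exp (- evals \<mu> g))"
      if \<mu>: "\<mu> \<in> point_measures" for \<mu>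
      using L(1)
    proof (induction L)
      case Nil
      then show ?case by (simp add: prod_def)
    next
      case (Cons p L)
      obtain c g where p: "p = (c, g)" by (cases p)
      have "(\<Sum>(c, g)\<leftarrow>prod (p # L) L'. c * exp (- evals \<mu> g)) =
        (\<Sum>(c', g')\<leftarrow>map (\<lambda>(c', g'). (c * c', \<lambda>z. g z + g' z)) L'. c' * exp (- evals \<mu> g'))
        + (\<Sum>(c, g)\<leftarrow>prod L L'. c * exp (- evals \<mu> g))"
        by (simp add: prod_def p)
      also have "\<dots> = c * exp (- evals \<mu> g) * (\<Sum>(c', g')\<leftarrow>L'. c' * exp (- evals \<mu> g'))
        + (\<Sum>(c, g)\<leftarrow>L. c * exp (- evals \<mu> g)) * (\<Sum>(c, g)\<leftarrow>L'. c * exp (- evals \<mu> g))"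
        using Cons L(2) p by (subst single[OF \<mu>]) auto
      also have "\<dots> = (\<Sum>(c, g)\<leftarrow>p # L. c * exp (- evals \<mu> g)) * (\<Sum>(c, g)\<leftarrow>L'. c * exp (- evals \<mu> g))"
        by (simp add: p distrib_right)
      finally show ?case .
    qed
    ultimately show ?case using L(3,4) by (intro exI[of _ "prod L L'"]) auto
  qed
  then obtain L :: "(real \<times> (ereal ^ 'd \<Rightarrow> real)) list" where L: "snd ` set L \<subseteq> CK_plus"
      "\<And>\<mu>. \<mu> \<in> point_measures \<Longrightarrow> F (evals \<mu>) = (\<Sum>(c, g)\<leftarrow>L. c * exp (- evals \<mu> g))"
    by auto
  \<comment> \<open>Padding with the zero function gives a test function for every index, as the
    conclusion demands.\<close>
  define h where "h i = (if i < length L then snd (L ! i) else (\<lambda>_. 0))" for i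
  show ?thesis
  proof (rule that[of h "\<lambda>i. fst (L ! i)" "length L"])
    show "h i \<in> CK_plus" for i
    proof (cases "i < length L")
      case True
      then have "snd (L ! i) \<in> snd ` set L" by (intro imageI nth_mem)
      then show ?thesis using L(1) True by (auto simp: h_def)
    qed (simp add: h_def CK_plus_0)
    fix \<mu> :: "(ereal ^ 'd) measure" assume "\<mu> \<in> point_measures"
    then have "F (evals \<mu>) = (\<Sum>(c, g)\<leftarrow>L. c * exp (- evals \<mu> g))" by (rule L(2))
    also have "\<dots> = (\<Sum>i<length L. fst (L ! i) * exp (- evals \<mu> (snd (L ! i))))"
      by (simp add: sum_list_sum_nth atLeast0LessThan case_prod_beta)
    also have "\<dots> = (\<Sum>i<length L. fst (L ! i) * exp (- evals \<mu> (h i)))"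
      by (simp add: h_def)
    finally show "F (evals \<mu>) = (\<Sum>i<length L. fst (L ! i) * exp (- evals \<mu> (h i)))" .
  qed
qed

lemma exp_algebra_bounded:
  fixes F :: "((ereal ^ 'd \<Rightarrow> real) \<Rightarrow> real) \<Rightarrow> real"
  assumes "exp_algebra F"
  obtains B where "\<And>\<mu>. \<mu> \<in> point_measures \<Longrightarrow> \<bar>F (evals \<mu>)\<bar> \<le> B"
proof -
  obtain h c and n :: nat where *: "\<And>i. h i \<in> CK_plus"
    "\<And>\<mu>. \<mu> \<in> point_measures \<Longrightarrow> F (evals \<mu>) = (\<Sum>i<n. c i * exp (- evals \<mu> (h i)))"
    by (rule exp_algebra_sum[OF assms]) auto
  show ?thesis
  proof (rule that)
    fix \<mu> :: "(ereal ^ 'd) measure" assume "\<mu> \<in> point_measures"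
    then have "\<bar>F (evals \<mu>)\<bar> \<le> (\<Sum>i<n. \<bar>c i * exp (- evals \<mu> (h i))\<bar>)"
      by (simp only: *(2) sum_abs)
    also have "\<dots> \<le> (\<Sum>i<n. \<bar>c i\<bar>)"
      using evals_nonneg[of \<mu>] by (intro sum_mono) (simp add: abs_mult mult_left_le)
    finally show "\<bar>F (evals \<mu>)\<bar> \<le> (\<Sum>i<n. \<bar>c i\<bar>)" .
  qed
qed

lemma exp_algebra_continuous: "exp_algebra F \<Longrightarrow> continuous_on A F"
proof (induction rule: exp_algebra.induct)
  case (exp g)
  have "continuous_on A (\<lambda>x. x g :: real)"
    by (rule continuous_on_subset[OF continuous_on_product_coordinates]) auto
  then show ?case by (intro continuous_intros)
qed (auto intro: continuous_intros)

lemma exp_algebra_polynomial: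
  fixes p :: "real \<Rightarrow> real"
  assumes "real_polynomial_function p" "exp_algebra F"
  shows "exp_algebra (\<lambda>x. p (F x))"
  using assms(1)
proof induction
  case (linear f)
  have lin: "f t = f 1 * t" for t
    using linear_scale[OF bounded_linear.linear[OF linear], of t 1] by (simp add: mult.commute)
  have "(\<lambda>x. f (F x)) = (\<lambda>x. f 1 * F x)" by (rule ext) (rule lin)
  then show ?case using exp_algebra.mult[OF exp_algebra.const[of "f 1"] assms(2)] by simp
qed (auto intro: exp_algebra.intros)

text \<open>Through this identity convergence of Laplace functionals becomes convergence of
  expectations for the whole algebra.\<close>

lemma exp_algebra_expectation:
  assumes M: "prob_space M" and N: "N \<in> measurable M (borel_of_topology vague_topology)"
    and F: "\<And>i::nat. i < n \<Longrightarrow> h i \<in> CK_plus"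
      "\<And>\<mu>. \<mu> \<in> point_measures \<Longrightarrow> F (evals \<mu>) = (\<Sum>i<n. c i * exp (- evals \<mu> (h i)))"
  shows "(\<integral>\<omega>. F (evals (N \<omega>)) \<partial>M) = (\<Sum>i<n. c i * laplace_functional M N (h i))"
    and "(\<lambda>\<omega>. F (evals (N \<omega>))) \<in> borel_measurable M"
proof -
  interpret prob_space M by fact
  have pm: "N \<omega> \<in> point_measures" if "\<omega> \<in> space M" for \<omega>
    using measurable_space[OF N that] by (simp add: space_borel_of_vague)
  have meas[measurable]: "(\<lambda>\<omega>. evals (N \<omega>) (h i)) \<in> borel_measurable M" if "i < n" for i
    using measurable_compose[OF N evals_measurable[OF F(1)[OF that]]] .
  have int: "integrable M (\<lambda>\<omega>. c i * exp (- evals (N \<omega>) (h i)))" if "i < n" for i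
    using meas[OF that] evals_nonneg
    by (intro integrable_mult_right integrable_const_bound[where B=1]) auto
  have "(\<integral>\<omega>. F (evals (N \<omega>)) \<partial>M) = (\<integral>\<omega>. (\<Sum>i<n. c i * exp (- evals (N \<omega>) (h i))) \<partial>M)"
    by (intro Bochner_Integration.integral_cong refl F(2) pm)
  also have "\<dots> = (\<Sum>i<n. \<integral>\<omega>. c i * exp (- evals (N \<omega>) (h i)) \<partial>M)"
    by (rule Bochner_Integration.integral_sum) (use int in simp)
  also have "\<dots> = (\<Sum>i<n. c i * laplace_functional M N (h i))"
    using F(1) by (intro sum.cong) (simp_all add: laplace_functional_def evals_def)
  finally show "(\<integral>\<omega>. F (evals (N \<omega>)) \<partial>M) = (\<Sum>i<n. c i * laplace_functional M N (h i))" .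
  have "(\<lambda>\<omega>. \<Sum>i<n. c i * exp (- evals (N \<omega>) (h i))) \<in> borel_measurable M"
    by (intro borel_measurable_sum borel_measurable_times borel_measurable_const) (use meas in auto)
  then show "(\<lambda>\<omega>. F (evals (N \<omega>))) \<in> borel_measurable M"
    by (rule measurable_cong[THEN iffD2, rotated]) (use F(2) pm in auto)
qed

text \<open>A vaguely continuous function is, on a compact set of point measures, a uniform limit of
  bounded functions in the algebra generated by the exponentials; composing with a polynomial
  that approximates a truncation keeps the approximants bounded off the compact set.\<close>

lemma vague_continuous_approx:
  fixes f :: "(ereal ^ 'd) measure \<Rightarrow> real" and T :: "((ereal ^ 'd \<Rightarrow> real) \<Rightarrow> real) set"
  assumes f: "continuous_map vague_topology euclideanreal f"
    and B: "\<And>\<mu>. \<mu> \<in> point_measures \<Longrightarrow> \<bar>f \<mu>\<bar> \<le> B"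
    and T: "compact T" "T \<subseteq> evals ` point_measures" and e: "0 < e"
  obtains F where "exp_algebra F" "\<And>\<mu>. \<mu> \<in> point_measures \<Longrightarrow> \<bar>F (evals \<mu>)\<bar> \<le> B + e"
    "\<And>\<mu>. \<mu> \<in> point_measures \<Longrightarrow> evals \<mu> \<in> T \<Longrightarrow> \<bar>f \<mu> - F (evals \<mu>)\<bar> \<le> e"
proof -
  have opn: "\<exists>V. open V \<and> {\<mu> \<in> point_measures. f \<mu> \<in> W} = {\<mu> \<in> point_measures. evals \<mu> \<in> V}"
    if "open W" for W
  proof -
    have "openin vague_topology {\<mu> \<in> point_measures. f \<mu> \<in> W}"
      using f that by (auto simp: continuous_map_def topspace_vague)
    then obtain V where "open V" "{\<mu> \<in> point_measures. f \<mu> \<in> W} = {\<mu> \<in> point_measures. evals \<mu> \<in> V}"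
      by (rule openin_vague)
    then show ?thesis by (intro exI[of _ V] conjI)
  qed
  \<comment> \<open>A continuous function into the reals cannot separate two measures that all test
    integrals identify. Hence f factors through \<open>evals\<close>, and h below is that
    factor.\<close>
  have inj: "f \<mu> = f \<mu>'" if "evals \<mu> = evals \<mu>'" "\<mu> \<in> point_measures" "\<mu>' \<in> point_measures" for \<mu> \<mu>'
  proof (rule ccontr)
    assume "f \<mu> \<noteq> f \<mu>'"
    then obtain W where W: "open W" "f \<mu> \<in> W" "f \<mu>' \<notin> W"
      using separation_t1[THEN iffD1, of "f \<mu>" "f \<mu>'"] by blast
    obtain V where V: "{\<mu> \<in> point_measures. f \<mu> \<in> W} = {\<mu> \<in> point_measures. evals \<mu> \<in> V}"
      using opn[OF W(1)] by blast
    have "\<mu> \<in> {\<mu> \<in> point_measures. evals \<mu> \<in> V}" unfolding V[symmetric] using that W by blast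
    then have "\<mu>' \<in> {\<mu> \<in> point_measures. evals \<mu> \<in> V}" using that by simp
    then show False unfolding V[symmetric] using W by blast
  qed
  define h where "h x = f (SOME \<mu>. \<mu> \<in> point_measures \<and> evals \<mu> = x)" for x
  have h: "h (evals \<mu>) = f \<mu>" if "\<mu> \<in> point_measures" for \<mu>
    using someI[of "\<lambda>\<mu>'. \<mu>' \<in> point_measures \<and> evals \<mu>' = evals \<mu>" \<mu>] that
    unfolding h_def by (intro inj) auto
  have h_cont: "continuous_on T h"
    unfolding continuous_on_open_invariant
  proof (intro allI impI)
    fix W :: "real set" assume "open W"
    from opn[OF this] obtain V where V: "open V"
      "{\<mu> \<in> point_measures. f \<mu> \<in> W} = {\<mu> \<in> point_measures. evals \<mu> \<in> V}" by blast
    have "V \<inter> T = h -` W \<inter> T"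
    proof (intro set_eqI)
      fix x
      show "x \<in> V \<inter> T \<longleftrightarrow> x \<in> h -` W \<inter> T"
      proof (cases "x \<in> T")
        case True
        then obtain \<mu> where \<mu>: "\<mu> \<in> point_measures" "x = evals \<mu>" using T by auto
        then have "x \<in> V \<longleftrightarrow> \<mu> \<in> {\<mu> \<in> point_measures. evals \<mu> \<in> V}" by simp
        also have "\<dots> \<longleftrightarrow> h x \<in> W" unfolding V(2)[symmetric] using \<mu> h by simp
        finally show ?thesis by simp
      qed simp
    qed
    then show "\<exists>A. open A \<and> A \<inter> T = h -` W \<inter> T" using V(1) by blast
  qed
  have "\<exists>G. exp_algebra G \<and> (\<forall>x\<in>T. \<bar>h x - G x\<bar> < e / 2)"
  proof (rule Stone_Weierstrass_HOL[OF T(1)])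
    fix x y assume xy: "x \<in> T \<and> y \<in> T \<and> x \<noteq> y"
    then obtain \<mu> \<mu>' where \<mu>: "x = evals \<mu>" "y = evals \<mu>'" using T by blast
    obtain g where g: "x g \<noteq> y g" using xy by (metis ext)
    then have "g \<in> CK_plus" by (auto simp: \<mu> evals_def split: if_splits)
    then show "\<exists>F. exp_algebra F \<and> F x \<noteq> F y"
      using g by (intro exI[of _ "\<lambda>x. exp (- x g)"]) (auto intro: exp_algebra.exp)
  qed (use h_cont e in \<open>auto intro: exp_algebra.intros exp_algebra_continuous\<close>)
  then obtain G where G: "exp_algebra G" "\<And>x. x \<in> T \<Longrightarrow> \<bar>h x - G x\<bar> < e / 2" by blast
  obtain L where L: "\<And>\<mu>. \<mu> \<in> point_measures \<Longrightarrow> \<bar>G (evals \<mu>)\<bar> \<le> L"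
    using exp_algebra_bounded[OF G(1)] by blast
  \<comment> \<open>That B is nonnegative is known only once a point measure is at hand, hence
    \<open>\<bar>B\<bar>\<close>. Clamping does not increase the distance to f, whose values lie in
    the clamped interval.\<close>
  define clamp where "clamp t = max (- \<bar>B\<bar>) (min \<bar>B\<bar> t)" for t :: real
  have "continuous_on {-L..L} clamp" unfolding clamp_def by (intro continuous_intros)
  from Stone_Weierstrass_real_polynomial_function[OF compact_Icc this, of "e / 2"] e
  obtain p where p: "real_polynomial_function p" "\<And>t. t \<in> {-L..L} \<Longrightarrow> \<bar>clamp t - p t\<bar> < e / 2" by auto
  have pL: "\<bar>clamp (G (evals \<mu>)) - p (G (evals \<mu>))\<bar> < e / 2" if "\<mu> \<in> point_measures" for \<mu>
    using L[OF that] by (intro p(2)) auto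
  show ?thesis
  proof (rule that[of "\<lambda>x. p (G x)"])
    show "exp_algebra (\<lambda>x. p (G x))" by (rule exp_algebra_polynomial[OF p(1) G(1)])
  next
    fix \<mu> :: "(ereal ^ 'd) measure" assume \<mu>: "\<mu> \<in> point_measures"
    have "0 \<le> B" using B[OF \<mu>] by linarith
    then have "\<bar>clamp (G (evals \<mu>))\<bar> \<le> B" by (auto simp: clamp_def)
    then show "\<bar>p (G (evals \<mu>))\<bar> \<le> B + e" using pL[OF \<mu>] e by linarith
    assume "evals \<mu> \<in> T"
    from G(2)[OF this] h[OF \<mu>] have "\<bar>f \<mu> - G (evals \<mu>)\<bar> < e / 2" by simp
    moreover have "\<bar>f \<mu> - clamp (G (evals \<mu>))\<bar> \<le> \<bar>f \<mu> - G (evals \<mu>)\<bar>"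
      using B[OF \<mu>] by (auto simp: clamp_def max_def min_def)
    ultimately show "\<bar>f \<mu> - p (G (evals \<mu>))\<bar> \<le> e" using pL[OF \<mu>] by linarith
  qed
qed

section \<open>Point configurations\<close>

text \<open>Counting indices rather than values keeps multiplicities; indices at the origin are
  removed because the origin is not in the punctured space.\<close>

definition point_sum :: "'i set \<Rightarrow> ('i \<Rightarrow> ereal ^ 'd) \<Rightarrow> (ereal ^ 'd) measure" where
  "point_sum I z = distr (count_space {i \<in> I. z i \<noteq> 0}) punctured_borel z"

definition locally_finite :: "'i set \<Rightarrow> ('i \<Rightarrow> ereal ^ 'd) \<Rightarrow> bool" where
  "locally_finite I z \<longleftrightarrow> (\<forall>U. open U \<longrightarrow> 0 \<in> U \<longrightarrow> finite {i \<in> I. z i \<notin> U})"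

lemma point_sum_measurable: "z \<in> measurable (count_space {i \<in> I. z i \<noteq> 0}) punctured_borel"
  by (auto simp: space_punctured_borel)

lemma locally_finite_finite: "finite I \<Longrightarrow> locally_finite I z"
  by (simp add: locally_finite_def)

lemma locally_finite_support:
  assumes "locally_finite I z" "g \<in> CK_plus"
  shows "finite {i \<in> I. g (z i) \<noteq> 0}"
proof -
  obtain U where U: "open U" "0 \<in> U" "\<And>z. z \<in> U \<Longrightarrow> g z = 0"
    using CK_plus_support[OF assms(2)] by blast
  have "finite {i \<in> I. z i \<notin> U}" using assms(1) U by (simp add: locally_finite_def)
  then show ?thesis by (rule finite_subset[rotated]) (use U(3) in blast)
qed

lemma evals_point_sum:
  assumes "locally_finite I z" "g \<in> CK_plus"
  shows "evals (point_sum I z) g = (\<Sum>i | i \<in> I \<and> g (z i) \<noteq> 0. g (z i))"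
proof -
  have eq: "{i \<in> {i \<in> I. z i \<noteq> 0}. g (z i) \<noteq> 0} = {i \<in> I. g (z i) \<noteq> 0}"
    using CK_plus_zero[OF assms(2)] by auto
  have "evals (point_sum I z) g = (\<integral>i. g (z i) \<partial>count_space {i \<in> I. z i \<noteq> 0})"
    unfolding evals_def point_sum_def using assms(2)
    by (simp add: integral_distr[OF point_sum_measurable CK_plus_measurable])
  also have "\<dots> = (\<Sum>i | i \<in> {i \<in> I. z i \<noteq> 0} \<and> g (z i) \<noteq> 0. g (z i))"
    by (rule lebesgue_integral_count_space_finite_support)
       (use locally_finite_support[OF assms] eq in simp)
  also have "{i. i \<in> {i \<in> I. z i \<noteq> 0} \<and> g (z i) \<noteq> 0} = {i. i \<in> I \<and> g (z i) \<noteq> 0}"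
    using eq by auto
  finally show ?thesis .
qed

lemma evals_point_sum_superset:
  assumes "locally_finite I z" "g \<in> CK_plus" "finite J" "J \<subseteq> I" "\<And>i. i \<in> I - J \<Longrightarrow> g (z i) = 0"
  shows "evals (point_sum I z) g = (\<Sum>i\<in>J. g (z i))"
  unfolding evals_point_sum[OF assms(1,2)]
  by (rule sum.mono_neutral_left) (use assms in auto)

lemma point_sum_point_measure:
  assumes "locally_finite I z"
  shows "point_sum I z \<in> point_measures"
  unfolding point_measures_def mem_Collect_eq
proof (intro conjI allI impI ballI)
  show "sets (point_sum I z) = sets punctured_borel"
    by (simp add: point_sum_def)
  have em: "emeasure (point_sum I z) A = emeasure (count_space {i \<in> I. z i \<noteq> 0}) {i \<in> I. z i \<noteq> 0 \<and> z i \<in> A}"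
    if "A \<in> sets punctured_borel" for A
    unfolding point_sum_def
    by (subst emeasure_distr[OF point_sum_measurable that]) (auto intro!: arg_cong2[where f=emeasure])
  {
    fix K :: "(ereal ^ 'b) set" assume K: "compact K" "0 \<notin> K"
    have "K \<in> sets borel" using K(1) by (intro borel_closed compact_imp_closed)
    then have "K \<in> sets punctured_borel"
      using K(2) by (auto simp: punctured_borel_def sets_restrict_space image_iff)
    moreover have "finite {i \<in> I. z i \<notin> - K}"
      using assms K unfolding locally_finite_def
      by (metis ComplI compact_imp_closed open_Compl)
    then have "finite {i \<in> I. z i \<noteq> 0 \<and> z i \<in> K}"
      by (rule finite_subset[rotated]) auto
    ultimately show "emeasure (point_sum I z) K < \<infinity>"
      unfolding em[OF \<open>K \<in> sets punctured_borel\<close>]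
      by (subst emeasure_count_space_finite) (auto simp: of_nat_less_top)
  next
    fix A assume "A \<in> sets (point_sum I z)"
    then have A: "A \<in> sets punctured_borel" by (simp add: point_sum_def)
    show "emeasure (point_sum I z) A = \<infinity> \<or> (\<exists>n::nat. emeasure (point_sum I z) A = of_nat n)"
      unfolding em[OF A]
      by (subst (1 2) emeasure_count_space) auto
  }
qed

text \<open>Measurable sets of the punctured space miss the origin, so leaving out the indices with
  value 0 changes no count.\<close>

lemma sample_process_eq_point_sum:
  fixes X :: "int \<Rightarrow> 'w \<Rightarrow> real ^ 'd"
  shows "sample_process X a n j \<omega> = point_sum {1..j} (\<lambda>t. emb (X (int t) \<omega> /\<^sub>R a n))"
    (is "_ = point_sum _ ?z")
proof -
  have "point_sum {1..j} ?z = measure_of (space (point_sum {1..j} ?z)) (sets (point_sum {1..j} ?z)) (emeasure (point_sum {1..j} ?z))"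
    by (rule measure_of_of_measure[symmetric])
  also have "\<dots> = measure_of (space punctured_borel) (sets punctured_borel) (emeasure (point_sum {1..j} ?z))"
    by (simp add: point_sum_def)
  also have "\<dots> = sample_process X a n j \<omega>"
    unfolding sample_process_def
  proof (rule measure_of_eq)
    show "sets punctured_borel \<subseteq> Pow (space punctured_borel :: (ereal ^ 'd) set)"
      by (rule sets.space_closed)
    fix A :: "(ereal ^ 'd) set" assume "A \<in> sigma_sets (space punctured_borel) (sets punctured_borel)"
    then have A: "A \<in> sets punctured_borel" by (simp add: sets.sigma_sets_eq)
    then have "0 \<notin> A" using sets.sets_into_space[OF A] by (auto simp: space_punctured_borel)
    have "emeasure (point_sum {1..j} ?z) A = emeasure (count_space {i \<in> {1..j}. ?z i \<noteq> 0}) (?z -` A \<inter> {i \<in> {1..j}. ?z i \<noteq> 0})"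
      unfolding point_sum_def by (subst emeasure_distr[OF point_sum_measurable A]) simp
    also have "?z -` A \<inter> {i \<in> {1..j}. ?z i \<noteq> 0} = {i \<in> {1..j}. ?z i \<in> A}"
      using \<open>0 \<notin> A\<close> by auto
    also have "emeasure (count_space {i \<in> {1..j}. ?z i \<noteq> 0}) {i \<in> {1..j}. ?z i \<in> A} = of_nat (card {i \<in> {1..j}. ?z i \<in> A})"
      using \<open>0 \<notin> A\<close> by (intro emeasure_count_space_finite) auto
    also have "\<dots> = (\<Sum>t=1..j. indicator A (?z t))"
      by (simp add: indicator_def sum.If_cases Int_def)
    finally show "emeasure (point_sum {1..j} ?z) A = (\<Sum>t=1..j. indicator A (?z t))" .
  qed
  finally show ?thesis by (rule sym)
qed

lemma evals_sample_process:
  assumes "g \<in> CK_plus"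
  shows "evals (sample_process X a n j \<omega>) g = (\<Sum>t=1..j. g (emb (X (int t) \<omega> /\<^sub>R a n)))"
  unfolding sample_process_eq_point_sum
  by (rule evals_point_sum_superset) (auto simp: locally_finite_finite assms)

text \<open>The homeomorphism between \<open>[-1, 1]\<close> and the extended real line that inverts
  \<open>x \<mapsto> x / (1 + |x|)\<close>, extended constantly to the real line.\<close>

definition unsquash :: "real \<Rightarrow> ereal" where
  "unsquash r = (if r \<ge> 1 then \<infinity> else if r \<le> -1 then -\<infinity> else ereal (r / (1 - \<bar>r\<bar>)))"

definition squash :: "real \<Rightarrow> real" where
  "squash x = x / (1 + \<bar>x\<bar>)"

lemma abs_squash: "\<bar>squash x\<bar> = \<bar>x\<bar> / (1 + \<bar>x\<bar>)"
  by (simp add: squash_def abs_divide)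

lemma unsquash_squash: "unsquash (squash x) = ereal x"
proof -
  have "\<bar>squash x\<bar> < 1" unfolding abs_squash by simp
  moreover have "1 - \<bar>squash x\<bar> = 1 / (1 + \<bar>x\<bar>)" unfolding abs_squash by (simp add: field_simps)
  then have "squash x / (1 - \<bar>squash x\<bar>) = x" by (simp add: squash_def)
  ultimately show ?thesis by (auto simp: unsquash_def)
qed

lemma unsquash_mono:
  assumes "r \<le> s" shows "unsquash r \<le> unsquash s"
proof (cases "-1 < r \<and> s < 1")
  case True
  have "r / (1 - \<bar>r\<bar>) \<le> s / (1 - \<bar>s\<bar>)"
  proof -
    have "r * (1 - \<bar>s\<bar>) \<le> s * (1 - \<bar>r\<bar>)"
    proof (cases "r \<ge> 0 \<or> s \<le> 0")
      case True
      then show ?thesis using assms by (auto simp: algebra_simps)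
    next
      case False
      then have "r * (1 - \<bar>s\<bar>) \<le> 0" "0 \<le> s * (1 - \<bar>r\<bar>)" using \<open>-1 < r \<and> s < 1\<close>
        by (auto simp: mult_le_0_iff)
      then show ?thesis by linarith
    qed
    then show ?thesis using True assms by (auto simp: divide_simps)
  qed
  then show ?thesis using True assms by (auto simp: unsquash_def)
qed (use assms in \<open>auto simp: unsquash_def\<close>)

lemma unsquash_surj: "range unsquash = UNIV"
proof (intro set_eqI iffI UNIV_I)
  fix y :: ereal
  show "y \<in> range unsquash"
  proof (cases y)
    case (real x)
    then show ?thesis using unsquash_squash[of x] by (metis rangeI)
  next
    case PInf
    then show ?thesis by (intro image_eqI[of _ _ 1]) (simp_all add: unsquash_def)
  next
    case MInf
    then show ?thesis by (intro image_eqI[of _ _ "-1"]) (simp_all add: unsquash_def)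
  qed
qed

text \<open>A monotone map onto a linearly ordered space has no jumps; this settles the end points 1
  and -1 as well.\<close>

lemma continuous_unsquash: "continuous_on UNIV unsquash"
  by (rule continuous_onI_mono) (simp_all add: unsquash_surj unsquash_mono)

definition decode :: "real ^ 'd \<Rightarrow> ereal ^ 'd" where
  "decode v = (\<chi> c. unsquash (v $ c))"

lemma continuous_decode: "continuous_on A decode"
proof -
  have "(decode \<longlongrightarrow> decode v) (at v within A)" for v
  proof (rule vec_tendstoI)
    fix c
    have "((\<lambda>w. unsquash (w $ c)) \<longlongrightarrow> unsquash (v $ c)) (at v within A)"
      by (rule continuous_on_tendsto_compose[OF continuous_unsquash])
         (auto intro!: tendsto_intros)
    then show "((\<lambda>w. decode w $ c) \<longlongrightarrow> decode v $ c) (at v within A)"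
      by (simp add: decode_def)
  qed
  then show ?thesis by (simp add: continuous_on_def)
qed

lemma decode_0 [simp]: "decode 0 = 0"
  by (simp add: decode_def unsquash_def vec_eq_iff zero_ereal_def)

lemma decode_squash: "decode (\<chi> c. squash (x $ c)) = emb x"
  by (simp add: decode_def emb_def unsquash_squash)

text \<open>A code describes a point configuration.  For each level \<open>q\<close> it lists points of
  norm of order \<open>1/q\<close>: the bit \<open>(q, i, None)\<close> tells whether there is an \<open>i\<close>-th point of level
  \<open>q\<close>, and the bits \<open>(q, i, Some (c, k))\<close> are the binary digits of its \<open>c\<close>-th
  coordinate, squashed and rescaled by \<open>q\<close>.\<close>

type_synonym 'd code = "nat \<times> nat \<times> ('d \<times> nat) option \<Rightarrow> bool"

definition code_point :: "'d::finite code \<Rightarrow> nat \<times> nat \<Rightarrow> ereal ^ 'd" where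
  "code_point b = (\<lambda>(q, i). decode ((1 / real q) *\<^sub>R (\<chi> c. 2 * binval (\<lambda>k. b (q, i, Some (c, k))) - 1)))"

definition code_index :: "'d code \<Rightarrow> (nat \<times> nat) set" where
  "code_index b = {(q, i). b (q, i, None)}"

definition config :: "'d::finite code \<Rightarrow> (ereal ^ 'd) measure" where
  "config b = point_sum (code_index b) (code_point b)"

text \<open>The substitute for compact sets of configurations: \<open>c q\<close> caps the indices
  in use at level q, so that a test function meets only finitely many index pairs, uniformly over
  the set.\<close>

definition bounded_codes :: "(nat \<Rightarrow> nat) \<Rightarrow> 'd code set" where
  "bounded_codes c = {b. \<forall>q i. c q \<le> i \<longrightarrow> \<not> b (q, i, None)}"

lemma continuous_code_point: "continuous_on A (\<lambda>b. code_point b qi)"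
proof -
  obtain q i where qi: "qi = (q, i)" by (cases qi)
  have cont: "continuous_on A (\<lambda>b. binval (\<lambda>k. b (q, i, Some (c, k))))" for c :: 'a
    by (rule continuous_on_compose2[OF continuous_binval[of UNIV]])
       (auto intro!: continuous_on_coordinatewise_then_product
          continuous_on_subset[OF continuous_on_product_coordinates])
  show ?thesis unfolding qi code_point_def case_prod_conv
    by (rule continuous_on_compose2[OF continuous_decode[of UNIV]])
       (auto intro!: continuous_intros cont continuous_on_vec_lambda)
qed

text \<open>Level q divides a vector of the cube [-1, 1]^d by q before decoding. The norm in the
  cube is at most d, so d / e is the right threshold for q, whatever the code.\<close>

lemma code_point_eventually_near_0:
  assumes "open U" "(0 :: ereal ^ 'd) \<in> U"
  obtains J where "\<And>(b :: 'd code) q i. J \<le> q \<Longrightarrow> code_point b (q, i) \<in> U"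
proof -
  have "open (decode -` U :: (real ^ 'd) set)"
    using assms(1) by (rule open_vimage) (rule continuous_decode)
  moreover have "0 \<in> (decode -` U :: (real ^ 'd) set)" using assms(2) by simp
  ultimately obtain e where e: "0 < e" "ball (0 :: real ^ 'd) e \<subseteq> decode -` U"
    by (meson open_contains_ball)
  obtain J :: nat where J: "real CARD('d) / e < real J" using reals_Archimedean2 by blast
  show ?thesis
  proof (rule that)
    fix b :: "'d code" and q i assume "J \<le> q"
    define v :: "real ^ 'd" where "v = (\<chi> c. 2 * binval (\<lambda>k. b (q, i, Some (c, k))) - 1)"
    have "0 < real CARD('d) / e" using e(1) by simp
    then have "real CARD('d) / e < real q" "0 < real q"
      using J \<open>J \<le> q\<close> by linarith+
    then have q: "0 < real q" "real CARD('d) < e * real q"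
      using e(1) by (simp_all add: pos_divide_less_eq mult.commute)
    have vc: "\<bar>v $ c\<bar> \<le> 1" for c
      using binval_ge_0[of "\<lambda>k. b (q, i, Some (c, k))"] binval_le_1[of "\<lambda>k. b (q, i, Some (c, k))"]
      by (simp add: v_def abs_le_iff)
    have "norm v \<le> (\<Sum>c\<in>UNIV. \<bar>v $ c\<bar>)" by (rule norm_le_l1_cart)
    also have "\<dots> \<le> (\<Sum>c\<in>(UNIV :: 'd set). 1)" using vc by (intro sum_mono)
    also have "\<dots> < e * real q" using q by simp
    finally have "norm ((1 / real q) *\<^sub>R v) < e" using q(1) by (simp add: divide_simps mult.commute)
    then have "(1 / real q) *\<^sub>R v \<in> ball 0 e" by (simp only: mem_ball_0)
    then have "(1 / real q) *\<^sub>R v \<in> decode -` U" using e(2) by blast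
    then show "code_point b (q, i) \<in> U" by (simp add: code_point_def v_def)
  qed
qed

lemma locally_finite_code:
  assumes "b \<in> bounded_codes c"
  shows "locally_finite (code_index b) (code_point b)"
  unfolding locally_finite_def
proof (intro allI impI)
  fix U :: "(ereal ^ 'a) set" assume U: "open U" "0 \<in> U"
  obtain J where J: "\<And>(b :: 'a code) q i. J \<le> q \<Longrightarrow> code_point b (q, i) \<in> U"
    using code_point_eventually_near_0[OF U] by blast
  have "{i \<in> code_index b. code_point b i \<notin> U} \<subseteq> Sigma {..<J} (\<lambda>q. {..<c q})"
    using J assms by (force simp: bounded_codes_def code_index_def not_le[symmetric])
  then show "finite {i \<in> code_index b. code_point b i \<notin> U}"
    by (rule finite_subset) auto
qed

lemma config_point_measure: "b \<in> bounded_codes c \<Longrightarrow> config b \<in> point_measures"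
  unfolding config_def by (intro point_sum_point_measure locally_finite_code)

text \<open>Levels from J on lie where g vanishes, and each lower level uses at most
  \<open>c q\<close> indices. The set S depends on g and c but not on b, which is what makes the
  decoded integral continuous in b.\<close>

lemma evals_config_finite_sum:
  fixes g :: "ereal ^ 'd \<Rightarrow> real"
  assumes g: "g \<in> CK_plus"
  obtains S where "finite S" "\<And>b :: 'd code. b \<in> bounded_codes c \<Longrightarrow>
      evals (config b) g = (\<Sum>(q, i)\<in>S. of_bool (b (q, i, None)) * g (code_point b (q, i)))"
proof -
  obtain U where U: "open U" "0 \<in> U" "\<And>z. z \<in> U \<Longrightarrow> g z = 0"
    using CK_plus_support[OF g] by blast
  obtain J where J: "\<And>(b :: 'd code) q i. J \<le> q \<Longrightarrow> code_point b (q, i) \<in> U"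
    using code_point_eventually_near_0[OF U(1,2)] by blast
  define S where "S = Sigma {..<J} (\<lambda>q. {..<c q})"
  have "finite S" by (simp add: S_def)
  show ?thesis
  proof (rule that[OF \<open>finite S\<close>])
    fix b :: "'d code" assume b: "b \<in> bounded_codes c"
    have "g (code_point b p) = 0" if "p \<in> code_index b - S \<inter> code_index b" for p
    proof -
      obtain q i where p: "p = (q, i)" by (cases p)
      have "b (q, i, None)" "\<not> (q < J \<and> i < c q)" using that by (auto simp: p code_index_def S_def)
      moreover from this b have "i < c q" by (auto simp: bounded_codes_def not_le[symmetric])
      ultimately have "J \<le> q" by auto
      then show ?thesis using J U(3) by (simp add: p)
    qed
    then have "evals (config b) g = (\<Sum>p\<in>S \<inter> code_index b. g (code_point b p))"
      unfolding config_def using g \<open>finite S\<close> locally_finite_code[OF b]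
      by (intro evals_point_sum_superset) auto
    also have "\<dots> = (\<Sum>(q, i)\<in>S. of_bool (b (q, i, None)) * g (code_point b (q, i)))"
      using \<open>finite S\<close> by (intro sum.mono_neutral_cong_left) (auto simp: code_index_def)
    finally show "evals (config b) g = (\<Sum>(q, i)\<in>S. of_bool (b (q, i, None)) * g (code_point b (q, i)))" .
  qed
qed

lemma continuous_finite_code_sum:
  assumes "g \<in> CK_plus"
  shows "continuous_on A (\<lambda>b. \<Sum>(q, i)\<in>S. of_bool (b (q, i, None)) * g (code_point b (q, i)))"
  unfolding case_prod_beta
  by (intro continuous_intros continuous_on_of_bool_coordinate
      continuous_on_compose2[OF CK_plus_continuous[OF assms, of UNIV] continuous_code_point]) auto

lemma continuous_evals_config: "continuous_on (bounded_codes c) (\<lambda>b :: 'd::finite code. evals (config b))"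
proof (rule continuous_on_coordinatewise_then_product)
  fix g :: "ereal ^ 'd \<Rightarrow> real"
  show "continuous_on (bounded_codes c) (\<lambda>b :: 'd code. evals (config b) g)"
  proof (cases "g \<in> CK_plus")
    case True
    obtain S where S: "\<And>b :: 'd code. b \<in> bounded_codes c \<Longrightarrow>
      evals (config b) g = (\<Sum>(q, i)\<in>S. of_bool (b (q, i, None)) * g (code_point b (q, i)))"
      using evals_config_finite_sum[OF True] by blast
    show ?thesis
      by (subst continuous_on_cong[OF refl S]) (auto intro: continuous_finite_code_sum[OF True])
  next
    case False
    then show ?thesis by (simp add: evals_def)
  qed
qed

lemma compact_bounded_codes: "compact (bounded_codes c :: 'd code set)"
proof -
  have "bounded_codes c = (\<Inter>q. \<Inter>i\<in>{c q..}. (\<lambda>b :: 'd code. b (q, i, None)) -` {False})"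
    by (auto simp: bounded_codes_def)
  moreover have "closed ((\<lambda>b :: 'd code. b (q, i, None)) -` {False})" for q i
    by (rule continuous_closed_vimage) (auto simp: discrete_topology_class.open_discrete closed_def
        continuous_on_product_coordinates continuous_at_imp_continuous_on intro!: continuous_on_interior[of UNIV])
  ultimately have "closed (bounded_codes c :: 'd code set)" by (auto intro!: closed_INT)
  then show ?thesis using compact_Int_closed[OF compact_UNIV_bool_fun] by auto
qed

text \<open>Chosen for two opposite needs: level q forces a norm above 1 / (q + 1), so exceedances
  bound the number of points per level, and q times a squashed coordinate stays inside (-1, 1), so
  that digits can represent it. The minimum with 1 keeps the level of a nonzero point at least
  1.\<close>

definition level :: "real ^ 'd \<Rightarrow> nat" where
  "level x = nat \<lfloor>1 / min 1 (norm x)\<rfloor>"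

lemma level_bounds:
  assumes "x \<noteq> 0"
  shows "1 \<le> level x" "real (level x) * min 1 (norm x) \<le> 1" "1 / (real (level x) + 1) < norm x"
proof -
  define s where "s = min 1 (norm x)"
  have s: "0 < s" "s \<le> 1" using assms by (auto simp: s_def)
  then have "1 \<le> 1 / s" by simp
  then have fl: "1 \<le> \<lfloor>1 / s\<rfloor>" by (simp add: le_floor_iff)
  show "1 \<le> level x" unfolding level_def s_def[symmetric] using fl by linarith
  have real: "real (level x) = real_of_int \<lfloor>1 / s\<rfloor>"
    unfolding level_def s_def[symmetric] using fl by linarith
  have "real (level x) \<le> 1 / s" unfolding real by linarith
  then show "real (level x) * min 1 (norm x) \<le> 1"
    using s by (simp add: s_def[symmetric] field_simps)
  have "1 / s < real (level x) + 1" unfolding real by linarith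
  then have "1 / (real (level x) + 1) < s"
    using s by (simp add: field_simps)
  then show "1 / (real (level x) + 1) < norm x" by (simp add: s_def)
qed

text \<open>Strictness comes from s / (1 + s) < min 1 s for s > 0; it is needed because the digits
  do not represent the right end point of the unit interval.\<close>

lemma level_squash:
  assumes "x \<noteq> 0"
  shows "\<bar>real (level x) * squash (x $ c)\<bar> < 1"
proof -
  have n: "0 < norm x" using assms by simp
  have frac: "u / (1 + u) \<le> w / (1 + w)" if "0 \<le> u" "u \<le> w" for u w :: real
    using that by (simp add: field_simps)
  have "\<bar>squash (x $ c)\<bar> \<le> norm x / (1 + norm x)"
    unfolding abs_squash by (intro frac component_le_norm_cart) simp
  also have "\<dots> < min 1 (norm x)" using n by (simp add: divide_less_eq less_divide_eq algebra_simps add_pos_pos)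
  finally have "real (level x) * \<bar>squash (x $ c)\<bar> < real (level x) * min 1 (norm x)"
    using level_bounds(1)[OF assms] by simp
  with level_bounds(2)[OF assms] show ?thesis by (simp add: abs_mult)
qed

definition at_level :: "nat \<Rightarrow> (nat \<Rightarrow> real ^ 'd) \<Rightarrow> nat \<Rightarrow> nat set" where
  "at_level n x q = {t \<in> {1..n}. x t \<noteq> 0 \<and> level (x t) = q}"

definition rank_in :: "nat set \<Rightarrow> nat \<Rightarrow> nat" where
  "rank_in T t = card {s \<in> T. s < t}"

lemma bij_betw_rank_in:
  assumes "finite T"
  shows "bij_betw (rank_in T) T {..<card T}"
proof -
  have mono: "rank_in T s < rank_in T t" if "s \<in> T" "s < t" for s t
    unfolding rank_in_def using that assms by (intro psubset_card_mono) auto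
  have "inj_on (rank_in T) T"
    by (intro linorder_inj_onI) (use mono in force)+
  moreover have "rank_in T ` T \<subseteq> {..<card T}"
    unfolding rank_in_def using assms by (auto intro!: psubset_card_mono)
  then have "rank_in T ` T = {..<card T}"
    by (rule card_subset_eq[rotated]) (simp_all add: card_image \<open>inj_on (rank_in T) T\<close>)
  ultimately show ?thesis by (simp add: bij_betw_def)
qed

text \<open>The points of a level are numbered by their rank in time. At most one t has a given
  level and rank, so the existential selects that point; ranging over a finite set, it also keeps
  every bit measurable.\<close>

definition encode :: "nat \<Rightarrow> (nat \<Rightarrow> real ^ 'd) \<Rightarrow> 'd::finite code" where
  "encode n x = (\<lambda>(q, i, d). case d of
     None \<Rightarrow> i < card (at_level n x q)
   | Some (c, k) \<Rightarrow> \<exists>t\<in>{1..n}. t \<in> at_level n x q \<and> rank_in (at_level n x q) t = i \<and>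
        bindig ((real q * squash (x t $ c) + 1) / 2) k)"

lemma finite_at_level [simp]: "finite (at_level n x q)"
  by (simp add: at_level_def)

text \<open>The affine map from (-1, 1) to (0, 1) that precedes the digits is undone in
  \<open>code_point\<close>, and division by q removes the rescaling.\<close>

lemma code_point_encode:
  assumes t: "t \<in> at_level n x q"
  shows "code_point (encode n x) (q, rank_in (at_level n x q) t) = emb (x t)"
proof -
  have x: "x t \<noteq> 0" "level (x t) = q" using t by (auto simp: at_level_def)
  have "encode n x (q, rank_in (at_level n x q) t, Some (c, k)) = bindig ((real q * squash (x t $ c) + 1) / 2) k"
    for c k
  proof -
    have "s = t" if "s \<in> at_level n x q" "rank_in (at_level n x q) s = rank_in (at_level n x q) t" for s
      using bij_betw_rank_in[of "at_level n x q"] that t by (auto simp: bij_betw_def inj_on_def)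
    moreover have "t \<in> {1..n}" using t by (simp add: at_level_def)
    ultimately show ?thesis using t by (auto simp: encode_def)
  qed
  moreover have "binval (bindig ((real q * squash (x t $ c) + 1) / 2)) = (real q * squash (x t $ c) + 1) / 2" for c
    using level_squash[OF x(1), of c] by (intro binval_bindig) (auto simp: x(2) abs_less_iff)
  ultimately have "code_point (encode n x) (q, rank_in (at_level n x q) t) =
      decode ((1 / real q) *\<^sub>R (\<chi> c. real q * squash (x t $ c)))"
    by (simp add: code_point_def field_simps)
  also have "(1 / real q) *\<^sub>R (\<chi> c. real q * squash (x t $ c)) = (\<chi> c. squash (x t $ c))"
    using level_bounds(1)[OF x(1)] x(2) by (simp add: vec_eq_iff)
  finally show ?thesis by (simp add: decode_squash)
qed

lemma encode_bounded_iff: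
  "encode n x \<in> bounded_codes c \<longleftrightarrow> (\<forall>q. card (at_level n x q) \<le> c q)"
  by (auto simp: bounded_codes_def encode_def not_less intro: order_trans)

text \<open>Level and rank map the nonzero sample points bijectively onto the indices of the code;
  points at the origin contribute nothing since g vanishes there.\<close>

lemma evals_config_encode:
  fixes x :: "nat \<Rightarrow> real ^ 'd::finite"
  assumes g: "g \<in> CK_plus"
  shows "evals (config (encode n x)) g = (\<Sum>t=1..n. g (emb (x t)))"
proof -
  define A where "A = {t \<in> {1..n}. x t \<noteq> 0}"
  define e where "e t = (level (x t), rank_in (at_level n x (level (x t))) t)" for t
  have at: "t \<in> at_level n x (level (x t))" if "t \<in> A" for t
    using that by (auto simp: A_def at_level_def)
  have inj: "inj_on e A"
  proof (rule inj_onI)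
    fix s t assume st: "s \<in> A" "t \<in> A" "e s = e t"
    then have "level (x s) = level (x t)" and
      "rank_in (at_level n x (level (x t))) s = rank_in (at_level n x (level (x t))) t"
      by (auto simp: e_def)
    then show "s = t"
      using bij_betw_rank_in[of "at_level n x (level (x t))"] at[OF st(1)] at[OF st(2)]
      by (auto simp: bij_betw_def inj_on_def)
  qed
  have img: "e ` A = code_index (encode n x)"
  proof (intro equalityI subsetI)
    fix p assume "p \<in> e ` A"
    then obtain t where t: "t \<in> A" "p = e t" by auto
    have "rank_in (at_level n x (level (x t))) t < card (at_level n x (level (x t)))"
      using bij_betw_rank_in[of "at_level n x (level (x t))"] at[OF t(1)] by (auto simp: bij_betw_def)
    then show "p \<in> code_index (encode n x)" by (simp add: t(2) e_def code_index_def encode_def)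
  next
    fix p assume p: "p \<in> code_index (encode n x)"
    obtain q i where qi: "p = (q, i)" by (cases p)
    then have "i \<in> {..<card (at_level n x q)}" using p by (simp add: code_index_def encode_def)
    then obtain t where t: "t \<in> at_level n x q" "rank_in (at_level n x q) t = i"
      using bij_betw_rank_in[of "at_level n x q"] unfolding bij_betw_def by (metis finite_at_level imageE)
    then have "t \<in> A" "level (x t) = q" by (auto simp: at_level_def A_def)
    then show "p \<in> e ` A" using t(2) by (auto simp: qi e_def)
  qed
  have fin: "finite (code_index (encode n x))" unfolding img[symmetric] by (simp add: A_def)
  have "evals (config (encode n x)) g = (\<Sum>p\<in>e ` A. g (code_point (encode n x) p))"
    unfolding config_def img using fin g
    by (intro evals_point_sum_superset locally_finite_finite) auto
  also have "\<dots> = (\<Sum>t\<in>A. g (code_point (encode n x) (e t)))"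
    by (rule sum.reindex_cong[OF inj]) auto
  also have "\<dots> = (\<Sum>t\<in>A. g (emb (x t)))"
    using at by (intro sum.cong) (auto simp: e_def code_point_encode)
  also have "\<dots> = (\<Sum>t=1..n. g (emb (x t)))"
  proof (rule sum.mono_neutral_left)
    have "g (emb 0) = 0"
    proof -
      have "emb (0 :: real ^ 'd) = 0" by (simp add: emb_def vec_eq_iff zero_ereal_def)
      then show ?thesis using CK_plus_zero[OF g] by simp
    qed
    then show "\<forall>t\<in>{1..n} - A. g (emb (x t)) = 0" by (auto simp: A_def)
  qed (auto simp: A_def)
  finally show ?thesis .
qed

lemma measurable_level [measurable]: "(level :: real ^ 'd \<Rightarrow> nat) \<in> measurable borel (count_space UNIV)"
  unfolding level_def by measurable

text \<open>The cardinality is the integer part of a real sum of indicators, which reduces the claim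
  to measurability of real functions.\<close>

lemma pred_card_eq:
  assumes [measurable]: "\<And>s. s \<in> S \<Longrightarrow> Measurable.pred M (\<lambda>\<omega>. P s \<omega>)" and S: "finite S"
  shows "(\<lambda>\<omega>. card {s \<in> S. P s \<omega>}) \<in> measurable M (count_space UNIV)"
proof -
  have "(\<lambda>\<omega>. \<Sum>s\<in>S. indicator {\<omega> \<in> space M. P s \<omega>} \<omega> :: real) \<in> borel_measurable M"
    by measurable
  then have "(\<lambda>\<omega>. nat \<lfloor>\<Sum>s\<in>S. indicator {\<omega> \<in> space M. P s \<omega>} \<omega> :: real\<rfloor>) \<in> measurable M (count_space UNIV)"
    by measurable
  moreover have "nat \<lfloor>\<Sum>s\<in>S. indicator {\<omega> \<in> space M. P s \<omega>} \<omega> :: real\<rfloor> = card {s \<in> S. P s \<omega>}"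
    if "\<omega> \<in> space M" for \<omega>
    using S that by (simp add: indicator_def sum.If_cases Int_def)
  ultimately show ?thesis
    by (subst measurable_cong[where g="\<lambda>\<omega>. nat \<lfloor>\<Sum>s\<in>S. indicator {\<omega> \<in> space M. P s \<omega>} \<omega> :: real\<rfloor>"]) auto
qed

lemma measurable_bindig [measurable]: "Measurable.pred borel (\<lambda>v. bindig v k)"
  unfolding bindig_def by measurable

lemma measurable_squash [measurable]: "squash \<in> borel_measurable borel"
  unfolding squash_def[abs_def] by measurable

lemma measurable_encode:
  fixes x :: "'w \<Rightarrow> nat \<Rightarrow> real ^ 'd::finite"
  assumes [measurable]: "\<And>t. (\<lambda>\<omega>. x \<omega> t) \<in> borel_measurable M"
  shows "Measurable.pred M (\<lambda>\<omega>. encode n (x \<omega>) p)"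
    and "(\<lambda>\<omega>. card (at_level n (x \<omega>) q)) \<in> measurable M (count_space UNIV)"
proof -
  have at[measurable]: "Measurable.pred M (\<lambda>\<omega>. t \<in> at_level n (x \<omega>) q)" for t q
    unfolding at_level_def by measurable
  have "(\<lambda>\<omega>. card {t \<in> {1..n}. t \<in> at_level n (x \<omega>) q}) \<in> measurable M (count_space UNIV)" for q
    by (rule pred_card_eq) auto
  moreover have "{t \<in> {1..n}. t \<in> at_level n (x \<omega>) q} = at_level n (x \<omega>) q" for \<omega> q
    by (auto simp: at_level_def)
  ultimately show card[measurable]: "(\<lambda>\<omega>. card (at_level n (x \<omega>) q)) \<in> measurable M (count_space UNIV)" for q
    by simp
  have "(\<lambda>\<omega>. card {s \<in> {1..n}. s \<in> at_level n (x \<omega>) q \<and> s < t}) \<in> measurable M (count_space UNIV)" for q t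
    by (rule pred_card_eq) auto
  moreover have "{s \<in> {1..n}. s \<in> at_level n (x \<omega>) q \<and> s < t} = {s \<in> at_level n (x \<omega>) q. s < t}" for \<omega> q t
    by (auto simp: at_level_def)
  ultimately have rank_in[measurable]: "(\<lambda>\<omega>. rank_in (at_level n (x \<omega>) q) t) \<in> measurable M (count_space UNIV)" for q t
    by (simp add: rank_in_def)
  obtain q i d where p: "p = (q, i, d)" by (cases p)
  show "Measurable.pred M (\<lambda>\<omega>. encode n (x \<omega>) p)"
  proof (cases d)
    case None
    then show ?thesis by (simp add: p encode_def)
  next
    case (Some ck)
    obtain c k where ck: "ck = (c, k)" by (cases ck)
    have [measurable]: "(\<lambda>\<omega>. x \<omega> t $ c) \<in> borel_measurable M" for t
      by (rule measurable_compose[OF assms, of "\<lambda>v. v $ c"])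
         (intro borel_measurable_continuous_onI continuous_intros)
    have [measurable]: "Measurable.pred M (\<lambda>\<omega>. bindig ((real q * squash (x \<omega> t $ c) + 1) / 2) k)" for t
      by (rule measurable_compose[OF _ measurable_bindig]) measurable
    have "Measurable.pred M (\<lambda>\<omega>. \<exists>t\<in>{1..n}. t \<in> at_level n (x \<omega>) q \<and>
        rank_in (at_level n (x \<omega>) q) t = i \<and> bindig ((real q * squash (x \<omega> t $ c) + 1) / 2) k)"
      by (intro pred_intros_finite pred_intros_logic) measurable
    with Some show ?thesis by (simp add: p ck encode_def)
  qed
qed

section \<open>Convergence from Laplace functionals\<close>

lemma expectation_close:
  fixes f F :: "'a \<Rightarrow> real"
  assumes "prob_space M" and [measurable]: "f \<in> borel_measurable M" "F \<in> borel_measurable M" "E \<in> sets M"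
    and d: "measure M (space M - E) \<le> d" and e: "0 \<le> e" "0 \<le> B"
    and close: "\<And>\<omega>. \<omega> \<in> E \<Longrightarrow> \<bar>f \<omega> - F \<omega>\<bar> \<le> e"
    and bound: "\<And>\<omega>. \<omega> \<in> space M \<Longrightarrow> \<bar>f \<omega>\<bar> \<le> B" "\<And>\<omega>. \<omega> \<in> space M \<Longrightarrow> \<bar>F \<omega>\<bar> \<le> B"
  shows "\<bar>(\<integral>\<omega>. f \<omega> \<partial>M) - (\<integral>\<omega>. F \<omega> \<partial>M)\<bar> \<le> e + 2 * B * d"
proof -
  interpret prob_space M by fact
  have int: "integrable M f" "integrable M F"
    using bound by (auto intro!: integrable_const_bound[where B=B])
  have "\<bar>(\<integral>\<omega>. f \<omega> \<partial>M) - (\<integral>\<omega>. F \<omega> \<partial>M)\<bar> = \<bar>\<integral>\<omega>. f \<omega> - F \<omega> \<partial>M\<bar>"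
    using int by simp
  also have "\<dots> \<le> (\<integral>\<omega>. \<bar>f \<omega> - F \<omega>\<bar> \<partial>M)" by (rule integral_abs_bound)
  also have "\<dots> \<le> (\<integral>\<omega>. e + 2 * B * indicator (space M - E) \<omega> \<partial>M)"
  proof (rule integral_mono)
    show "integrable M (\<lambda>\<omega>. \<bar>f \<omega> - F \<omega>\<bar>)" using int by auto
    show "integrable M (\<lambda>\<omega>. e + 2 * B * indicator (space M - E) \<omega>)"
      by (intro Bochner_Integration.integrable_add integrable_const integrable_mult_right integrable_real_indicator)
         (auto simp: less_top[symmetric])
    fix \<omega> assume \<omega>: "\<omega> \<in> space M"
    show "\<bar>f \<omega> - F \<omega>\<bar> \<le> e + 2 * B * indicator (space M - E) \<omega>"
      using close[of \<omega>] bound[OF \<omega>] e \<omega> by (cases "\<omega> \<in> E") auto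
  qed
  also have "\<dots> = e + 2 * B * measure M (space M - E)"
    by (subst Bochner_Integration.integral_add)
       (auto simp: prob_space less_top[symmetric] intro!: integrable_mult_right integrable_real_indicator)
  also have "\<dots> \<le> e + 2 * B * d" using d e by (simp add: mult_left_mono)
  finally show ?thesis .
qed

lemma continuous_emb: "continuous_on A emb"
proof -
  have "(emb \<longlongrightarrow> emb v) (at v within A)" for v :: "real ^ 'a"
    by (rule vec_tendstoI) (auto simp: emb_def intro!: tendsto_intros)
  then show ?thesis by (simp add: continuous_on_def)
qed

text \<open>The integrals factor through the whole sequence by a map S that is continuous into the
  product over all test functions. This handles uncountably many integrals at once, while the
  sequence itself is measurable coordinate by coordinate.\<close>

lemma sample_process_measurable:
  fixes X :: "int \<Rightarrow> 'w \<Rightarrow> real ^ 'd"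
  assumes X: "\<And>t. X t \<in> borel_measurable M"
  shows "sample_process X a n j \<in> measurable M (borel_of_topology vague_topology)"
proof (rule measurable_vagueI)
  show "sample_process X a n j \<omega> \<in> point_measures" for \<omega>
    unfolding sample_process_eq_point_sum by (intro point_sum_point_measure locally_finite_finite) simp
  fix V :: "((ereal ^ 'd \<Rightarrow> real) \<Rightarrow> real) set" assume "open V"
  define S where "S v g = (if g \<in> CK_plus then \<Sum>t=1..j. g (emb (v (int t) /\<^sub>R a n)) else 0)"
    for v :: "int \<Rightarrow> real ^ 'd" and g :: "ereal ^ 'd \<Rightarrow> real"
  have "continuous_on UNIV (\<lambda>v. S v g)" for g
  proof (cases "g \<in> CK_plus")
    case True
    then show ?thesis unfolding S_def
      by (auto intro!: continuous_intros continuous_on_compose2[OF CK_plus_continuous[OF True, of UNIV]]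
          continuous_on_compose2[OF continuous_emb[of UNIV]])
  qed (simp add: S_def)
  then have "continuous_on UNIV S" by (rule continuous_on_coordinatewise_then_product)
  then have "S \<in> borel_measurable borel" by (rule borel_measurable_continuous_onI)
  moreover have "(\<lambda>\<omega> t. X t \<omega>) \<in> borel_measurable M"
    by (rule measurable_coordinatewise_then_product) (rule X)
  ultimately have "(\<lambda>\<omega>. S (\<lambda>t. X t \<omega>)) \<in> borel_measurable M" by (rule measurable_compose[rotated])
  moreover have "evals (sample_process X a n j \<omega>) = S (\<lambda>t. X t \<omega>)" for \<omega>
  proof
    fix g :: "ereal ^ 'd \<Rightarrow> real"
    show "evals (sample_process X a n j \<omega>) g = S (\<lambda>t. X t \<omega>) g"
    proof (cases "g \<in> CK_plus")
      case True
      then show ?thesis using evals_sample_process[OF True, of X a n j \<omega>] by (simp add: S_def)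
    next
      case False
      then show ?thesis by (simp add: S_def evals_def)
    qed
  qed
  ultimately show "{\<omega> \<in> space M. evals (sample_process X a n j \<omega>) \<in> V} \<in> sets M"
    using measurable_sets[of "\<lambda>\<omega>. S (\<lambda>t. X t \<omega>)" M borel V] \<open>open V\<close>
    by (simp add: vimage_def Int_def conj_commute)
qed

text \<open>Markov's inequality at each level: points of level q have norm above 1 / (q + 1), and
  the expected number of such points is at most \<open>C q\<close>. The caps make the failure
  probabilities sum to at most e.\<close>

lemma encode_tight:
  fixes x :: "nat \<Rightarrow> 'w \<Rightarrow> nat \<Rightarrow> real ^ 'd::finite"
  assumes "prob_space M" and x: "\<And>n t. (\<lambda>\<omega>. x n \<omega> t) \<in> borel_measurable M"
    and tight: "\<And>q::nat. \<exists>C. \<forall>n. (\<Sum>t=1..n. measure M {\<omega> \<in> space M. norm (x n \<omega> t) > 1 / (real q + 1)}) \<le> C"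
    and e: "0 < e"
  obtains c where "\<And>n. measure M {\<omega> \<in> space M. encode n (x n \<omega>) \<notin> bounded_codes c} \<le> e"
proof -
  interpret prob_space M by fact
  obtain C where C: "\<And>q n. (\<Sum>t=1..n. measure M {\<omega> \<in> space M. norm (x n \<omega> t) > 1 / (real q + 1)}) \<le> C q"
    using choice[of "\<lambda>q C. \<forall>n. (\<Sum>t=1..n. measure M {\<omega> \<in> space M. norm (x n \<omega> t) > 1 / (real q + 1)}) \<le> C"] tight
    by blast
  \<comment> \<open>Failure at level q means at least \<open>c q + 1\<close> points, so Markov's
    bound is \<open>C q / (c q + 1)\<close>, which this choice makes at most
    \<open>e * (1/2) ^ Suc q\<close>.\<close>
  define c where "c q = nat \<lceil>C q * 2 ^ Suc q / e\<rceil>" for q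
  have c: "C q \<le> real (c q + 1) * (e * (1/2) ^ Suc q)" for q
  proof -
    have "C q * 2 ^ Suc q / e \<le> real (c q + 1)" unfolding c_def by linarith
    then show ?thesis using e by (simp add: field_simps power_one_over)
  qed
  note [measurable] = x measurable_encode(2)[where x="x n" for n, OF x]
  show ?thesis
  proof (rule that[of c])
    fix n
    define B where "B q = {\<omega> \<in> space M. c q < card (at_level n (x n \<omega>) q)}" for q
    have B[measurable]: "B q \<in> sets M" for q unfolding B_def by measurable
    have Bq: "measure M (B q) \<le> e * (1/2) ^ Suc q" for q
    proof -
      let ?A = "\<lambda>t. {\<omega> \<in> space M. norm (x n \<omega> t) > 1 / (real q + 1)}"
      have "real (c q + 1) * measure M (B q) = (\<integral>\<omega>. real (c q + 1) * indicator (B q) \<omega> \<partial>M)"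
        by simp
      also have "\<dots> \<le> (\<integral>\<omega>. (\<Sum>t=1..n. indicator (?A t) \<omega>) \<partial>M)"
      proof (rule integral_mono)
        show "integrable M (\<lambda>\<omega>. real (c q + 1) * indicator (B q) \<omega>)" by (intro integrable_mult_right integrable_real_indicator) (auto simp: less_top[symmetric])
        show "integrable M (\<lambda>\<omega>. \<Sum>t=1..n. indicator (?A t) \<omega> :: real)"
          by (intro Bochner_Integration.integrable_sum integrable_real_indicator) (auto simp: less_top[symmetric])
        fix \<omega> assume \<omega>: "\<omega> \<in> space M"
        have "real (card (at_level n (x n \<omega>) q)) \<le> (\<Sum>t=1..n. indicator (?A t) \<omega>)"
        proof -
          have "real (card (at_level n (x n \<omega>) q)) = (\<Sum>t\<in>at_level n (x n \<omega>) q. 1)" by simp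
          also have "\<dots> = (\<Sum>t\<in>at_level n (x n \<omega>) q. indicator (?A t) \<omega>)"
          proof (rule sum.cong[OF refl])
            fix t assume "t \<in> at_level n (x n \<omega>) q"
            then have "1 / (real q + 1) < norm (x n \<omega> t)"
              using level_bounds(3)[of "x n \<omega> t"] by (auto simp: at_level_def)
            then show "1 = indicator (?A t) \<omega>" using \<omega> by simp
          qed
          also have "\<dots> \<le> (\<Sum>t=1..n. indicator (?A t) \<omega>)"
            by (rule sum_mono2) (auto simp: at_level_def)
          finally show ?thesis .
        qed
        moreover have "real (c q + 1) * indicator (B q) \<omega> \<le> real (card (at_level n (x n \<omega>) q))"
          by (cases "\<omega> \<in> B q") (auto simp: B_def)
        ultimately show "real (c q + 1) * indicator (B q) \<omega> \<le> (\<Sum>t=1..n. indicator (?A t) \<omega>)"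
          by linarith
      qed
      also have "\<dots> = (\<Sum>t=1..n. measure M (?A t))"
        by (subst Bochner_Integration.integral_sum) (auto intro!: integrable_real_indicator simp: less_top[symmetric])
      also have "\<dots> \<le> real (c q + 1) * (e * (1/2) ^ Suc q)" using order_trans[OF C c] by blast
      finally show ?thesis by (subst (asm) mult_le_cancel_left_pos) auto
    qed
    have sums: "(\<lambda>q. e * (1/2) ^ Suc q) sums e"
      using sums_mult[OF power_half_series, of e] by simp
    have summ: "summable (\<lambda>q. measure M (B q))"
      by (rule summable_comparison_test'[OF sums_summable[OF sums], of 0]) (use Bq in simp)
    have "{\<omega> \<in> space M. encode n (x n \<omega>) \<notin> bounded_codes c} = (\<Union>q. B q)"
      by (auto simp: encode_bounded_iff B_def not_le)
    also have "measure M \<dots> \<le> (\<Sum>q. measure M (B q))"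
      by (rule finite_measure_subadditive_countably) (use summ in auto)
    also have "\<dots> \<le> (\<Sum>q. e * (1/2) ^ Suc q)"
      by (rule suminf_le[OF Bq summ sums_summable[OF sums]])
    also have "\<dots> = e" by (rule sums_unique[OF sums, symmetric])
    finally show "measure M {\<omega> \<in> space M. encode n (x n \<omega>) \<notin> bounded_codes c} \<le> e" .
  qed
qed

text \<open>A continuous substitute, depending on finitely many bits, for the indicator of the
  complement of \<open>bounded_codes c\<close>: it is 1 if a forbidden bit with both indices below Q
  is set and 0 otherwise.\<close>

definition overflow :: "(nat \<Rightarrow> nat) \<Rightarrow> nat \<Rightarrow> 'd code \<Rightarrow> real" where
  "overflow c Q b = 1 - (\<Prod>p\<in>Sigma {..<Q} (\<lambda>q. {c q..<Q}). 1 - of_bool (b (fst p, snd p, None)))"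

lemma overflow_bounds: "0 \<le> overflow c Q b" "overflow c Q b \<le> 1"
  unfolding overflow_def by (auto intro!: prod_le_1 prod_nonneg)

lemma overflow_bounded_codes: "b \<in> bounded_codes c \<Longrightarrow> overflow c Q b = 0"
  unfolding overflow_def by (subst prod.neutral) (auto simp: bounded_codes_def)

lemma overflow_eventually:
  assumes "b \<notin> bounded_codes c"
  shows "(\<lambda>Q. overflow c Q b) \<longlonglongrightarrow> 1"
proof -
  obtain q i where qi: "c q \<le> i" "b (q, i, None)" using assms by (auto simp: bounded_codes_def)
  have "\<forall>\<^sub>F Q in sequentially. overflow c Q b = 1"
    using eventually_gt_at_top[of "max q i"]
  proof eventually_elim
    case (elim Q)
    then have "(q, i) \<in> Sigma {..<Q} (\<lambda>q. {c q..<Q})" using qi by auto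
    then have "(\<Prod>p\<in>Sigma {..<Q} (\<lambda>q. {c q..<Q}). 1 - of_bool (b (fst p, snd p, None)) :: real) = 0"
      using qi by (intro prod_zero) force+
    then show ?case by (simp add: overflow_def)
  qed
  then show ?thesis by (rule tendsto_eventually)
qed

lemma continuous_overflow: "continuous_on A (overflow c Q)"
  unfolding overflow_def[abs_def]
  by (intro continuous_intros continuous_on_of_bool_coordinate)

lemma borel_bounded_codes: "bounded_codes c \<in> sets (borel :: ('d::finite code) measure)"
  by (intro borel_closed compact_imp_closed compact_bounded_codes)

text \<open>Compactness of the codes yields a subsequential limit, whose Laplace functional must be
  L. The whole sequence then converges because expectations over the exponential algebra are finite
  combinations of Laplace functionals, and uniform tightness extends this to bounded vaguely
  continuous functions.\<close>

theorem sample_process_converges: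
  fixes X :: "int \<Rightarrow> 'w \<Rightarrow> real ^ 'd"
  assumes M: "prob_space M" and X: "\<And>t. X t \<in> borel_measurable M"
    and tight: "\<And>q::nat. \<exists>C. \<forall>n.
      (\<Sum>t=1..n. measure M {\<omega> \<in> space M. norm (X (int t) \<omega> /\<^sub>R a n) > 1 / (real q + 1)}) \<le> C"
    and L: "\<And>g. g \<in> CK_plus \<Longrightarrow> (\<lambda>n. laplace_functional M (sample_process X a n n) g) \<longlonglongrightarrow> L g"
  shows "\<exists>(P :: (ereal ^ 'd) measure measure) N. prob_space P \<and> point_process P N \<and>
      converges_in_distribution vague_topology M (\<lambda>n. sample_process X a n n) P N \<and>
      (\<forall>g\<in>CK_plus. laplace_functional P N g = L g)"
proof -
  interpret M: prob_space M by fact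
  let ?BV = "borel_of_topology vague_topology :: (ereal ^ 'd) measure measure"
  define x where "x n \<omega> t = X (int t) \<omega> /\<^sub>R a n" for n \<omega> and t :: nat
  have x[measurable]: "(\<lambda>\<omega>. x n \<omega> t) \<in> borel_measurable M" for n t
    unfolding x_def using X by (intro borel_measurable_scaleR) auto
  define \<xi> where "\<xi> n \<omega> = encode n (x n \<omega>)" for n \<omega>
  have \<xi>[measurable]: "Measurable.pred M (\<lambda>\<omega>. \<xi> n \<omega> i)" for n i
    unfolding \<xi>_def using x by (rule measurable_encode(1))
  have \<xi>_borel[measurable]: "\<xi> n \<in> borel_measurable M" for n
    using \<xi> by (rule borel_measurable_bool_fun)
  let ?N = "\<lambda>n. sample_process X a n n"
  have N[measurable]: "?N n \<in> measurable M ?BV" for n using X by (rule sample_process_measurable)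
  have N_code: "evals (?N n \<omega>) = evals (config (\<xi> n \<omega>))" for n \<omega>
  proof
    fix g :: "ereal ^ 'd \<Rightarrow> real"
    show "evals (?N n \<omega>) g = evals (config (\<xi> n \<omega>)) g"
    proof (cases "g \<in> CK_plus")
      case True
      then show ?thesis
        using evals_sample_process[OF True, of X a n n \<omega>] evals_config_encode[OF True, of n "x n \<omega>"]
        by (simp add: \<xi>_def x_def)
    next
      case False
      then show ?thesis by (simp add: evals_def)
    qed
  qed
  have "\<exists>c. \<forall>n. measure M {\<omega> \<in> space M. \<xi> n \<omega> \<notin> bounded_codes c} \<le> 1 / (real k + 1)" for k :: nat
  proof -
    have pos: "0 < 1 / (real k + 1)" by simp
    obtain c where "\<And>n. measure M {\<omega> \<in> space M. encode n (x n \<omega>) \<notin> bounded_codes c} \<le> 1 / (real k + 1)"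
      by (rule encode_tight[OF M x tight[folded x_def] pos]) blast
    then show ?thesis unfolding \<xi>_def by blast
  qed
  then have "\<forall>k::nat. \<exists>c. \<forall>n. measure M {\<omega> \<in> space M. \<xi> n \<omega> \<notin> bounded_codes c} \<le> 1 / (real k + 1)"
    by (rule allI)
  from choice[OF this] obtain c
    where c_all: "\<forall>k n. measure M {\<omega> \<in> space M. \<xi> n \<omega> \<notin> bounded_codes (c k)} \<le> 1 / (real k + 1)"
    by (rule exE)
  have c: "measure M {\<omega> \<in> space M. \<xi> n \<omega> \<notin> bounded_codes (c k)} \<le> 1 / (real k + 1)" for k n
    using c_all by (elim allE)
  obtain r P0 \<zeta> where r: "strict_mono r" and P0: "prob_space (P0 :: real measure)"
    and \<zeta>: "\<And>i. Measurable.pred P0 (\<lambda>\<omega>. \<zeta> \<omega> i)"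
    and lim: "\<And>F. continuous_on UNIV F \<Longrightarrow>
       (\<lambda>n. \<integral>\<omega>. F (\<xi> (r n) \<omega>) \<partial>M) \<longlonglongrightarrow> (\<integral>\<omega>. (F (\<zeta> \<omega>) :: real) \<partial>P0)"
    by (rule bool_fun_convergent_subsequence[OF M \<xi>]) (rule that, assumption+)
  interpret P0: prob_space P0 by fact
  have \<zeta>_borel[measurable]: "\<zeta> \<in> borel_measurable P0" using \<zeta> by (rule borel_measurable_bool_fun)
  have borelM[measurable]: "F \<in> borel_measurable borel" if "continuous_on UNIV F"
    for F :: "'d code \<Rightarrow> real" using that by (rule borel_measurable_continuous_onI)
  have bc[measurable]: "Measurable.pred borel (\<lambda>b :: 'd code. b \<in> bounded_codes c')" for c'
    by (rule pred_sets2[OF borel_bounded_codes measurable_ident_sets]) simp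
  \<comment> \<open>An indicator cannot be carried through the weak limit directly. Each
    \<open>overflow\<close> is continuous and keeps the bound in the limit; afterwards Q goes to
    infinity.\<close>
  have \<zeta>_tight: "measure P0 {\<omega> \<in> space P0. \<zeta> \<omega> \<notin> bounded_codes (c k)} \<le> 1 / (real k + 1)" for k
  proof -
    have [measurable]: "overflow (c k) Q \<in> borel_measurable (borel :: 'd code measure)" for Q
      by (rule borel_measurable_continuous_onI[OF continuous_overflow])
    have *: "(\<integral>\<omega>. overflow (c k) Q (\<xi> n \<omega>) \<partial>M) \<le> 1 / (real k + 1)" for Q n
    proof -
      have "(\<integral>\<omega>. overflow (c k) Q (\<xi> n \<omega>) \<partial>M) \<le>
          (\<integral>\<omega>. indicator {\<omega> \<in> space M. \<xi> n \<omega> \<notin> bounded_codes (c k)} \<omega> \<partial>M)"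
      proof (rule integral_mono)
        show "integrable M (\<lambda>\<omega>. overflow (c k) Q (\<xi> n \<omega>))"
          by (intro M.integrable_const_bound[where B=1]) (auto simp: overflow_bounds)
        show "integrable M (\<lambda>\<omega>. indicator {\<omega> \<in> space M. \<xi> n \<omega> \<notin> bounded_codes (c k)} \<omega> :: real)"
          by (intro integrable_real_indicator) (auto simp: less_top[symmetric])
        show "overflow (c k) Q (\<xi> n \<omega>) \<le> indicator {\<omega> \<in> space M. \<xi> n \<omega> \<notin> bounded_codes (c k)} \<omega>"
          if "\<omega> \<in> space M" for \<omega>
          using that overflow_bounds[of "c k" Q "\<xi> n \<omega>"] overflow_bounded_codes[of "\<xi> n \<omega>" "c k" Q]
          by (cases "\<xi> n \<omega> \<in> bounded_codes (c k)") auto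
      qed
      also have "\<dots> \<le> 1 / (real k + 1)" using c by simp
      finally show ?thesis .
    qed
    have **: "(\<integral>\<omega>. overflow (c k) Q (\<zeta> \<omega>) \<partial>P0) \<le> 1 / (real k + 1)" for Q
      by (rule LIMSEQ_le_const2[OF lim[OF continuous_overflow]]) (use * in blast)
    have "(\<lambda>Q. \<integral>\<omega>. overflow (c k) Q (\<zeta> \<omega>) \<partial>P0) \<longlonglongrightarrow>
        (\<integral>\<omega>. indicator {\<omega> \<in> space P0. \<zeta> \<omega> \<notin> bounded_codes (c k)} \<omega> \<partial>P0)"
    proof (rule integral_dominated_convergence[where w="\<lambda>_. 1"])
      show "AE \<omega> in P0. (\<lambda>Q. overflow (c k) Q (\<zeta> \<omega>)) \<longlonglongrightarrow>
          indicator {\<omega> \<in> space P0. \<zeta> \<omega> \<notin> bounded_codes (c k)} \<omega>"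
      proof (rule AE_I2)
        fix \<omega> assume "\<omega> \<in> space P0"
        then show "(\<lambda>Q. overflow (c k) Q (\<zeta> \<omega>)) \<longlonglongrightarrow>
          indicator {\<omega> \<in> space P0. \<zeta> \<omega> \<notin> bounded_codes (c k)} \<omega>"
          using overflow_eventually[of "\<zeta> \<omega>" "c k"] overflow_bounded_codes[of "\<zeta> \<omega>" "c k"]
          by (cases "\<zeta> \<omega> \<in> bounded_codes (c k)") auto
      qed
    qed (auto simp: overflow_bounds)
    then have "(\<lambda>Q. \<integral>\<omega>. overflow (c k) Q (\<zeta> \<omega>) \<partial>P0) \<longlonglongrightarrow>
        measure P0 {\<omega> \<in> space P0. \<zeta> \<omega> \<notin> bounded_codes (c k)}" by simp
    then show ?thesis by (rule LIMSEQ_le_const2) (use ** in blast)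
  qed
  \<comment> \<open>By \<open>\<zeta>_tight\<close> the codes outside every
    \<open>bounded_codes (c k)\<close> form a null event. Clearing all their bits makes the decoded
    measure a point measure everywhere, as measurability into the space requires.\<close>
  define \<zeta>' where "\<zeta>' \<omega> i \<longleftrightarrow> \<zeta> \<omega> i \<and> (\<exists>k. \<zeta> \<omega> \<in> bounded_codes (c k))" for \<omega> i
  have \<zeta>'_pred: "Measurable.pred P0 (\<lambda>\<omega>. \<zeta>' \<omega> i)" for i
    unfolding \<zeta>'_def using \<zeta> by measurable
  have \<zeta>'_borel[measurable]: "\<zeta>' \<in> borel_measurable P0" using \<zeta>'_pred by (rule borel_measurable_bool_fun)
  have \<zeta>'_eq: "\<zeta>' \<omega> = \<zeta> \<omega>" if "\<zeta> \<omega> \<in> bounded_codes (c k)" for \<omega> k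
    by (rule ext) (use that in \<open>auto simp: \<zeta>'_def\<close>)
  have \<zeta>'_good: "\<exists>k. \<zeta>' \<omega> \<in> bounded_codes (c k)" for \<omega>
  proof (cases "\<exists>k. \<zeta> \<omega> \<in> bounded_codes (c k)")
    case True
    then obtain k where k: "\<zeta> \<omega> \<in> bounded_codes (c k)" ..
    show ?thesis by (rule exI[of _ k]) (simp only: \<zeta>'_eq[OF k] k)
  next
    case False
    then have "\<zeta>' \<omega> = (\<lambda>_. False)" by (intro ext) (simp add: \<zeta>'_def)
    then show ?thesis by (simp add: bounded_codes_def)
  qed
  have N0[measurable]: "(\<lambda>\<omega>. config (\<zeta>' \<omega>)) \<in> measurable P0 ?BV"
  proof (rule measurable_vagueI)
    show "config (\<zeta>' \<omega>) \<in> point_measures" for \<omega> using \<zeta>'_good config_point_measure by blast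
    fix V :: "((ereal ^ 'd \<Rightarrow> real) \<Rightarrow> real) set" assume "open V"
    \<comment> \<open>Decoding is continuous on each bounded set separately, so the preimage of V is
      pieced together from relatively open sets over countably many k.\<close>
    then have "\<exists>W. open W \<and> W \<inter> bounded_codes c' = (\<lambda>b :: 'd code. evals (config b)) -` V \<inter> bounded_codes c'" for c'
      using continuous_evals_config[of c'] unfolding continuous_on_open_invariant by blast
    then have "\<forall>k. \<exists>W. open W \<and> W \<inter> bounded_codes (c k) = (\<lambda>b :: 'd code. evals (config b)) -` V \<inter> bounded_codes (c k)"
      by (intro allI)
    from choice[OF this] obtain W where W_all: "\<forall>k. open (W k) \<and>
      W k \<inter> bounded_codes (c k) = (\<lambda>b :: 'd code. evals (config b)) -` V \<inter> bounded_codes (c k)"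
      by (rule exE)
    have W: "open (W k)"
      "W k \<inter> bounded_codes (c k) = (\<lambda>b :: 'd code. evals (config b)) -` V \<inter> bounded_codes (c k)" for k
      using spec[OF W_all, of k] by (rule conjunct1, rule conjunct2)
    have "{\<omega> \<in> space P0. evals (config (\<zeta>' \<omega>)) \<in> V} =
      (\<Union>k. {\<omega> \<in> space P0. \<zeta>' \<omega> \<in> W k \<inter> bounded_codes (c k)})"
      unfolding W(2) using \<zeta>'_good by auto
    also have "\<dots> \<in> sets P0"
    proof (rule sets.countable_UN)
      have "W k \<inter> bounded_codes (c k) \<in> sets borel" for k
        using W(1)[of k] borel_bounded_codes[of "c k"] by auto
      from measurable_sets[OF \<zeta>'_borel this]
      show "range (\<lambda>k. {\<omega> \<in> space P0. \<zeta>' \<omega> \<in> W k \<inter> bounded_codes (c k)}) \<subseteq> sets P0"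
        by (auto simp: vimage_def Int_def conj_commute)
    qed
    finally show "{\<omega> \<in> space P0. evals (config (\<zeta>' \<omega>)) \<in> V} \<in> sets P0" .
  qed
  let ?Z = "\<lambda>\<omega>. config (\<zeta>' \<omega>)"
  have small: "\<exists>k::nat. 1 / (real k + 1) \<le> e" if "0 < e" for e :: real
    using reals_Archimedean[OF that] by (metis add.commute inverse_eq_divide less_imp_le of_nat_Suc)
  have laplace_evals: "laplace_functional P' N' g = (\<integral>\<omega>. exp (- evals (N' \<omega>) g) \<partial>P')"
    if "g \<in> CK_plus" for P' :: "'w measure" and N' and g :: "ereal ^ 'd \<Rightarrow> real"
    using that by (simp add: laplace_functional_def evals_def)
  have lap0: "(\<integral>\<omega>. exp (- evals (?Z \<omega>) g) \<partial>P0) = L g" if g: "g \<in> CK_plus" for g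
  proof -
    have "\<bar>(\<integral>\<omega>. exp (- evals (?Z \<omega>) g) \<partial>P0) - L g\<bar> \<le> e" if "0 < e" for e
    proof -
      \<comment> \<open>Replacing the functional by a continuous F costs 2 / (k + 1), at most e / 2,
        once for the limit and once for the sample.\<close>
      obtain k :: nat where k: "1 / (real k + 1) \<le> e / 4" using small[of "e/4"] \<open>0 < e\<close> by auto
      obtain S where S: "finite S" "\<And>b :: 'd code. b \<in> bounded_codes (c k) \<Longrightarrow>
          evals (config b) g = (\<Sum>(q, i)\<in>S. of_bool (b (q, i, None)) * g (code_point b (q, i)))"
        using evals_config_finite_sum[OF g] by blast
      define F where "F b = exp (- (\<Sum>(q, i)\<in>S. of_bool (b (q, i, None)) * g (code_point b (q, i))))"
        for b :: "'d code"
      have F: "continuous_on UNIV F" unfolding F_def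
        by (intro continuous_intros continuous_finite_code_sum[OF g])
      have [measurable]: "F \<in> borel_measurable borel" using F by (rule borelM)
      have Fb: "\<bar>F b\<bar> \<le> 1" for b
        unfolding F_def by (auto intro!: sum_nonneg mult_nonneg_nonneg CK_plus_nonneg[OF g])
      have [measurable]: "(\<lambda>\<omega>. evals (?Z \<omega>) g) \<in> borel_measurable P0"
        using measurable_compose[OF N0 evals_measurable[OF g]] .
      have Nm[measurable]: "(\<lambda>\<omega>. evals (?N n \<omega>) g) \<in> borel_measurable M" for n
        using measurable_compose[OF N evals_measurable[OF g]] .
      have A: "\<bar>(\<integral>\<omega>. exp (- evals (?Z \<omega>) g) \<partial>P0) - (\<integral>\<omega>. F (\<zeta> \<omega>) \<partial>P0)\<bar> \<le> 0 + 2 * 1 * (1 / (real k + 1))"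
      proof (rule expectation_close[OF P0, where E="{\<omega> \<in> space P0. \<zeta> \<omega> \<in> bounded_codes (c k)}"])
        have "space P0 - {\<omega> \<in> space P0. \<zeta> \<omega> \<in> bounded_codes (c k)} = {\<omega> \<in> space P0. \<zeta> \<omega> \<notin> bounded_codes (c k)}" by auto
        then show "measure P0 (space P0 - {\<omega> \<in> space P0. \<zeta> \<omega> \<in> bounded_codes (c k)}) \<le> 1 / (real k + 1)"
          using \<zeta>_tight[of k] by simp
        show "\<bar>exp (- evals (?Z \<omega>) g) - F (\<zeta> \<omega>)\<bar> \<le> 0"
          if "\<omega> \<in> {\<omega> \<in> space P0. \<zeta> \<omega> \<in> bounded_codes (c k)}" for \<omega>
          using that \<zeta>'_eq[of \<omega> k] S(2) by (simp add: F_def)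
      qed (use Fb evals_nonneg in auto)
      have B: "\<bar>laplace_functional M (?N n) g - (\<integral>\<omega>. F (\<xi> n \<omega>) \<partial>M)\<bar> \<le> 0 + 2 * 1 * (1 / (real k + 1))" for n
        unfolding laplace_evals[OF g]
      proof (rule expectation_close[OF M, where E="{\<omega> \<in> space M. \<xi> n \<omega> \<in> bounded_codes (c k)}"])
        have "space M - {\<omega> \<in> space M. \<xi> n \<omega> \<in> bounded_codes (c k)} = {\<omega> \<in> space M. \<xi> n \<omega> \<notin> bounded_codes (c k)}" by auto
        then show "measure M (space M - {\<omega> \<in> space M. \<xi> n \<omega> \<in> bounded_codes (c k)}) \<le> 1 / (real k + 1)"
          using c[of n k] c by simp
        show "\<bar>exp (- evals (?N n \<omega>) g) - F (\<xi> n \<omega>)\<bar> \<le> 0"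
          if "\<omega> \<in> {\<omega> \<in> space M. \<xi> n \<omega> \<in> bounded_codes (c k)}" for \<omega>
          using that S(2) by (simp add: F_def N_code)
      qed (use Fb evals_nonneg in auto)
      have "(\<lambda>n. laplace_functional M (?N (r n)) g - (\<integral>\<omega>. F (\<xi> (r n) \<omega>) \<partial>M)) \<longlonglongrightarrow> L g - (\<integral>\<omega>. F (\<zeta> \<omega>) \<partial>P0)"
        using LIMSEQ_subseq_LIMSEQ[OF L[OF g] r] lim[OF F] by (intro tendsto_diff) (simp_all add: o_def)
      then have "(\<lambda>n. \<bar>laplace_functional M (?N (r n)) g - (\<integral>\<omega>. F (\<xi> (r n) \<omega>) \<partial>M)\<bar>) \<longlonglongrightarrow> \<bar>L g - (\<integral>\<omega>. F (\<zeta> \<omega>) \<partial>P0)\<bar>"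
        by (rule tendsto_rabs)
      then have "\<bar>L g - (\<integral>\<omega>. F (\<zeta> \<omega>) \<partial>P0)\<bar> \<le> 0 + 2 * 1 * (1 / (real k + 1))"
        by (rule LIMSEQ_le_const2) (use B in blast)
      with A k show ?thesis by linarith
    qed
    then have "\<bar>(\<integral>\<omega>. exp (- evals (?Z \<omega>) g) \<partial>P0) - L g\<bar> \<le> 0" by (rule field_le_epsilon) simp
    then show ?thesis by simp
  qed
  \<comment> \<open>The law is moved to the space of measures, so that P has the type demanded and
    the identity serves as N.\<close>
  define P where "P = distr P0 ?BV ?Z"
  have P: "prob_space P" unfolding P_def by (rule P0.prob_space_distr[OF N0])
  interpret P: prob_space P by fact
  have id[measurable]: "(\<lambda>\<mu>. \<mu>) \<in> measurable P ?BV" by (simp add: P_def)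
  have lapP: "laplace_functional P (\<lambda>\<mu>. \<mu>) g = L g" if g: "g \<in> CK_plus" for g
  proof -
    have "laplace_functional P (\<lambda>\<mu>. \<mu>) g = (\<integral>\<mu>. exp (- evals \<mu> g) \<partial>P)"
      using g by (simp add: laplace_functional_def evals_def)
    also have "\<dots> = (\<integral>\<omega>. exp (- evals (?Z \<omega>) g) \<partial>P0)"
      unfolding P_def using evals_measurable[OF g] by (intro integral_distr N0) measurable
    finally show ?thesis using lap0[OF g] by simp
  qed
  have pmN: "?N n \<omega> \<in> point_measures" if "\<omega> \<in> space M" for n \<omega>
    using measurable_space[OF N that] by (simp add: space_borel_of_vague)
  have conv: "(\<lambda>n. \<integral>\<omega>. f (?N n \<omega>) \<partial>M) \<longlonglongrightarrow> (\<integral>\<omega>. f (?Z \<omega>) \<partial>P0)"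
    if f: "continuous_map vague_topology euclideanreal f" and bdd: "bounded (f ` point_measures)" for f
  proof -
    obtain B where B: "\<And>\<mu>. \<mu> \<in> point_measures \<Longrightarrow> \<bar>f \<mu>\<bar> \<le> B"
      using bdd by (auto simp: bounded_iff)
    have f_meas: "f \<in> borel_measurable ?BV" using f by (rule continuous_vague_borel)
    have "0 \<le> B"
    proof -
      obtain \<omega> where "\<omega> \<in> space M" using M.not_empty by auto
      from B[OF pmN[OF this, of 0]] show ?thesis by linarith
    qed
    have key: "\<forall>\<^sub>F n in sequentially. \<bar>(\<integral>\<omega>. f (?N n \<omega>) \<partial>M) - (\<integral>\<omega>. f (?Z \<omega>) \<partial>P0)\<bar> < e" if "0 < e" for e
    proof -
      \<comment> \<open>Each of two replacements costs at most e' + 2 (B + e') e', and the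
        comparison of the F-integrals costs e'. As e' is at most 1, the total is at most (4 B + 7)
        e', which is below e.\<close>
      define e' where "e' = min 1 (e / (4 * (B + 3)))"
      have B3: "0 < 4 * (B + 3)" using \<open>0 \<le> B\<close> by simp
      have "e' \<le> e / (4 * (B + 3))" by (simp only: e'_def min.cobounded2)
      then have e': "0 < e'" "e' \<le> 1" "e' * (4 * (B + 3)) \<le> e"
        using \<open>0 < e\<close> B3 by (simp_all only: pos_le_divide_eq) (simp_all add: e'_def)
      obtain k :: nat where k: "1 / (real k + 1) \<le> e'" using small[OF e'(1)] by auto
      have K: "compact ((\<lambda>b :: 'd code. evals (config b)) ` bounded_codes (c k))"
        by (rule compact_continuous_image[OF continuous_evals_config compact_bounded_codes])
      have Ksub: "(\<lambda>b :: 'd code. evals (config b)) ` bounded_codes (c k) \<subseteq> evals ` point_measures"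
        using config_point_measure by auto
      obtain F where F: "exp_algebra F" "\<And>\<mu>. \<mu> \<in> point_measures \<Longrightarrow> \<bar>F (evals \<mu>)\<bar> \<le> B + e'"
        "\<And>\<mu>. \<mu> \<in> point_measures \<Longrightarrow> evals \<mu> \<in> (\<lambda>b :: 'd code. evals (config b)) ` bounded_codes (c k) \<Longrightarrow>
          \<bar>f \<mu> - F (evals \<mu>)\<bar> \<le> e'"
        by (rule vague_continuous_approx[OF f B K Ksub e'(1)]) (assumption, rule that, assumption+)
      obtain h d and l :: nat where h: "\<And>i. h i \<in> CK_plus"
        "\<And>\<mu>. \<mu> \<in> point_measures \<Longrightarrow> F (evals \<mu>) = (\<Sum>i<l. d i * exp (- evals \<mu> (h i)))"
        by (rule exp_algebra_sum[OF F(1)]) auto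
      have FN: "(\<integral>\<omega>. F (evals (?N n \<omega>)) \<partial>M) = (\<Sum>i<l. d i * laplace_functional M (?N n) (h i))"
        and [measurable]: "(\<lambda>\<omega>. F (evals (?N n \<omega>))) \<in> borel_measurable M" for n
        using exp_algebra_expectation[OF M N h] by auto
      have FN0: "(\<integral>\<omega>. F (evals (?Z \<omega>)) \<partial>P0) = (\<Sum>i<l. d i * laplace_functional P0 ?Z (h i))"
        and [measurable]: "(\<lambda>\<omega>. F (evals (?Z \<omega>))) \<in> borel_measurable P0"
        using exp_algebra_expectation[OF P0 N0 h] by auto
      have "laplace_functional P0 ?Z (h i) = L (h i)" for i
        using lap0[OF h(1)[of i]] h(1)[of i] by (simp add: laplace_functional_def evals_def)
      \<comment> \<open>This convergence is along all n; the subsequence r served only to construct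
        the limit.\<close>
      then have limF: "(\<lambda>n. \<integral>\<omega>. F (evals (?N n \<omega>)) \<partial>M) \<longlonglongrightarrow> (\<integral>\<omega>. F (evals (?Z \<omega>)) \<partial>P0)"
        unfolding FN FN0 by (auto intro!: tendsto_sum tendsto_mult_left L h(1))
      have [measurable]: "(\<lambda>\<omega>. f (?N n \<omega>)) \<in> borel_measurable M" for n
        by (rule measurable_compose[OF N f_meas])
      have [measurable]: "(\<lambda>\<omega>. f (?Z \<omega>)) \<in> borel_measurable P0"
        by (rule measurable_compose[OF N0 f_meas])
      have A: "\<bar>(\<integral>\<omega>. f (?N n \<omega>) \<partial>M) - (\<integral>\<omega>. F (evals (?N n \<omega>)) \<partial>M)\<bar> \<le> e' + 2 * (B + e') * e'" for n
      proof (rule expectation_close[OF M, where E="{\<omega> \<in> space M. \<xi> n \<omega> \<in> bounded_codes (c k)}"])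
        have "space M - {\<omega> \<in> space M. \<xi> n \<omega> \<in> bounded_codes (c k)} = {\<omega> \<in> space M. \<xi> n \<omega> \<notin> bounded_codes (c k)}" by auto
        then show "measure M (space M - {\<omega> \<in> space M. \<xi> n \<omega> \<in> bounded_codes (c k)}) \<le> e'"
          using order_trans[OF c k] by simp
        show "\<bar>f (?N n \<omega>) - F (evals (?N n \<omega>))\<bar> \<le> e'"
          if "\<omega> \<in> {\<omega> \<in> space M. \<xi> n \<omega> \<in> bounded_codes (c k)}" for \<omega>
          using that by (intro F(3) pmN) (auto simp: N_code)
        show "\<bar>f (?N n \<omega>)\<bar> \<le> B + e'" if "\<omega> \<in> space M" for \<omega>
          using B[OF pmN[OF that, of n]] e'(1) by linarith
        show "\<bar>F (evals (?N n \<omega>))\<bar> \<le> B + e'" if "\<omega> \<in> space M" for \<omega>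
          by (rule F(2)[OF pmN[OF that]])
      qed (use e' \<open>0 \<le> B\<close> in auto)
      have pm0: "?Z \<omega> \<in> point_measures" for \<omega> using \<zeta>'_good config_point_measure by blast
      have A0: "\<bar>(\<integral>\<omega>. f (?Z \<omega>) \<partial>P0) - (\<integral>\<omega>. F (evals (?Z \<omega>)) \<partial>P0)\<bar> \<le> e' + 2 * (B + e') * e'"
      proof (rule expectation_close[OF P0, where E="{\<omega> \<in> space P0. \<zeta> \<omega> \<in> bounded_codes (c k)}"])
        have "space P0 - {\<omega> \<in> space P0. \<zeta> \<omega> \<in> bounded_codes (c k)} = {\<omega> \<in> space P0. \<zeta> \<omega> \<notin> bounded_codes (c k)}" by auto
        then show "measure P0 (space P0 - {\<omega> \<in> space P0. \<zeta> \<omega> \<in> bounded_codes (c k)}) \<le> e'"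
          using order_trans[OF \<zeta>_tight k] by simp
        show "\<bar>f (?Z \<omega>) - F (evals (?Z \<omega>))\<bar> \<le> e'"
          if "\<omega> \<in> {\<omega> \<in> space P0. \<zeta> \<omega> \<in> bounded_codes (c k)}" for \<omega>
          using that \<zeta>'_eq[of \<omega> k] by (intro F(3) pm0) auto
        show "\<bar>f (?Z \<omega>)\<bar> \<le> B + e'" for \<omega>
          using B[OF pm0, of \<omega>] e'(1) by linarith
        show "\<bar>F (evals (?Z \<omega>))\<bar> \<le> B + e'" for \<omega>
          by (rule F(2)[OF pm0])
      qed (use e' \<open>0 \<le> B\<close> in auto)
      have "2 * (B + e') * e' \<le> 2 * (B + 1) * e'" using e' by (intro mult_right_mono) auto
      then have small': "2 * (e' + 2 * (B + e') * e') \<le> e - 6 * e'"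
        using e'(3) by (simp add: algebra_simps)
      from limF have "\<forall>\<^sub>F n in sequentially. \<bar>(\<integral>\<omega>. F (evals (?N n \<omega>)) \<partial>M) - (\<integral>\<omega>. F (evals (?Z \<omega>)) \<partial>P0)\<bar> < e'"
        using e'(1) unfolding tendsto_iff dist_real_def by blast
      then show ?thesis
      proof eventually_elim
        case (elim n)
        have tri: "\<bar>u - w\<bar> < e" if "\<bar>p - q\<bar> < e'" "\<bar>u - p\<bar> \<le> s" "\<bar>w - q\<bar> \<le> s" "2 * s \<le> e - 6 * e'" "0 < e'"
          for u w p q s :: real using that by linarith
        show ?case by (rule tri[OF elim A A0 small' e'(1)])
      qed
    qed
    then show ?thesis unfolding tendsto_iff dist_real_def by blast
  qed
  show ?thesis
  proof (intro exI conjI ballI)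
    show "prob_space P" by (rule P)
    show "point_process P (\<lambda>\<mu>. \<mu>)" unfolding point_process_def by (rule id)
    show "laplace_functional P (\<lambda>\<mu>. \<mu>) g = L g" if "g \<in> CK_plus" for g using that by (rule lapP)
    show "converges_in_distribution vague_topology M ?N P (\<lambda>\<mu>. \<mu>)"
      unfolding converges_in_distribution_def weakly_converges_def
    proof (intro conjI allI impI N id)
      fix f :: "(ereal ^ 'd) measure \<Rightarrow> real"
      assume f: "continuous_map vague_topology euclideanreal f" "bounded (f ` topspace vague_topology)"
      have f_meas: "f \<in> borel_measurable ?BV" using f(1) by (rule continuous_vague_borel)
      have "(\<integral>\<mu>. f \<mu> \<partial>distr P ?BV (\<lambda>\<mu>. \<mu>)) = (\<integral>\<omega>. f (?Z \<omega>) \<partial>P0)"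
        unfolding integral_distr[OF id f_meas] unfolding P_def by (rule integral_distr[OF N0 f_meas])
      then show "(\<lambda>n. \<integral>\<mu>. f \<mu> \<partial>distr M ?BV (?N n)) \<longlonglongrightarrow> (\<integral>\<mu>. f \<mu> \<partial>distr P ?BV (\<lambda>\<mu>. \<mu>))"
        using conv[OF f(1)] f(2) by (simp add: integral_distr[OF N f_meas] topspace_vague)
    qed
  qed
qed

section \<open>The tail process\<close>

lemma integral_uniform_measure:
  fixes f :: "'a \<Rightarrow> real"
  assumes "prob_space M" and A[measurable]: "A \<in> sets M" and [measurable]: "f \<in> borel_measurable M"
  shows "(\<integral>\<omega>. f \<omega> \<partial>uniform_measure M A) = (\<integral>\<omega>. indicator A \<omega> * f \<omega> \<partial>M) / measure M A"
\<comment> \<open>For a null event the uniform measure is the zero measure, in accordance with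
  division by zero yielding 0.\<close>
proof (cases "measure M A = 0")
  case True
  interpret prob_space M by fact
  have "emeasure M A = 0" using True by (simp add: emeasure_eq_measure)
  then have "emeasure (uniform_measure M A) (space (uniform_measure M A)) = 0"
    using sets.sets_into_space[OF A] by (simp add: emeasure_uniform_measure Int_absorb2)
  then have "AE \<omega> in uniform_measure M A. f \<omega> = 0"
    by (intro AE_I[of _ _ "space (uniform_measure M A)"]) auto
  then have "(\<integral>\<omega>. f \<omega> \<partial>uniform_measure M A) = 0" by (rule integral_eq_zero_AE)
  then show ?thesis using True by simp
next
  case False
  interpret prob_space M by fact
  have "0 < measure M A" using False by (simp add: zero_less_measure_iff)
  then have "uniform_measure M A = density M (\<lambda>\<omega>. ennreal (indicator A \<omega> / measure M A))"
    unfolding uniform_measure_def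
    by (intro density_cong AE_I2) (auto simp: emeasure_eq_measure divide_ennreal ennreal_indicator[symmetric])
  then have "(\<integral>\<omega>. f \<omega> \<partial>uniform_measure M A) = (\<integral>\<omega>. (indicator A \<omega> / measure M A) *\<^sub>R f \<omega> \<partial>M)"
    by (simp only:) (rule integral_density, auto)
  also have "\<dots> = (\<integral>\<omega>. (indicator A \<omega> * f \<omega>) / measure M A \<partial>M)" by simp
  finally show ?thesis by simp
qed

text \<open>The grid \<open>{0, 1/p, \<dots>, p}\<close>; summation by parts writes a function at a grid point as a
  combination of the indicators \<open>i / p < s\<close>, so that only the tail of \<open>R\<close> is needed below.\<close>

definition grid_index :: "nat \<Rightarrow> real \<Rightarrow> nat" where
  "grid_index p s = min (nat \<lceil>real p * s\<rceil>) (p * p)"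

lemma grid_index_telescope:
  fixes a :: "nat \<Rightarrow> real"
  assumes "0 < p"
  shows "a (grid_index p s) = a 0 + (\<Sum>i<p * p. (a (Suc i) - a i) * of_bool (real i / real p < s))"
proof -
  have iff: "real i / real p < s \<longleftrightarrow> i < nat \<lceil>real p * s\<rceil>" for i
  proof -
    have "real i / real p < s \<longleftrightarrow> real i < real p * s" using assms by (simp add: field_simps)
    also have "\<dots> \<longleftrightarrow> int i < \<lceil>real p * s\<rceil>" by (simp add: less_ceiling_iff)
    also have "\<dots> \<longleftrightarrow> i < nat \<lceil>real p * s\<rceil>" by linarith
    finally show ?thesis .
  qed
  have "(\<Sum>i<p * p. (a (Suc i) - a i) * of_bool (real i / real p < s)) = (\<Sum>i<grid_index p s. a (Suc i) - a i)"
    unfolding iff grid_index_def by (rule sum.mono_neutral_cong_right) auto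
  also have "\<dots> = a (grid_index p s) - a 0" by (rule sum_lessThan_telescope)
  finally show ?thesis by simp
qed

text \<open>Rounding up costs at most one grid step. Once p is at least s + 1, the cap
  \<open>p * p\<close> is out of reach, since p s + 1 is at most p (s + 1).\<close>

lemma grid_index_tendsto:
  assumes "0 \<le> s"
  shows "(\<lambda>p. real (grid_index (Suc p) s) / real (Suc p)) \<longlonglongrightarrow> s"
proof -
  have "(\<lambda>p. real (grid_index (Suc p) s) / real (Suc p) - s) \<longlonglongrightarrow> 0"
  proof (rule Lim_null_comparison)
    show "\<forall>\<^sub>F p in sequentially. norm (real (grid_index (Suc p) s) / real (Suc p) - s) \<le> inverse (real (Suc p))"
      using eventually_ge_at_top[of "nat \<lceil>s + 1\<rceil>"]
    proof eventually_elim
      case (elim p)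
      define N where "N = real (Suc p)"
      have N: "s + 1 \<le> N" "0 < N" using elim unfolding N_def by linarith+
      have "N * s + 1 \<le> N * (s + 1)" using N assms by (simp add: algebra_simps)
      also have "\<dots> \<le> N * N" using N by (intro mult_left_mono) auto
      finally have "real_of_int \<lceil>N * s\<rceil> \<le> N * N" by linarith
      moreover have c0: "0 \<le> \<lceil>N * s\<rceil>"
      proof -
        have "0 \<le> N * s" using N assms by simp
        then show ?thesis by linarith
      qed
      then have "real (nat \<lceil>N * s\<rceil>) = real_of_int \<lceil>N * s\<rceil>" by simp
      moreover have "real (Suc p * Suc p) = N * N" by (simp only: N_def of_nat_mult)
      ultimately have "real (nat \<lceil>N * s\<rceil>) \<le> real (Suc p * Suc p)" by linarith
      then have "nat \<lceil>N * s\<rceil> \<le> Suc p * Suc p" by (simp only: of_nat_le_iff)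
      then have "real (grid_index (Suc p) s) = real_of_int \<lceil>N * s\<rceil>"
        using c0 unfolding grid_index_def N_def[symmetric] by (simp add: min_absorb1)
      moreover have "\<bar>real_of_int \<lceil>N * s\<rceil> - N * s\<bar> \<le> 1" by linarith
      then have "\<bar>real_of_int \<lceil>N * s\<rceil> - N * s\<bar> / N \<le> 1 / N" using N by (intro divide_right_mono) auto
      moreover have "\<bar>real_of_int \<lceil>N * s\<rceil> - N * s\<bar> / N = \<bar>real_of_int \<lceil>N * s\<rceil> / N - s\<bar>"
      proof -
        have "real_of_int \<lceil>N * s\<rceil> / N - s = (real_of_int \<lceil>N * s\<rceil> - N * s) / N" using N by (simp add: field_simps)
        then show ?thesis using N by (simp add: abs_divide)
      qed
      ultimately show ?case by (simp add: N_def inverse_eq_divide)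
    qed
    show "(\<lambda>p. inverse (real (Suc p))) \<longlonglongrightarrow> 0" by (rule LIMSEQ_inverse_real_of_nat)
  qed
  then show ?thesis by (rule LIM_zero_cancel)
qed

text \<open>A Fubini statement for an argument R independent of F, where independence is available
  only against the events u < R. With R rounded to a grid, F at R is a combination of such
  indicators, and \<open>indep\<close> applies term by term; continuity in s and dominated
  convergence remove the grid. Measurability of F at R comes from the same approximation.\<close>

lemma integral_independent_argument:
  fixes F :: "real \<Rightarrow> 'v \<Rightarrow> real"
  assumes "prob_space Q" and R[measurable]: "R \<in> borel_measurable Q" and R0: "\<And>\<omega>. 0 \<le> R \<omega>"
    and F[measurable]: "\<And>s. F s \<in> borel_measurable Q" and B: "\<And>s \<omega>. \<bar>F s \<omega>\<bar> \<le> B"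
    and cont: "\<And>\<omega>. continuous_on UNIV (\<lambda>s. F s \<omega>)"
    and indep: "\<And>s u. 0 \<le> u \<Longrightarrow> (\<integral>\<omega>. indicator {\<omega> \<in> space Q. u < R \<omega>} \<omega> * F s \<omega> \<partial>Q) =
       measure Q {\<omega> \<in> space Q. u < R \<omega>} * (\<integral>\<omega>. F s \<omega> \<partial>Q)"
  shows "continuous_on UNIV (\<lambda>s. \<integral>\<omega>. F s \<omega> \<partial>Q)"
    and "(\<integral>\<omega>. F (R \<omega>) \<omega> \<partial>Q) = (\<integral>\<omega>. (\<integral>\<omega>'. F (R \<omega>) \<omega>' \<partial>Q) \<partial>Q)"
proof -
  interpret prob_space Q by fact
  define \<phi> where "\<phi> s = (\<integral>\<omega>. F s \<omega> \<partial>Q)" for s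
  have intF: "integrable Q (F s)" for s by (rule integrable_const_bound[where B=B]) (auto simp: B)
  have \<phi>B: "\<bar>\<phi> s\<bar> \<le> B" for s
  proof -
    have "\<bar>\<phi> s\<bar> \<le> (\<integral>\<omega>. \<bar>F s \<omega>\<bar> \<partial>Q)" unfolding \<phi>_def by (rule integral_abs_bound)
    also have "\<dots> \<le> (\<integral>\<omega>. B \<partial>Q)" using B intF by (intro integral_mono) auto
    finally show ?thesis by (simp add: prob_space)
  qed
  have tend: "(\<lambda>n. \<phi> (S n)) \<longlonglongrightarrow> \<phi> s" if "S \<longlonglongrightarrow> s" for S s
    unfolding \<phi>_def
  proof (rule integral_dominated_convergence[where w="\<lambda>_. B"])
    show "AE \<omega> in Q. (\<lambda>n. F (S n) \<omega>) \<longlonglongrightarrow> F s \<omega>"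
      using continuous_on_tendsto_compose[OF cont that] by auto
  qed (auto simp: B)
  show phi_cont: "continuous_on UNIV (\<lambda>s. \<integral>\<omega>. F s \<omega> \<partial>Q)"
    unfolding \<phi>_def[symmetric] continuous_on_sequentially by (auto simp: o_def tend)
  have [measurable]: "\<phi> \<in> borel_measurable borel"
    using phi_cont unfolding \<phi>_def[symmetric] by (rule borel_measurable_continuous_onI)
  let ?d = "\<lambda>p s. real (grid_index (Suc p) s) / real (Suc p)"
  let ?J = "\<lambda>p. {..<Suc p * Suc p}"
  let ?x = "\<lambda>p i. real i / real (Suc p)"
  let ?A = "\<lambda>p i. {\<omega> \<in> space Q. ?x p i < R \<omega>}"
  \<comment> \<open>Used for h = F at a fixed \<omega> and for h = \<open>\<phi>\<close>, so that
    both sides expand over the same events.\<close>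
  have expand: "h (?d p (R \<omega>)) = h 0 + (\<Sum>i\<in>?J p. (h (?x p (Suc i)) - h (?x p i)) * indicator (?A p i) \<omega>)"
    if "\<omega> \<in> space Q" for h :: "real \<Rightarrow> real" and p \<omega>
    using grid_index_telescope[of "Suc p" "\<lambda>i. h (?x p i)" "R \<omega>"] that
    by (simp add: indicator_def of_bool_def)
  have Fd: "(\<lambda>\<omega>. F (?d p (R \<omega>)) \<omega>) \<in> borel_measurable Q" for p
  proof (subst measurable_cong)
    show "F (?d p (R \<omega>)) \<omega> = F 0 \<omega> + (\<Sum>i\<in>?J p. (F (?x p (Suc i)) \<omega> - F (?x p i) \<omega>) * indicator (?A p i) \<omega>)"
      if "\<omega> \<in> space Q" for \<omega> using expand[OF that, of "\<lambda>s. F s \<omega>"] .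
  qed measurable
  have eq: "(\<integral>\<omega>. F (?d p (R \<omega>)) \<omega> \<partial>Q) = (\<integral>\<omega>. \<phi> (?d p (R \<omega>)) \<partial>Q)" for p
  proof -
    have int1: "integrable Q (\<lambda>\<omega>. (F s \<omega> - F s' \<omega>) * indicator (?A p i) \<omega>)" for i s s'
      using intF by (intro integrable_real_mult_indicator Bochner_Integration.integrable_diff) auto
    have int2: "integrable Q (\<lambda>\<omega>. (\<phi> s - \<phi> s') * indicator (?A p i) \<omega>)" for i s s'
      by (intro integrable_real_mult_indicator) auto
    have lin: "(\<integral>\<omega>. f \<omega> + (\<Sum>i\<in>J. g i \<omega>) \<partial>Q) = (\<integral>\<omega>. f \<omega> \<partial>Q) + (\<Sum>i\<in>J. \<integral>\<omega>. g i \<omega> \<partial>Q)"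
      if "integrable Q f" "\<And>i. integrable Q (g i)" for f :: "'v \<Rightarrow> real" and g and J :: "nat set"
      using that by (simp add: Bochner_Integration.integral_sum)
    have one: "(\<integral>\<omega>. (F s \<omega> - F s' \<omega>) * indicator (?A p i) \<omega> \<partial>Q) = (\<integral>\<omega>. (\<phi> s - \<phi> s') * indicator (?A p i) \<omega> \<partial>Q)"
      for i s s'
    proof -
      have int3: "integrable Q (\<lambda>\<omega>. indicator (?A p i) \<omega> * F s \<omega>)" for s
        using integrable_real_mult_indicator[of "?A p i" Q "F s"] intF by (simp add: mult.commute)
      have "(\<integral>\<omega>. (F s \<omega> - F s' \<omega>) * indicator (?A p i) \<omega> \<partial>Q) =
          (\<integral>\<omega>. indicator (?A p i) \<omega> * F s \<omega> - indicator (?A p i) \<omega> * F s' \<omega> \<partial>Q)"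
        by (simp add: algebra_simps)
      also have "\<dots> = measure Q (?A p i) * \<phi> s - measure Q (?A p i) * \<phi> s'"
        by (subst Bochner_Integration.integral_diff[OF int3 int3]) (simp add: indep \<phi>_def)
      also have "\<dots> = (\<phi> s - \<phi> s') * measure Q (?A p i)" by (simp add: algebra_simps)
      also have "\<dots> = (\<integral>\<omega>. (\<phi> s - \<phi> s') * indicator (?A p i) \<omega> \<partial>Q)" by simp
      finally show ?thesis .
    qed
    have "(\<integral>\<omega>. F (?d p (R \<omega>)) \<omega> \<partial>Q) =
        (\<integral>\<omega>. F 0 \<omega> + (\<Sum>i\<in>?J p. (F (?x p (Suc i)) \<omega> - F (?x p i) \<omega>) * indicator (?A p i) \<omega>) \<partial>Q)"
      by (rule Bochner_Integration.integral_cong[OF refl]) (rule expand[of _ "\<lambda>s. F s _"])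
    also have "\<dots> = \<phi> 0 + (\<Sum>i\<in>?J p. (\<integral>\<omega>. (F (?x p (Suc i)) \<omega> - F (?x p i) \<omega>) * indicator (?A p i) \<omega> \<partial>Q))"
      unfolding \<phi>_def by (rule lin[OF intF int1])
    also have "\<dots> = \<phi> 0 + (\<Sum>i\<in>?J p. (\<integral>\<omega>. (\<phi> (?x p (Suc i)) - \<phi> (?x p i)) * indicator (?A p i) \<omega> \<partial>Q))"
      by (simp only: one)
    also have "\<dots> = (\<integral>\<omega>. \<phi> 0 + (\<Sum>i\<in>?J p. (\<phi> (?x p (Suc i)) - \<phi> (?x p i)) * indicator (?A p i) \<omega>) \<partial>Q)"
      by (subst lin[OF integrable_const int2]) (simp add: prob_space)
    also have "\<dots> = (\<integral>\<omega>. \<phi> (?d p (R \<omega>)) \<partial>Q)"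
      by (rule Bochner_Integration.integral_cong[OF refl]) (rule expand[symmetric])
    finally show ?thesis .
  qed
  have FR: "(\<lambda>p. F (?d p (R \<omega>)) \<omega>) \<longlonglongrightarrow> F (R \<omega>) \<omega>" for \<omega>
    using continuous_on_tendsto_compose[OF cont grid_index_tendsto[OF R0]] by auto
  have [measurable]: "(\<lambda>\<omega>. F (R \<omega>) \<omega>) \<in> borel_measurable Q"
    by (rule borel_measurable_LIMSEQ_real[OF FR Fd])
  have "(\<lambda>p. \<integral>\<omega>. F (?d p (R \<omega>)) \<omega> \<partial>Q) \<longlonglongrightarrow> (\<integral>\<omega>. F (R \<omega>) \<omega> \<partial>Q)"
    by (rule integral_dominated_convergence[where w="\<lambda>_. B"]) (use FR Fd B in auto)
  moreover have "(\<lambda>p. \<integral>\<omega>. \<phi> (?d p (R \<omega>)) \<partial>Q) \<longlonglongrightarrow> (\<integral>\<omega>. \<phi> (R \<omega>) \<partial>Q)"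
  proof (rule integral_dominated_convergence[where w="\<lambda>_. B"])
    show "AE \<omega> in Q. (\<lambda>p. \<phi> (?d p (R \<omega>))) \<longlonglongrightarrow> \<phi> (R \<omega>)"
      using tend[OF grid_index_tendsto[OF R0]] by auto
    show "(\<lambda>\<omega>. \<phi> (?d p (R \<omega>))) \<in> borel_measurable Q" for p
    proof (subst measurable_cong)
      show "\<phi> (?d p (R \<omega>)) = \<phi> 0 + (\<Sum>i\<in>?J p. (\<phi> (?x p (Suc i)) - \<phi> (?x p i)) * indicator (?A p i) \<omega>)"
        if "\<omega> \<in> space Q" for \<omega> using expand[OF that] .
    qed measurable
  qed (auto simp: \<phi>B)
  ultimately show "(\<integral>\<omega>. F (R \<omega>) \<omega> \<partial>Q) = (\<integral>\<omega>. (\<integral>\<omega>'. F (R \<omega>) \<omega>' \<partial>Q) \<partial>Q)"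
    unfolding eq \<phi>_def by (rule LIMSEQ_unique)
qed

text \<open>The distribution functions agree: the density is the derivative of
  \<open>- (y powr (-\<alpha>))\<close>, and the tail value 1 at y = 1 leaves no mass at or below
  1.\<close>

lemma pareto_distribution:
  assumes "prob_space Q" and R[measurable]: "R \<in> borel_measurable Q" and \<alpha>: "0 < \<alpha>"
    and tail: "\<And>y. 1 \<le> y \<Longrightarrow> measure Q {\<omega> \<in> space Q. R \<omega> > y} = y powr (-\<alpha>)"
  shows "distr Q borel R = density lborel (\<lambda>y. ennreal (indicator {1..} y * (\<alpha> * y powr (-\<alpha> - 1))))"
    (is "_ = density lborel (\<lambda>y. ennreal (?p y))")
proof (rule cdf_unique)
  interpret prob_space Q by fact
  let ?D = "density lborel (\<lambda>y. ennreal (?p y))"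
  have deriv: "((\<lambda>y. - (y powr (-\<alpha>))) has_real_derivative \<alpha> * y powr (-\<alpha> - 1)) (at y)" if "1 \<le> y" for y
    using that by (auto intro!: derivative_eq_intros)
  have pd: "ennreal (?p y) * indicator A y = ennreal (\<alpha> * y powr (-\<alpha> - 1)) * indicator ({1..} \<inter> A) y" for y A
    by (auto simp: indicator_def)
  have em: "emeasure ?D A = (\<integral>\<^sup>+y. ennreal (\<alpha> * y powr (-\<alpha> - 1)) * indicator ({1..} \<inter> A) y \<partial>lborel)"
    if "A \<in> sets borel" for A
    using that by (subst emeasure_density) (auto simp: pd)
  have total: "emeasure ?D (space ?D) = 1"
  proof -
    have "((\<lambda>y::real. - (y powr (-\<alpha>))) \<longlongrightarrow> - 0) at_top"
      using \<alpha> by (intro tendsto_minus tendsto_neg_powr filterlim_ident) auto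
    then have "(\<integral>\<^sup>+y. ennreal (\<alpha> * y powr (-\<alpha> - 1)) * indicator {1..} y \<partial>lborel) = 0 - (- (1 powr (-\<alpha>)))"
      using \<alpha> deriv by (intro nn_integral_FTC_atLeast) auto
    then show ?thesis using em[of UNIV] by simp
  qed
  show "real_distribution (distr Q borel R)" by (rule real_distribution_distr) simp
  show D: "real_distribution ?D"
    using total by (intro real_distribution.intro prob_spaceI real_distribution_axioms.intro) auto
  interpret D: real_distribution ?D by (rule D)
  show "cdf (distr Q borel R) = cdf ?D"
  proof
    fix y :: real
    show "cdf (distr Q borel R) y = cdf ?D y"
    proof (cases "1 \<le> y")
      case True
      have "{\<omega> \<in> space Q. R \<omega> \<le> y} = space Q - {\<omega> \<in> space Q. R \<omega> > y}" by auto
      then have "measure Q {\<omega> \<in> space Q. R \<omega> \<le> y} = 1 - y powr (-\<alpha>)"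
        using tail[OF True] by (simp add: prob_compl)
      moreover have "cdf (distr Q borel R) y = measure Q {\<omega> \<in> space Q. R \<omega> \<le> y}"
        unfolding cdf_def by (subst measure_distr) (auto intro!: arg_cong2[where f=measure])
      moreover have "emeasure ?D {..y} = ennreal (1 - y powr (-\<alpha>))"
      proof -
        have "{1..} \<inter> {..y} = {1..y}" by auto
        then have "emeasure ?D {..y} = (\<integral>\<^sup>+x. ennreal (\<alpha> * x powr (-\<alpha> - 1)) * indicator {1..y} x \<partial>lborel)"
          using em[of "{..y}"] by simp
        also have "\<dots> = - (y powr (-\<alpha>)) - (- (1 powr (-\<alpha>)))"
          using \<alpha> deriv True by (intro nn_integral_FTC_Icc) auto
        finally show ?thesis by simp
      qed
      moreover have "0 \<le> 1 - y powr (-\<alpha>)" using True \<alpha> powr_mono[of "-\<alpha>" 0 y] by simp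
      ultimately show ?thesis by (simp add: cdf_def measure_def)
    next
      case False
      have "measure Q {\<omega> \<in> space Q. R \<omega> > 1} = 1" using tail[of 1] by simp
      moreover have "{\<omega> \<in> space Q. R \<omega> \<le> 1} = space Q - {\<omega> \<in> space Q. R \<omega> > 1}" by auto
      ultimately have "measure Q {\<omega> \<in> space Q. R \<omega> \<le> 1} = 0" by (simp add: prob_compl)
      moreover have "measure Q {\<omega> \<in> space Q. R \<omega> \<le> y} \<le> measure Q {\<omega> \<in> space Q. R \<omega> \<le> 1}"
        using False by (intro finite_measure_mono) auto
      ultimately have "measure Q {\<omega> \<in> space Q. R \<omega> \<le> y} = 0" by (simp add: measure_le_0_iff)
      moreover have "cdf (distr Q borel R) y = measure Q {\<omega> \<in> space Q. R \<omega> \<le> y}"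
        unfolding cdf_def by (subst measure_distr) (auto intro!: arg_cong2[where f=measure])
      moreover have "{1..} \<inter> {..y} = {}" using False by auto
      then have "emeasure ?D {..y} = 0" using em[of "{..y}"] by simp
      ultimately show ?thesis by (simp add: cdf_def measure_def)
    qed
  qed
qed

text \<open>The functionals of the sequence used below depend only on the coordinates in a finite
  window; they are evaluated on the whole sequence so as to avoid restricted functions.\<close>

definition window_functional :: "int \<Rightarrow> ((int \<Rightarrow> real ^ 'd) \<Rightarrow> real) \<Rightarrow> bool" where
  "window_functional k f \<longleftrightarrow> 0 \<le> k \<and> continuous_on UNIV f \<and>
     (\<forall>v w. (\<forall>t\<in>{-k..k}. v t = w t) \<longrightarrow> f v = f w)"

lemma window_functional_cong:
  "window_functional k f \<Longrightarrow> (\<And>t. t \<in> {-k..k} \<Longrightarrow> v t = w t) \<Longrightarrow> f v = f w"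
  by (simp add: window_functional_def)

lemma window_functional_restrict:
  "window_functional k f \<Longrightarrow> f (\<lambda>t\<in>{-k..k}. v t) = f v"
  by (rule window_functional_cong) auto

lemma window_functional_const: "0 \<le> k \<Longrightarrow> window_functional k (\<lambda>_. c)"
  by (simp add: window_functional_def)

lemma window_functional_mult:
  "window_functional k f \<Longrightarrow> window_functional k g \<Longrightarrow> window_functional k (\<lambda>v. f v * g v)"
  unfolding window_functional_def by (auto intro!: continuous_on_mult) metis

lemma continuous_coordinate: "continuous_on A (\<lambda>v :: 'i \<Rightarrow> 'b::topological_space. v t)"
  by (rule continuous_on_subset[OF continuous_on_product_coordinates]) auto

lemma window_functional_norm:
  assumes "0 \<le> k" "continuous_on UNIV h"
  shows "window_functional k (\<lambda>v. h (norm (v 0)))"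
  unfolding window_functional_def using assms
  by (auto intro!: continuous_on_compose2[OF assms(2)] continuous_intros continuous_coordinate)

text \<open>Serves scaling by constants and by a function of the norm at time 0. Every window
  contains 0, so such a factor is determined within the window.\<close>

lemma window_functional_compose:
  assumes f: "window_functional k f"
    and c: "continuous_on UNIV c" "\<And>v w. v 0 = w 0 \<Longrightarrow> c v = c w"
  shows "window_functional k (\<lambda>v. f (\<lambda>t. c v *\<^sub>R v t))"
  unfolding window_functional_def
proof (intro conjI allI impI)
  show "0 \<le> k" using f by (simp add: window_functional_def)
  show "continuous_on UNIV (\<lambda>v. f (\<lambda>t. c v *\<^sub>R v t))"
    by (rule continuous_on_compose2[of UNIV f])
       (use f in \<open>auto simp: window_functional_def
          intro!: continuous_on_coordinatewise_then_product continuous_intros c(1) continuous_coordinate\<close>)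
  fix v w :: "int \<Rightarrow> real ^ 'a" assume vw: "\<forall>t\<in>{-k..k}. v t = w t"
  then have "v 0 = w 0" using \<open>0 \<le> k\<close> by simp
  then have "c v = c w" by (rule c(2))
  then show "f (\<lambda>t. c v *\<^sub>R v t) = f (\<lambda>t. c w *\<^sub>R w t)"
    using vw by (intro window_functional_cong[OF f]) simp
qed

lemma window_functional_measurable:
  assumes "window_functional k f" "\<And>t. (\<lambda>\<omega>. Z \<omega> t) \<in> borel_measurable M"
  shows "(\<lambda>\<omega>. f (Z \<omega>)) \<in> borel_measurable M"
proof -
  have "f \<in> borel_measurable borel"
    using assms(1) by (intro borel_measurable_continuous_onI) (simp add: window_functional_def)
  moreover have "Z \<in> borel_measurable M"
    using assms(2) by (rule measurable_coordinatewise_then_product)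
  ultimately show ?thesis by (rule measurable_compose[rotated])
qed

section \<open>Conditional limits, scaling and independence for the tail process\<close>

locale regularly_varying_tail =
  fixes M :: "'w measure" and X :: "int \<Rightarrow> 'w \<Rightarrow> real ^ 'd"
    and \<alpha> :: real and Q :: "'v measure" and Y :: "int \<Rightarrow> 'v \<Rightarrow> real ^ 'd"
  assumes M: "prob_space M" and X[measurable]: "\<And>t. X t \<in> borel_measurable M"
    and \<alpha>: "0 < \<alpha>" and tail: "tail_process M X \<alpha> Q Y"
begin

sublocale M: prob_space M by (rule M)
sublocale Q: prob_space Q using tail by (simp add: tail_process_def)

lemma Y[measurable]: "Y t \<in> borel_measurable Q"
  using tail by (simp add: tail_process_def)

definition exceed :: "real \<Rightarrow> 'w set" where
  "exceed x = {\<omega> \<in> space M. norm (X 0 \<omega>) > x}"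

definition tail_prob :: "real \<Rightarrow> real" where
  "tail_prob x = measure M (exceed x)"

lemma exceed[measurable]: "exceed x \<in> sets M"
  unfolding exceed_def by measurable

lemma tail_prob_nonneg: "0 \<le> tail_prob x"
  by (simp add: tail_prob_def)

lemma tail_prob_antimono: "x \<le> y \<Longrightarrow> tail_prob y \<le> tail_prob x"
  unfolding tail_prob_def by (rule M.finite_measure_mono) (auto simp: exceed_def)

text \<open>The definition speaks of functions on finite blocks, the sequel of functionals of whole
  sequences. A block is an extensional function, constant outside its window; it embeds continuously
  into the sequences, and a window functional does not notice the filler.\<close>

lemma tail_process_limit:
  fixes f :: "(int \<Rightarrow> real ^ 'd) \<Rightarrow> real"
  assumes f: "window_functional k f" and B: "\<And>v. \<bar>f v\<bar> \<le> B"
  shows "((\<lambda>x. (\<integral>\<omega>. indicator (exceed x) \<omega> * f (\<lambda>t. X t \<omega> /\<^sub>R x) \<partial>M) / tail_prob x)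
           \<longlongrightarrow> (\<integral>\<omega>. f (\<lambda>t. Y t \<omega>) \<partial>Q)) at_top"
proof -
  let ?I = "{-k..k}"
  have k: "0 \<le> k" and fc: "continuous_on UNIV f" using f by (auto simp: window_functional_def)
  have cont: "continuous_map (block_topology ?I) euclideanreal f"
  proof -
    have "continuous_map (block_topology ?I) (product_topology (\<lambda>_. euclidean) UNIV) (\<lambda>v. v)"
      unfolding continuous_map_componentwise_UNIV
    proof
      fix t
      show "continuous_map (block_topology ?I) euclidean (\<lambda>v. v t)"
      proof (cases "t \<in> ?I")
        case True
        then show ?thesis by (rule continuous_map_product_projection)
      next
        case False
        have "continuous_map (block_topology ?I) euclidean (\<lambda>_. undefined)" by simp
        then show ?thesis by (rule continuous_map_eq) (use False in \<open>auto simp: PiE_def extensional_def\<close>)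
      qed
    qed
    then have "continuous_map (block_topology ?I) euclidean (\<lambda>v. v)"
      by (simp add: euclidean_product_topology)
    moreover have "continuous_map euclidean euclideanreal f" using fc by simp
    ultimately have "continuous_map (block_topology ?I) euclideanreal (f \<circ> (\<lambda>v. v))"
      by (rule continuous_map_compose)
    then show ?thesis by (simp add: o_def)
  qed
  have f_block: "f \<in> borel_measurable (block_borel ?I)"
  proof -
    have "(\<lambda>v. v) \<in> measurable (block_borel ?I) (borel :: (int \<Rightarrow> real ^ 'd) measure)"
    proof (rule measurable_coordinatewise_then_product)
      fix t
      show "(\<lambda>v. v t) \<in> borel_measurable (block_borel ?I :: (int \<Rightarrow> real ^ 'd) measure)"
      proof (cases "t \<in> ?I")
        case False
        have "(\<lambda>_. undefined) \<in> borel_measurable (block_borel ?I :: (int \<Rightarrow> real ^ 'd) measure)" by simp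
        then show ?thesis
          by (rule measurable_cong[THEN iffD1, rotated])
             (use False in \<open>auto simp: space_PiM PiE_def extensional_def\<close>)
      qed simp
    qed
    from measurable_compose[OF this borel_measurable_continuous_onI[OF fc]] show ?thesis .
  qed
  have "weakly_converges (block_topology ?I)
        (\<lambda>x. distr (uniform_measure M (exceed x)) (block_borel ?I) (\<lambda>\<omega>. \<lambda>t\<in>?I. X t \<omega> /\<^sub>R x))
        (distr Q (block_borel ?I) (\<lambda>\<omega>. \<lambda>t\<in>?I. Y t \<omega>)) at_top"
    using tail k unfolding tail_process_def exceed_def by blast
  moreover have "bounded (f ` topspace (block_topology ?I))"
    using B by (intro boundedI[of _ B]) auto
  ultimately have "((\<lambda>x. \<integral>v. f v \<partial>distr (uniform_measure M (exceed x)) (block_borel ?I) (\<lambda>\<omega>. \<lambda>t\<in>?I. X t \<omega> /\<^sub>R x))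
      \<longlongrightarrow> (\<integral>v. f v \<partial>distr Q (block_borel ?I) (\<lambda>\<omega>. \<lambda>t\<in>?I. Y t \<omega>))) at_top"
    using cont unfolding weakly_converges_def by blast
  moreover have "(\<integral>v. f v \<partial>distr (uniform_measure M (exceed x)) (block_borel ?I) (\<lambda>\<omega>. \<lambda>t\<in>?I. X t \<omega> /\<^sub>R x)) =
      (\<integral>\<omega>. indicator (exceed x) \<omega> * f (\<lambda>t. X t \<omega> /\<^sub>R x) \<partial>M) / tail_prob x" for x
  proof -
    have "(\<lambda>\<omega>. \<lambda>t\<in>?I. X t \<omega> /\<^sub>R x) \<in> measurable M (block_borel ?I)"
      by (rule measurable_restrict) measurable
    then have "(\<lambda>\<omega>. \<lambda>t\<in>?I. X t \<omega> /\<^sub>R x) \<in> measurable (uniform_measure M (exceed x)) (block_borel ?I)"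
      by simp
    then have "(\<integral>v. f v \<partial>distr (uniform_measure M (exceed x)) (block_borel ?I) (\<lambda>\<omega>. \<lambda>t\<in>?I. X t \<omega> /\<^sub>R x)) =
        (\<integral>\<omega>. f (\<lambda>t\<in>?I. X t \<omega> /\<^sub>R x) \<partial>uniform_measure M (exceed x))"
      using f_block by (rule integral_distr)
    also have "\<dots> = (\<integral>\<omega>. f (\<lambda>t. X t \<omega> /\<^sub>R x) \<partial>uniform_measure M (exceed x))"
      by (simp only: window_functional_restrict[OF f])
    also have "\<dots> = (\<integral>\<omega>. indicator (exceed x) \<omega> * f (\<lambda>t. X t \<omega> /\<^sub>R x) \<partial>M) / tail_prob x"
      unfolding tail_prob_def
      by (rule integral_uniform_measure[OF M exceed window_functional_measurable[OF f]]) measurable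
    finally show ?thesis .
  qed
  moreover have "(\<integral>v. f v \<partial>distr Q (block_borel ?I) (\<lambda>\<omega>. \<lambda>t\<in>?I. Y t \<omega>)) = (\<integral>\<omega>. f (\<lambda>t. Y t \<omega>) \<partial>Q)"
  proof -
    have "(\<lambda>\<omega>. \<lambda>t\<in>?I. Y t \<omega>) \<in> measurable Q (block_borel ?I)"
      by (rule measurable_restrict) measurable
    then have "(\<integral>v. f v \<partial>distr Q (block_borel ?I) (\<lambda>\<omega>. \<lambda>t\<in>?I. Y t \<omega>)) = (\<integral>\<omega>. f (\<lambda>t\<in>?I. Y t \<omega>) \<partial>Q)"
      using f_block by (rule integral_distr)
    then show ?thesis by (simp only: window_functional_restrict[OF f])
  qed
  ultimately show ?thesis by simp
qed

text \<open>For the constant functional 1 the conditional limit says that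
  \<open>tail_prob x / tail_prob x\<close> tends to 1. As 0 / 0 is 0, the tail cannot vanish far
  out, hence nowhere by monotonicity.\<close>

lemma tail_prob_pos: "0 < tail_prob x"
proof -
  have "((\<lambda>x. (\<integral>\<omega>. indicator (exceed x) \<omega> * 1 \<partial>M) / tail_prob x) \<longlongrightarrow> (\<integral>\<omega>. 1 \<partial>Q)) at_top"
    by (rule tail_process_limit[where k=0 and B=1]) (auto intro: window_functional_const)
  then have "((\<lambda>x. tail_prob x / tail_prob x) \<longlongrightarrow> 1) at_top"
    by (simp add: tail_prob_def Q.prob_space)
  from order_tendstoD(1)[OF this, of 0]
  have "\<forall>\<^sub>F y in at_top. 0 < tail_prob y / tail_prob y" by simp
  then have "\<forall>\<^sub>F y in at_top. 0 < tail_prob y"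
    by eventually_elim (use tail_prob_nonneg in \<open>metis div_0 less_eq_real_def less_irrefl\<close>)
  with eventually_ge_at_top[of x] have "\<forall>\<^sub>F y in at_top. x \<le> y \<and> 0 < tail_prob y" by eventually_elim auto
  then obtain y where "x \<le> y" "0 < tail_prob y"
    using eventually_happens[of _ "at_top :: real filter"] by auto
  then show ?thesis using tail_prob_antimono[of x y] by linarith
qed

definition R :: "'v \<Rightarrow> real" where "R \<omega> = norm (Y 0 \<omega>)"

lemma R_measurable[measurable]: "R \<in> borel_measurable Q"
  unfolding R_def by measurable

text \<open>The tail process prescribes the values for y > 1. The end point, which makes R > 1
  almost sure, follows as y decreases to 1.\<close>

lemma R_tail:
  assumes "1 \<le> y"
  shows "measure Q {\<omega> \<in> space Q. y < R \<omega>} = y powr (-\<alpha>)"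
proof (cases "y = 1")
  case False
  then show ?thesis using tail assms by (simp add: tail_process_def R_def)
next
  case True
  have "(\<lambda>n. (1 + 1 / real (Suc n)) powr (-\<alpha>)) \<longlonglongrightarrow> (1 + 0) powr (-\<alpha>)"
    by (intro tendsto_powr tendsto_add tendsto_const LIMSEQ_Suc lim_1_over_n) auto
  moreover have "(1 + 1 / real (Suc n)) powr (-\<alpha>) \<le> measure Q {\<omega> \<in> space Q. 1 < R \<omega>}" for n
  proof -
    have "(1 + 1 / real (Suc n)) powr (-\<alpha>) = measure Q {\<omega> \<in> space Q. 1 + 1 / real (Suc n) < R \<omega>}"
      using tail by (simp add: tail_process_def R_def)
    also have "\<dots> \<le> measure Q {\<omega> \<in> space Q. 1 < R \<omega>}"
    proof (rule Q.finite_measure_mono)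
      have pos: "0 < 1 / real (Suc n)" by simp
      have "1 < r" if "1 + 1 / real (Suc n) < r" for r using that pos by linarith
      then show "{\<omega> \<in> space Q. 1 + 1 / real (Suc n) < R \<omega>} \<subseteq> {\<omega> \<in> space Q. 1 < R \<omega>}" by blast
    qed measurable
    finally show ?thesis .
  qed
  ultimately have "1 \<le> measure Q {\<omega> \<in> space Q. 1 < R \<omega>}"
    by (intro LIMSEQ_le_const2) auto
  then have "measure Q {\<omega> \<in> space Q. 1 < R \<omega>} = 1" using Q.prob_le_1 by (intro antisym)
  then show ?thesis using True by simp
qed

lemma R_gt_1: "AE \<omega> in Q. 1 < R \<omega>"
  using R_tail[of 1] by (subst Q.prob_Collect_eq_1[symmetric]) auto

text \<open>The indicator of u < R is discontinuous, so it is squeezed between two ramps at u. Their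
  gap is at most B times the mass of R near u, which vanishes because the Pareto tail is continuous.
  For u > 1 and x > 0 the event \<open>exceed (u * x)\<close> is contained in the conditioning event
  \<open>exceed x\<close>.\<close>

lemma tail_process_limit_above:
  fixes f :: "(int \<Rightarrow> real ^ 'd) \<Rightarrow> real"
  assumes f: "window_functional k f" and B: "\<And>v. 0 \<le> f v" "\<And>v. f v \<le> B" and u: "1 < u"
  shows "((\<lambda>x. (\<integral>\<omega>. indicator (exceed (u * x)) \<omega> * f (\<lambda>t. X t \<omega> /\<^sub>R x) \<partial>M) / tail_prob x)
           \<longlongrightarrow> (\<integral>\<omega>. indicator {\<omega> \<in> space Q. u < R \<omega>} \<omega> * f (\<lambda>t. Y t \<omega>) \<partial>Q)) at_top"
    (is "(?G \<longlongrightarrow> ?l) at_top")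
proof -
  have B0: "0 \<le> B" using B[of undefined] by linarith
  have k: "0 \<le> k" using f by (simp add: window_functional_def)
  define ramp where "ramp a b s = max 0 (min 1 ((s - a) / (b - a)))" for a b s :: real
  have ramp: "0 \<le> ramp a b s" "ramp a b s \<le> 1" for a b s by (auto simp: ramp_def)
  have ramp1: "ramp a b s = 1" if "a < b" "b \<le> s" for a b s
    using that by (auto simp: ramp_def max_def min_def field_simps)
  have ramp0: "ramp a b s = 0" if "a < b" "s \<le> a" for a b s
    using that by (auto simp: ramp_def max_def min_def divide_nonpos_nonneg field_simps)
  have ramp_cont: "continuous_on UNIV (ramp a b)" for a b
    unfolding ramp_def by (cases "a = b") (auto intro!: continuous_intros)
  have fr: "window_functional k (\<lambda>v. f v * ramp a b (norm (v 0)))" for a b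
    by (intro window_functional_mult f window_functional_norm k ramp_cont)
  have frB: "0 \<le> f v * ramp a b s" "f v * ramp a b s \<le> B" for v a b s
    using B[of v] ramp[of a b s] B0 mult_mono[of "f v" B "ramp a b s" 1] by auto
  have lim: "((\<lambda>x. (\<integral>\<omega>. indicator (exceed x) \<omega> * (f (\<lambda>t. X t \<omega> /\<^sub>R x) * ramp a b (norm (X 0 \<omega> /\<^sub>R x))) \<partial>M) / tail_prob x)
       \<longlongrightarrow> (\<integral>\<omega>. f (\<lambda>t. Y t \<omega>) * ramp a b (R \<omega>) \<partial>Q)) at_top" for a b
    unfolding R_def by (rule tail_process_limit[OF fr, where B=B]) (simp add: frB abs_of_nonneg)
  have [measurable]: "(\<lambda>\<omega>. f (\<lambda>t. Y t \<omega>)) \<in> borel_measurable Q"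
    "(\<lambda>\<omega>. f (\<lambda>t. X t \<omega> /\<^sub>R x)) \<in> borel_measurable M" for x
    by (rule window_functional_measurable[OF f], measurable)+
  have [measurable]: "ramp a b \<in> borel_measurable borel" for a b
    using ramp_cont by (rule borel_measurable_continuous_onI)
  have intM: "integrable M (\<lambda>\<omega>. indicator A \<omega> * (f (\<lambda>t. X t \<omega> /\<^sub>R x) * h \<omega>))"
    if [measurable]: "A \<in> sets M" "h \<in> borel_measurable M" and "\<And>\<omega>. 0 \<le> h \<omega>" "\<And>\<omega>. h \<omega> \<le> 1" for A h x
  proof (rule M.integrable_const_bound[where B=B])
    show "AE \<omega> in M. norm (indicator A \<omega> * (f (\<lambda>t. X t \<omega> /\<^sub>R x) * h \<omega>)) \<le> B"
      using B B0 that(3,4) by (intro AE_I2) (auto simp: indicator_def abs_mult intro: mult_mono[of _ B _ 1, simplified])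
  qed measurable
  have intQ: "integrable Q (\<lambda>\<omega>. f (\<lambda>t. Y t \<omega>) * h \<omega>)"
    if [measurable]: "h \<in> borel_measurable Q" and "\<And>\<omega>. 0 \<le> h \<omega>" "\<And>\<omega>. h \<omega> \<le> 1" for h
  proof (rule Q.integrable_const_bound[where B=B])
    show "AE \<omega> in Q. norm (f (\<lambda>t. Y t \<omega>) * h \<omega>) \<le> B"
      using B B0 that(2,3) by (intro AE_I2) (auto simp: abs_mult intro: mult_mono[of _ B _ 1, simplified])
  qed measurable
  have indQ: "indicator {\<omega> \<in> space Q. u < R \<omega>} \<omega> * f (\<lambda>t. Y t \<omega>) = f (\<lambda>t. Y t \<omega>) * indicator {\<omega> \<in> space Q. u < R \<omega>} \<omega>" for \<omega>
    by (rule mult.commute)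
  have up: "?G x \<le> (\<integral>\<omega>. indicator (exceed x) \<omega> * (f (\<lambda>t. X t \<omega> /\<^sub>R x) * ramp a u (norm (X 0 \<omega> /\<^sub>R x))) \<partial>M) / tail_prob x"
    if "0 < x" "a < u" for x a
  proof (intro divide_right_mono tail_prob_nonneg integral_mono)
    show "integrable M (\<lambda>\<omega>. indicator (exceed (u * x)) \<omega> * f (\<lambda>t. X t \<omega> /\<^sub>R x))"
      using intM[of "exceed (u * x)" "\<lambda>_. 1"] by simp
    show "integrable M (\<lambda>\<omega>. indicator (exceed x) \<omega> * (f (\<lambda>t. X t \<omega> /\<^sub>R x) * ramp a u (norm (X 0 \<omega> /\<^sub>R x))))"
      by (rule intM) (use ramp in auto)
    fix \<omega> assume \<omega>: "\<omega> \<in> space M"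
    show "indicator (exceed (u * x)) \<omega> * f (\<lambda>t. X t \<omega> /\<^sub>R x) \<le>
        indicator (exceed x) \<omega> * (f (\<lambda>t. X t \<omega> /\<^sub>R x) * ramp a u (norm (X 0 \<omega> /\<^sub>R x)))"
    proof (cases "\<omega> \<in> exceed (u * x)")
      case True
      then have n: "u * x < norm (X 0 \<omega>)" by (simp add: exceed_def)
      have "1 * x \<le> u * x" using u that(1) by (intro mult_right_mono) auto
      then have "\<omega> \<in> exceed x" using n \<omega> by (simp add: exceed_def)
      moreover have "u \<le> norm (X 0 \<omega> /\<^sub>R x)" using n that(1) by (simp add: field_simps)
      ultimately show ?thesis using True ramp1[OF that(2)] by simp
    qed (use frB in \<open>auto simp: indicator_def\<close>)
  qed
  have low: "(\<integral>\<omega>. indicator (exceed x) \<omega> * (f (\<lambda>t. X t \<omega> /\<^sub>R x) * ramp u b (norm (X 0 \<omega> /\<^sub>R x))) \<partial>M) / tail_prob x \<le> ?G x"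
    if "0 < x" "u < b" for x b
  proof (intro divide_right_mono tail_prob_nonneg integral_mono)
    show "integrable M (\<lambda>\<omega>. indicator (exceed (u * x)) \<omega> * f (\<lambda>t. X t \<omega> /\<^sub>R x))"
      using intM[of "exceed (u * x)" "\<lambda>_. 1"] by simp
    show "integrable M (\<lambda>\<omega>. indicator (exceed x) \<omega> * (f (\<lambda>t. X t \<omega> /\<^sub>R x) * ramp u b (norm (X 0 \<omega> /\<^sub>R x))))"
      by (rule intM) (use ramp in auto)
    fix \<omega> assume \<omega>: "\<omega> \<in> space M"
    show "indicator (exceed x) \<omega> * (f (\<lambda>t. X t \<omega> /\<^sub>R x) * ramp u b (norm (X 0 \<omega> /\<^sub>R x))) \<le>
        indicator (exceed (u * x)) \<omega> * f (\<lambda>t. X t \<omega> /\<^sub>R x)"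
    proof (cases "\<omega> \<in> exceed (u * x)")
      case True
      then show ?thesis using B[of "\<lambda>t. X t \<omega> /\<^sub>R x"] ramp[of u b "norm (X 0 \<omega> /\<^sub>R x)"]
        mult_left_le[of "ramp u b (norm (X 0 \<omega> /\<^sub>R x))" "f (\<lambda>t. X t \<omega> /\<^sub>R x)"]
        by (auto simp: indicator_def)
    next
      case False
      then have "norm (X 0 \<omega>) \<le> u * x" using \<omega> by (auto simp: exceed_def)
      then have "norm (X 0 \<omega> /\<^sub>R x) \<le> u" using that(1) by (simp add: field_simps)
      then show ?thesis using ramp0[OF that(2)] False by simp
    qed
  qed
  show ?thesis
  proof (rule tendstoI)
    fix e :: real assume e: "0 < e"
    \<comment> \<open>\<eta> is the width of each ramp; keeping it below u - 1 leaves u - \<eta>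
      above 1, where the tail of R is known.\<close>
    have "((\<lambda>\<eta>. B * ((u - \<eta>) powr (-\<alpha>) - (u + \<eta>) powr (-\<alpha>))) \<longlongrightarrow> B * ((u - 0) powr (-\<alpha>) - (u + 0) powr (-\<alpha>))) (at_right 0)"
      using u by (intro tendsto_intros) auto
    then have "\<forall>\<^sub>F \<eta> in at_right 0. B * ((u - \<eta>) powr (-\<alpha>) - (u + \<eta>) powr (-\<alpha>)) < e"
      using e by (intro order_tendstoD(2)) auto
    moreover have "\<forall>\<^sub>F \<eta> in at_right 0. \<eta> < u - 1" using u by (auto simp: eventually_at_right_field intro!: exI[of _ "u - 1"])
    moreover have "\<forall>\<^sub>F \<eta> in at_right (0::real). 0 < \<eta>" by (rule eventually_at_right_less)
    ultimately have "\<forall>\<^sub>F \<eta> in at_right 0. B * ((u - \<eta>) powr (-\<alpha>) - (u + \<eta>) powr (-\<alpha>)) < e \<and> \<eta> < u - 1 \<and> 0 < \<eta>"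
      by eventually_elim auto
    then obtain \<eta> where \<eta>: "B * ((u - \<eta>) powr (-\<alpha>) - (u + \<eta>) powr (-\<alpha>)) < e" "\<eta> < u - 1" "0 < \<eta>"
      using eventually_happens[of _ "at_right (0::real)"] by auto
    define lo where "lo = (\<integral>\<omega>. f (\<lambda>t. Y t \<omega>) * ramp u (u + \<eta>) (R \<omega>) \<partial>Q)"
    define hi where "hi = (\<integral>\<omega>. f (\<lambda>t. Y t \<omega>) * ramp (u - \<eta>) u (R \<omega>) \<partial>Q)"
    have "lo \<le> ?l"
      unfolding lo_def indQ
    proof (rule integral_mono)
      fix \<omega> assume "\<omega> \<in> space Q"
      then show "f (\<lambda>t. Y t \<omega>) * ramp u (u + \<eta>) (R \<omega>) \<le> f (\<lambda>t. Y t \<omega>) * indicator {\<omega> \<in> space Q. u < R \<omega>} \<omega>"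
        using ramp[of u "u + \<eta>"] ramp0[of u "u + \<eta>" "R \<omega>"] \<eta>(3) B(1)
        by (intro mult_left_mono) (auto simp: indicator_def not_less)
    qed (auto intro!: intQ ramp)
    moreover have "?l \<le> hi"
      unfolding hi_def indQ
    proof (rule integral_mono)
      fix \<omega> assume "\<omega> \<in> space Q"
      then show "f (\<lambda>t. Y t \<omega>) * indicator {\<omega> \<in> space Q. u < R \<omega>} \<omega> \<le> f (\<lambda>t. Y t \<omega>) * ramp (u - \<eta>) u (R \<omega>)"
        using ramp[of "u - \<eta>" u] ramp1[of "u - \<eta>" u "R \<omega>"] \<eta>(3) B(1)
        by (intro mult_left_mono) (auto simp: indicator_def)
    qed (auto intro!: intQ ramp)
    moreover have "hi - lo \<le> B * ((u - \<eta>) powr (-\<alpha>) - (u + \<eta>) powr (-\<alpha>))"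
    proof -
      have "hi - lo = (\<integral>\<omega>. f (\<lambda>t. Y t \<omega>) * ramp (u - \<eta>) u (R \<omega>) - f (\<lambda>t. Y t \<omega>) * ramp u (u + \<eta>) (R \<omega>) \<partial>Q)"
        unfolding hi_def lo_def by (rule Bochner_Integration.integral_diff[symmetric]; rule intQ) (auto intro: ramp)
      also have "\<dots> \<le> (\<integral>\<omega>. B * (indicator {\<omega> \<in> space Q. u - \<eta> < R \<omega>} \<omega> - indicator {\<omega> \<in> space Q. u + \<eta> < R \<omega>} \<omega>) \<partial>Q)"
      proof (rule integral_mono)
        show "integrable Q (\<lambda>\<omega>. f (\<lambda>t. Y t \<omega>) * ramp (u - \<eta>) u (R \<omega>) - f (\<lambda>t. Y t \<omega>) * ramp u (u + \<eta>) (R \<omega>))"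
          by (rule Bochner_Integration.integrable_diff; rule intQ) (auto intro: ramp)
        show "integrable Q (\<lambda>\<omega>. B * (indicator {\<omega> \<in> space Q. u - \<eta> < R \<omega>} \<omega> - indicator {\<omega> \<in> space Q. u + \<eta> < R \<omega>} \<omega>))"
          by (intro integrable_mult_right Bochner_Integration.integrable_diff integrable_real_indicator)
             (auto simp: less_top[symmetric])
        fix \<omega> assume \<omega>: "\<omega> \<in> space Q"
        define s where "s = R \<omega>"
        have d: "ramp (u - \<eta>) u s - ramp u (u + \<eta>) s \<le> of_bool (u - \<eta> < s) - of_bool (u + \<eta> < s)"
          using ramp1[of "u - \<eta>" u s] ramp1[of u "u + \<eta>" s] ramp0[of "u - \<eta>" u s] ramp0[of u "u + \<eta>" s]
            ramp[of "u - \<eta>" u s] ramp[of u "u + \<eta>" s] \<eta>(3) by (auto simp: not_less of_bool_def split: if_splits)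
        have nn: "(0::real) \<le> of_bool (u - \<eta> < s) - of_bool (u + \<eta> < s)" using \<eta>(3) by (auto simp: of_bool_def)
        have "f (\<lambda>t. Y t \<omega>) * (ramp (u - \<eta>) u s - ramp u (u + \<eta>) s) \<le>
            f (\<lambda>t. Y t \<omega>) * (of_bool (u - \<eta> < s) - of_bool (u + \<eta> < s))"
          using d B(1) by (intro mult_left_mono) auto
        also have "\<dots> \<le> B * (of_bool (u - \<eta> < s) - of_bool (u + \<eta> < s))"
          using nn B(2) by (intro mult_right_mono) auto
        finally show "f (\<lambda>t. Y t \<omega>) * ramp (u - \<eta>) u (R \<omega>) - f (\<lambda>t. Y t \<omega>) * ramp u (u + \<eta>) (R \<omega>)
          \<le> B * (indicator {\<omega> \<in> space Q. u - \<eta> < R \<omega>} \<omega> - indicator {\<omega> \<in> space Q. u + \<eta> < R \<omega>} \<omega>)"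
          using \<omega> by (simp add: s_def[symmetric] right_diff_distrib indicator_def of_bool_def)
      qed
      also have "\<dots> = B * (measure Q {\<omega> \<in> space Q. u - \<eta> < R \<omega>} - measure Q {\<omega> \<in> space Q. u + \<eta> < R \<omega>})"
        by (subst integral_mult_right_zero, subst Bochner_Integration.integral_diff)
           (auto simp: less_top[symmetric] intro!: integrable_real_indicator)
      also have "\<dots> = B * ((u - \<eta>) powr (-\<alpha>) - (u + \<eta>) powr (-\<alpha>))"
        using \<eta>(2,3) u by (simp add: R_tail)
      finally show ?thesis .
    qed
    ultimately have gap: "?l < lo + e" "hi - e < ?l" using \<eta>(1) by linarith+
    have "\<forall>\<^sub>F x in at_top. ?l - e < (\<integral>\<omega>. indicator (exceed x) \<omega> * (f (\<lambda>t. X t \<omega> /\<^sub>R x) * ramp u (u + \<eta>) (norm (X 0 \<omega> /\<^sub>R x))) \<partial>M) / tail_prob x"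
      using lim[of u "u + \<eta>"] gap(1) unfolding lo_def[symmetric] by (intro order_tendstoD(1)) auto
    moreover have "\<forall>\<^sub>F x in at_top. (\<integral>\<omega>. indicator (exceed x) \<omega> * (f (\<lambda>t. X t \<omega> /\<^sub>R x) * ramp (u - \<eta>) u (norm (X 0 \<omega> /\<^sub>R x))) \<partial>M) / tail_prob x < ?l + e"
      using lim[of "u - \<eta>" u] gap(2) unfolding hi_def[symmetric] by (intro order_tendstoD(2)) auto
    ultimately show "\<forall>\<^sub>F x in at_top. dist (?G x) ?l < e"
      using eventually_gt_at_top[of 0]
    proof eventually_elim
      case (elim x)
      have "?l - e < ?G x" using elim(1) low[OF elim(3), of "u + \<eta>"] \<eta>(3) by linarith
      moreover have "?G x < ?l + e" using elim(2) up[OF elim(3), of "u - \<eta>"] \<eta>(3) by linarith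
      ultimately show ?case by (simp add: dist_real_def abs_less_iff)
    qed
  qed
qed

end

context regularly_varying_tail
begin

text \<open>For u > 1 this is the preceding limit for the constant functional 1; for u < 1 it is the
  reciprocal of the ratio with factor 1 / u, taken at u x.\<close>

lemma tail_prob_ratio:
  assumes u: "0 < u"
  shows "((\<lambda>x. tail_prob (u * x) / tail_prob x) \<longlongrightarrow> u powr (-\<alpha>)) at_top"
proof -
  have gt1: "((\<lambda>x. tail_prob (u * x) / tail_prob x) \<longlongrightarrow> u powr (-\<alpha>)) at_top" if "1 < u" for u
  proof -
    have "((\<lambda>x. (\<integral>\<omega>. indicator (exceed (u * x)) \<omega> * 1 \<partial>M) / tail_prob x) \<longlongrightarrow>
       (\<integral>\<omega>. indicator {\<omega> \<in> space Q. u < R \<omega>} \<omega> * 1 \<partial>Q)) at_top"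
      by (rule tail_process_limit_above[where k=0 and B=1]) (auto intro: window_functional_const that)
    then show ?thesis using that by (simp add: tail_prob_def R_tail)
  qed
  consider "u = 1" | "1 < u" | "u < 1" by linarith
  then show ?thesis
  proof cases
    case 1
    then show ?thesis using tail_prob_pos by (simp add: less_imp_neq[symmetric])
  next
    case 2
    then show ?thesis by (rule gt1)
  next
    case 3
    have "((\<lambda>x. inverse (tail_prob (inverse u * (u * x)) / tail_prob (u * x))) \<longlongrightarrow> inverse (inverse u powr (-\<alpha>))) at_top"
    proof (rule tendsto_inverse)
      have "filterlim (\<lambda>x. u * x) at_top at_top"
        using u by (rule filterlim_tendsto_pos_mult_at_top[OF tendsto_const _ filterlim_ident])
      from filterlim_compose[OF gt1[of "inverse u"] this]
      show "((\<lambda>x. tail_prob (inverse u * (u * x)) / tail_prob (u * x)) \<longlongrightarrow> inverse u powr (-\<alpha>)) at_top"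
        using u 3 by (simp add: one_less_inverse)
    qed (use u in simp)
    moreover have "inverse u * (u * x) = x" for x using u by simp
    moreover have "inverse (inverse u powr (-\<alpha>)) = u powr (-\<alpha>)"
      using u by (simp add: powr_minus inverse_powr)
    ultimately show ?thesis by (simp only: inverse_divide)
  qed
qed

text \<open>The expectation over the event that \<open>X 0\<close> exceeds u x has two descriptions.
  Relative to level x it tends to the left side; relative to level u x it is a ratio of tails times
  a conditional expectation of the rescaled sequence. Uniqueness of limits gives the identity from
  which independence follows.\<close>

lemma scaling:
  fixes f :: "(int \<Rightarrow> real ^ 'd) \<Rightarrow> real"
  assumes f: "window_functional k f" and B: "\<And>v. 0 \<le> f v" "\<And>v. f v \<le> B" and u: "1 < u"
  shows "(\<integral>\<omega>. indicator {\<omega> \<in> space Q. u < R \<omega>} \<omega> * f (\<lambda>t. Y t \<omega>) \<partial>Q) =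
    u powr (-\<alpha>) * (\<integral>\<omega>. f (\<lambda>t. u *\<^sub>R Y t \<omega>) \<partial>Q)"
proof (rule tendsto_unique[OF _ tail_process_limit_above[OF f B u]])
  have fu: "window_functional k (\<lambda>v. f (\<lambda>t. u *\<^sub>R v t))"
    by (rule window_functional_compose[OF f]) auto
  have lim: "filterlim (\<lambda>x. u * x) at_top at_top"
    using u by (intro filterlim_tendsto_pos_mult_at_top[OF tendsto_const _ filterlim_ident]) simp
  have "((\<lambda>x. (\<integral>\<omega>. indicator (exceed (u * x)) \<omega> * f (\<lambda>t. u *\<^sub>R (X t \<omega> /\<^sub>R (u * x))) \<partial>M) / tail_prob (u * x))
     \<longlongrightarrow> (\<integral>\<omega>. f (\<lambda>t. u *\<^sub>R Y t \<omega>) \<partial>Q)) at_top"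
    using filterlim_compose[OF tail_process_limit[OF fu, of B] lim] B by (simp add: abs_of_nonneg)
  then have lim_prod: "((\<lambda>x. tail_prob (u * x) / tail_prob x *
      ((\<integral>\<omega>. indicator (exceed (u * x)) \<omega> * f (\<lambda>t. u *\<^sub>R (X t \<omega> /\<^sub>R (u * x))) \<partial>M) / tail_prob (u * x)))
     \<longlongrightarrow> u powr (-\<alpha>) * (\<integral>\<omega>. f (\<lambda>t. u *\<^sub>R Y t \<omega>) \<partial>Q)) at_top"
    using u by (intro tendsto_mult tail_prob_ratio) auto
  have sc: "u *\<^sub>R (v /\<^sub>R (u * x)) = v /\<^sub>R x" for v :: "real ^ 'd" and x
  proof -
    have "u * inverse (u * x) = inverse x" using u by simp
    then show ?thesis by (simp only: scaleR_scaleR)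
  qed
  have "tail_prob (u * x) / tail_prob x *
      ((\<integral>\<omega>. indicator (exceed (u * x)) \<omega> * f (\<lambda>t. u *\<^sub>R (X t \<omega> /\<^sub>R (u * x))) \<partial>M) / tail_prob (u * x)) =
      (\<integral>\<omega>. indicator (exceed (u * x)) \<omega> * f (\<lambda>t. X t \<omega> /\<^sub>R x) \<partial>M) / tail_prob x" for x
    unfolding sc using tail_prob_pos[of "u * x"] by simp
  with lim_prod show "((\<lambda>x. (\<integral>\<omega>. indicator (exceed (u * x)) \<omega> * f (\<lambda>t. X t \<omega> /\<^sub>R x) \<partial>M) / tail_prob x)
     \<longlongrightarrow> u powr (-\<alpha>) * (\<integral>\<omega>. f (\<lambda>t. u *\<^sub>R Y t \<omega>) \<partial>Q)) at_top" by simp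
qed simp

abbreviation \<Theta> :: "int \<Rightarrow> 'v \<Rightarrow> real ^ 'd" where "\<Theta> \<equiv> spectral_tail Y"

lemma Theta_eq: "\<Theta> t \<omega> = Y t \<omega> /\<^sub>R R \<omega>"
  by (simp add: spectral_tail_def R_def)

lemma Theta_measurable[measurable]: "\<Theta> t \<in> borel_measurable Q"
  unfolding Theta_eq[abs_def] by measurable

text \<open>\<open>scaling\<close> is applied to f after division by
  \<open>max 1 (norm (v 0))\<close>. This division is continuous everywhere, reproduces the spectral
  process where R > 1, and cancels the factor u on the right of \<open>scaling\<close>. For u at
  most 1 the event has probability 1.\<close>

lemma Theta_independent:
  fixes f :: "(int \<Rightarrow> real ^ 'd) \<Rightarrow> real"
  assumes f: "window_functional k f" and B: "\<And>v. 0 \<le> f v" "\<And>v. f v \<le> B" and u: "0 \<le> u"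
  shows "(\<integral>\<omega>. indicator {\<omega> \<in> space Q. u < R \<omega>} \<omega> * f (\<lambda>t. \<Theta> t \<omega>) \<partial>Q) =
    measure Q {\<omega> \<in> space Q. u < R \<omega>} * (\<integral>\<omega>. f (\<lambda>t. \<Theta> t \<omega>) \<partial>Q)"
proof (cases "1 < u")
  case True
  define h where "h v = f (\<lambda>t. inverse (max 1 (norm (v 0))) *\<^sub>R v t)" for v :: "int \<Rightarrow> real ^ 'd"
  have h: "window_functional k h"
    unfolding h_def
    by (rule window_functional_compose[OF f]) (auto intro!: continuous_intros continuous_coordinate)
  have h1: "h (\<lambda>t. c *\<^sub>R Y t \<omega>) = f (\<lambda>t. \<Theta> t \<omega>)" if "1 < R \<omega>" "1 \<le> c" for c \<omega>
  proof -
    have "1 * 1 \<le> c * R \<omega>" using that by (intro mult_mono) auto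
    then have "max 1 (norm (c *\<^sub>R Y 0 \<omega>)) = c * R \<omega>" using that by (simp add: R_def max_def)
    moreover have "inverse (c * R \<omega>) * c = inverse (R \<omega>)" using that by simp
    ultimately show ?thesis by (simp only: h_def Theta_eq scaleR_scaleR)
  qed
  have meas[measurable]: "(\<lambda>\<omega>. h (\<lambda>t. c *\<^sub>R Y t \<omega>)) \<in> borel_measurable Q" for c
    by (rule window_functional_measurable[OF h]) measurable
  have [measurable]: "(\<lambda>\<omega>. f (\<lambda>t. \<Theta> t \<omega>)) \<in> borel_measurable Q"
    by (rule window_functional_measurable[OF f]) measurable
  have [measurable]: "(\<lambda>\<omega>. h (\<lambda>t. Y t \<omega>)) \<in> borel_measurable Q" using meas[of 1] by simp
  have "(\<integral>\<omega>. indicator {\<omega> \<in> space Q. u < R \<omega>} \<omega> * f (\<lambda>t. \<Theta> t \<omega>) \<partial>Q) =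
      (\<integral>\<omega>. indicator {\<omega> \<in> space Q. u < R \<omega>} \<omega> * h (\<lambda>t. Y t \<omega>) \<partial>Q)"
    using R_gt_1 by (intro integral_cong_AE) (auto elim!: eventually_mono simp: h1[of _ 1, simplified])
  also have "\<dots> = u powr (-\<alpha>) * (\<integral>\<omega>. h (\<lambda>t. u *\<^sub>R Y t \<omega>) \<partial>Q)"
    by (rule scaling[OF h, where B=B, OF _ _ True]) (auto simp: h_def B)
  also have "(\<integral>\<omega>. h (\<lambda>t. u *\<^sub>R Y t \<omega>) \<partial>Q) = (\<integral>\<omega>. f (\<lambda>t. \<Theta> t \<omega>) \<partial>Q)"
    using R_gt_1 True by (intro integral_cong_AE) (auto elim!: eventually_mono simp: h1)
  finally show ?thesis using True by (simp add: R_tail)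
next
  case False
  then have ae: "AE \<omega> in Q. u < R \<omega>" using R_gt_1 by (auto elim!: eventually_mono)
  have [measurable]: "(\<lambda>\<omega>. f (\<lambda>t. \<Theta> t \<omega>)) \<in> borel_measurable Q"
    by (rule window_functional_measurable[OF f]) measurable
  have "measure Q {\<omega> \<in> space Q. u < R \<omega>} = 1" using ae by (subst Q.prob_Collect_eq_1) auto
  moreover have "(\<integral>\<omega>. indicator {\<omega> \<in> space Q. u < R \<omega>} \<omega> * f (\<lambda>t. \<Theta> t \<omega>) \<partial>Q) = (\<integral>\<omega>. f (\<lambda>t. \<Theta> t \<omega>) \<partial>Q)"
  proof (rule integral_cong_AE)
    show "AE \<omega> in Q. indicator {\<omega> \<in> space Q. u < R \<omega>} \<omega> * f (\<lambda>t. \<Theta> t \<omega>) = f (\<lambda>t. \<Theta> t \<omega>)"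
      using ae AE_space[of Q] by eventually_elim simp
  qed measurable
  ultimately show ?thesis by simp
qed

text \<open>Y equals R times the spectral process almost surely; independence integrates out the
  spectral process for each value of R, whose law is Pareto.\<close>

lemma tail_process_integral:
  fixes f :: "(int \<Rightarrow> real ^ 'd) \<Rightarrow> real"
  assumes f: "window_functional k f" and B: "\<And>v. 0 \<le> f v" "\<And>v. f v \<le> B"
  shows "(\<lambda>y. \<integral>\<omega>. f (\<lambda>t. y *\<^sub>R \<Theta> t \<omega>) \<partial>Q) \<in> borel_measurable borel"
    and "(\<integral>\<omega>. f (\<lambda>t. Y t \<omega>) \<partial>Q) =
      (\<integral>y. indicator {1..} y * (\<alpha> * y powr (-\<alpha> - 1)) * (\<integral>\<omega>. f (\<lambda>t. y *\<^sub>R \<Theta> t \<omega>) \<partial>Q) \<partial>lborel)"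
proof -
  have fs: "window_functional k (\<lambda>v. f (\<lambda>t. s *\<^sub>R v t))" for s
    by (rule window_functional_compose[OF f]) auto
  have meas: "(\<lambda>\<omega>. f (\<lambda>t. s *\<^sub>R \<Theta> t \<omega>)) \<in> borel_measurable Q" for s
    by (rule window_functional_measurable[OF f]) measurable
  have abs: "\<bar>f v\<bar> \<le> B" for v using B[of v] by simp
  have cont: "continuous_on UNIV (\<lambda>s. f (\<lambda>t. s *\<^sub>R \<Theta> t \<omega>))" for \<omega>
    by (rule continuous_on_compose2[of UNIV f])
       (use f in \<open>auto simp: window_functional_def intro!: continuous_on_coordinatewise_then_product continuous_intros\<close>)
  note * = integral_independent_argument[where F="\<lambda>s \<omega>. f (\<lambda>t. s *\<^sub>R \<Theta> t \<omega>)" and B=B,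
      OF Q.prob_space_axioms R_measurable _ meas abs cont Theta_independent[OF fs B]]
  have R0: "0 \<le> R \<omega>" for \<omega> by (simp add: R_def)
  show phi[measurable]: "(\<lambda>y. \<integral>\<omega>. f (\<lambda>t. y *\<^sub>R \<Theta> t \<omega>) \<partial>Q) \<in> borel_measurable borel"
    by (rule borel_measurable_continuous_onI[OF *(1)[OF R0]])
  have [measurable]: "(\<lambda>\<omega>. f (\<lambda>t. R \<omega> *\<^sub>R \<Theta> t \<omega>)) \<in> borel_measurable Q" "(\<lambda>\<omega>. f (\<lambda>t. Y t \<omega>)) \<in> borel_measurable Q"
    by (rule window_functional_measurable[OF f], measurable)+
  have "(\<integral>\<omega>. f (\<lambda>t. Y t \<omega>) \<partial>Q) = (\<integral>\<omega>. f (\<lambda>t. R \<omega> *\<^sub>R \<Theta> t \<omega>) \<partial>Q)"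
  proof (rule integral_cong_AE)
    show "AE \<omega> in Q. f (\<lambda>t. Y t \<omega>) = f (\<lambda>t. R \<omega> *\<^sub>R \<Theta> t \<omega>)"
      using R_gt_1 by eventually_elim (simp add: Theta_eq)
  qed measurable
  also have "\<dots> = (\<integral>\<omega>. (\<integral>\<omega>'. f (\<lambda>t. R \<omega> *\<^sub>R \<Theta> t \<omega>') \<partial>Q) \<partial>Q)"
    by (rule *(2)[OF R0])
  also have "\<dots> = (\<integral>y. (\<integral>\<omega>'. f (\<lambda>t. y *\<^sub>R \<Theta> t \<omega>') \<partial>Q) \<partial>distr Q borel R)"
    by (rule integral_distr[symmetric]) measurable
  also have "\<dots> = (\<integral>y. (indicator {1..} y * (\<alpha> * y powr (-\<alpha> - 1))) *\<^sub>R (\<integral>\<omega>. f (\<lambda>t. y *\<^sub>R \<Theta> t \<omega>) \<partial>Q) \<partial>lborel)"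
  proof -
    have "distr Q borel R = density lborel (\<lambda>y. ennreal (indicator {1..} y * (\<alpha> * y powr (-\<alpha> - 1))))"
      by (rule pareto_distribution[OF Q.prob_space_axioms R_measurable \<alpha>]) (rule R_tail)
    then show ?thesis
      using \<alpha> by (simp only:) (rule integral_density, auto simp: indicator_def)
  qed
  finally show "(\<integral>\<omega>. f (\<lambda>t. Y t \<omega>) \<partial>Q) =
      (\<integral>y. indicator {1..} y * (\<alpha> * y powr (-\<alpha> - 1)) * (\<integral>\<omega>. f (\<lambda>t. y *\<^sub>R \<Theta> t \<omega>) \<partial>Q) \<partial>lborel)"
    by simp
qed

text \<open>The tail at \<open>a n\<close> is of order 1 / n and tends to 0, while at a fixed C it
  is positive; monotonicity places \<open>a n\<close> above C.\<close>

lemma normalizing_at_top: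
  assumes a: "(\<lambda>n. real n * tail_prob (a n)) \<longlonglongrightarrow> 1"
  shows "filterlim a at_top sequentially"
  unfolding filterlim_at_top
proof
  fix C
  have "(\<lambda>n. (real n * tail_prob (a n)) * inverse (real n)) \<longlonglongrightarrow> 1 * 0"
    by (rule tendsto_mult[OF a lim_inverse_n])
  then have "(\<lambda>n. (real n * tail_prob (a n)) * inverse (real n)) \<longlonglongrightarrow> 0" by simp
  from order_tendstoD(2)[OF this tail_prob_pos[of C]] eventually_gt_at_top[of 0]
  show "\<forall>\<^sub>F n in sequentially. C \<le> a n"
  proof eventually_elim
    case (elim n)
    then have "tail_prob (a n) < tail_prob C" by (simp add: field_simps)
    then show ?case using tail_prob_antimono[of "a n" C] by linarith
  qed
qed

lemma normalizing_scaled: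
  assumes a: "(\<lambda>n. real n * tail_prob (a n)) \<longlonglongrightarrow> 1" and \<delta>: "0 < \<delta>"
  shows "(\<lambda>n. real n * tail_prob (\<delta> * a n)) \<longlonglongrightarrow> \<delta> powr (-\<alpha>)"
proof -
  have "(\<lambda>n. (real n * tail_prob (a n)) * (tail_prob (\<delta> * a n) / tail_prob (a n))) \<longlonglongrightarrow> 1 * \<delta> powr (-\<alpha>)"
    by (intro tendsto_mult a filterlim_compose[OF tail_prob_ratio[OF \<delta>] normalizing_at_top[OF a]])
  moreover have "tail_prob x \<noteq> 0" for x using tail_prob_pos[of x] by simp
  ultimately show ?thesis by simp
qed

end

section \<open>Anti-clustering and blocks\<close>

lemma stationary_expectation:
  fixes X :: "int \<Rightarrow> 'w \<Rightarrow> real ^ 'd" and f :: "(int \<Rightarrow> real ^ 'd) \<Rightarrow> real"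
  assumes X: "\<And>t. X t \<in> borel_measurable M" and stat: "strictly_stationary M X"
    and f: "f \<in> borel_measurable (PiM UNIV (\<lambda>_. borel))"
  shows "(\<integral>\<omega>. f (\<lambda>t. X (t + h) \<omega>) \<partial>M) = (\<integral>\<omega>. f (\<lambda>t. X t \<omega>) \<partial>M)"
proof -
  let ?P = "PiM UNIV (\<lambda>_. borel) :: (int \<Rightarrow> real ^ 'd) measure"
  have m: "(\<lambda>\<omega> t. X (t + h) \<omega>) \<in> measurable M ?P" for h
    by (rule measurable_PiM_single') (auto simp: X space_PiM)
  have "(\<integral>\<omega>. f (\<lambda>t. X (t + h) \<omega>) \<partial>M) = (\<integral>v. f v \<partial>distr M ?P (\<lambda>\<omega> t. X (t + h) \<omega>))"
    by (rule integral_distr[symmetric, OF m f])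
  also have "distr M ?P (\<lambda>\<omega> t. X (t + h) \<omega>) = distr M ?P (\<lambda>\<omega> t. X t \<omega>)"
    using stat by (simp add: strictly_stationary_def)
  also have "(\<integral>v. f v \<partial>\<dots>) = (\<integral>\<omega>. f (\<lambda>t. X t \<omega>) \<partial>M)"
    using m[of 0] f by (intro integral_distr) simp_all
  finally show ?thesis .
qed

lemma prod_one_minus_bounds:
  fixes x :: "'i \<Rightarrow> real"
  assumes "\<And>i. i \<in> I \<Longrightarrow> 0 \<le> x i" "\<And>i. i \<in> I \<Longrightarrow> x i \<le> 1"
  shows "0 \<le> 1 - (\<Prod>i\<in>I. 1 - x i)" "1 - (\<Prod>i\<in>I. 1 - x i) \<le> 1"
  using assms by (auto intro!: prod_le_1 prod_nonneg)

context regularly_varying_tail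
begin

text \<open>The anti-clustering bound for one k, as a joint probability for large n; an existential
  takes the place of the maximum.\<close>

definition anticluster :: "(nat \<Rightarrow> real) \<Rightarrow> (nat \<Rightarrow> nat) \<Rightarrow> real \<Rightarrow> nat \<Rightarrow> real \<Rightarrow> bool" where
  "anticluster a m \<delta> k \<eta> \<longleftrightarrow> (\<forall>\<^sub>F n in sequentially.
     measure M {\<omega> \<in> space M. (\<exists>i\<in>{k..m n}. norm (X (int i) \<omega>) > \<delta> * a n) \<and> norm (X 0 \<omega>) > \<delta> * a n}
       \<le> \<eta> * tail_prob (\<delta> * a n))"

text \<open>For k > \<open>m n\<close> the maximum would range over the empty set. As
  \<open>m n\<close> tends to infinity, this is excluded for large n, and the maximum exceeds the
  level iff some term does.\<close>

lemma anticlusterI: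
  assumes m: "filterlim m at_top sequentially"
    and lim: "(\<lambda>k::nat. limsup (\<lambda>n. ereal
         (\<P>(\<omega> in M. Max ((\<lambda>i. norm (X (int i) \<omega>)) ` {k..m n}) > \<delta> * a n
              \<bar> norm (X 0 \<omega>) > \<delta> * a n)))) \<longlonglongrightarrow> 0"
    and \<eta>: "0 < \<eta>"
  shows "\<forall>\<^sub>F k in sequentially. anticluster a m \<delta> k \<eta>"
proof -
  have "\<forall>\<^sub>F k in sequentially. limsup (\<lambda>n. ereal
         (\<P>(\<omega> in M. Max ((\<lambda>i. norm (X (int i) \<omega>)) ` {k..m n}) > \<delta> * a n
              \<bar> norm (X 0 \<omega>) > \<delta> * a n))) < ereal \<eta>"
    using lim \<eta> by (intro order_tendstoD(2)) auto
  then show ?thesis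
  proof (rule eventually_mono)
    fix k assume k: "limsup (\<lambda>n. ereal (\<P>(\<omega> in M. Max ((\<lambda>i. norm (X (int i) \<omega>)) ` {k..m n}) > \<delta> * a n
              \<bar> norm (X 0 \<omega>) > \<delta> * a n))) < ereal \<eta>"
    have "\<forall>\<^sub>F n in sequentially. k \<le> m n" using m by (simp add: filterlim_at_top)
    with Limsup_lessD[OF k] show "anticluster a m \<delta> k \<eta>"
      unfolding anticluster_def
    proof eventually_elim
      case (elim n)
      have "Max ((\<lambda>i. norm (X (int i) \<omega>)) ` {k..m n}) > \<delta> * a n \<longleftrightarrow> (\<exists>i\<in>{k..m n}. norm (X (int i) \<omega>) > \<delta> * a n)" for \<omega>
        using elim(2) by (subst Max_gr_iff) auto
      then have "measure M {\<omega> \<in> space M. (\<exists>i\<in>{k..m n}. norm (X (int i) \<omega>) > \<delta> * a n) \<and> norm (X 0 \<omega>) > \<delta> * a n}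
          / tail_prob (\<delta> * a n) < \<eta>"
        using elim(1) by (simp add: cond_prob_def tail_prob_def exceed_def)
      then show ?case using tail_prob_pos[of "\<delta> * a n"] by (simp add: field_simps)
    qed
  qed
qed

text \<open>For a fixed window k..j, eventually j is at most \<open>m n\<close>, and anti-clustering
  passes to the tail process with a bound free of j; then j goes to infinity. The limit conditions
  at \<open>a n\<close> but the bound is at \<epsilon> times \<open>a n\<close>; the ratio of these
  tails yields \<open>\<epsilon> powr (-\<alpha>)\<close>.\<close>

lemma tail_exceedance_bound:
  assumes a: "(\<lambda>n. real n * tail_prob (a n)) \<longlonglongrightarrow> 1" and m: "filterlim m at_top sequentially"
    and \<epsilon>: "0 < \<epsilon>" "\<epsilon> \<le> 1" and ac: "anticluster a m \<epsilon> k \<eta>"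
  shows "measure Q {\<omega> \<in> space Q. \<exists>t\<ge>k. \<epsilon> < norm (Y (int t) \<omega>)} \<le> \<eta> * \<epsilon> powr (-\<alpha>)"
proof -
  have a_top: "filterlim a at_top sequentially" by (rule normalizing_at_top[OF a])
  \<comment> \<open>A continuous minorant of the indicator of s > \<epsilon> whose slope grows with
    j, so that widening the window and sharpening the indicator happen in a single limit.\<close>
  define \<rho> where "\<rho> j s = min 1 (real j * max 0 (s - \<epsilon>))" for j :: nat and s :: real
  have \<rho>: "0 \<le> \<rho> j s" "\<rho> j s \<le> 1" for j s by (auto simp: \<rho>_def)
  have \<rho>0: "\<rho> j s = 0" if "s \<le> \<epsilon>" for j s using that by (simp add: \<rho>_def)
  define f where "f j v = 1 - (\<Prod>t\<in>{k..j}. 1 - \<rho> j (norm (v (int t))))" for j and v :: "int \<Rightarrow> real ^ 'd"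
  have f: "window_functional (int j) (f j)" for j
    unfolding window_functional_def
  proof (intro conjI allI impI)
    show "continuous_on UNIV (f j)" unfolding f_def \<rho>_def
      by (intro continuous_intros continuous_coordinate)
    fix v w :: "int \<Rightarrow> real ^ 'd" assume "\<forall>t\<in>{- int j..int j}. v t = w t"
    then show "f j v = f j w" unfolding f_def by (intro arg_cong2[where f="(-)"] prod.cong refl) auto
  qed simp
  have fb: "0 \<le> f j v" "f j v \<le> 1" for j v
    unfolding f_def by (intro prod_one_minus_bounds \<rho>)+
  have f0: "f j v = 0" if "\<And>t. t \<in> {k..j} \<Longrightarrow> norm (v (int t)) \<le> \<epsilon>" for j v
    unfolding f_def using that by (simp add: \<rho>0)
  have Ef: "(\<integral>\<omega>. f j (\<lambda>t. Y t \<omega>) \<partial>Q) \<le> \<eta> * \<epsilon> powr (-\<alpha>)" for j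
  proof (rule tendsto_le[OF sequentially_bot])
    show "(\<lambda>n. (\<integral>\<omega>. indicator (exceed (a n)) \<omega> * f j (\<lambda>t. X t \<omega> /\<^sub>R a n) \<partial>M) / tail_prob (a n))
        \<longlonglongrightarrow> (\<integral>\<omega>. f j (\<lambda>t. Y t \<omega>) \<partial>Q)"
      by (rule filterlim_compose[OF tail_process_limit[OF f, where B=1] a_top]) (use fb in simp)
    show "(\<lambda>n. \<eta> * (tail_prob (\<epsilon> * a n) / tail_prob (a n))) \<longlonglongrightarrow> \<eta> * \<epsilon> powr (-\<alpha>)"
      by (intro tendsto_mult_left filterlim_compose[OF tail_prob_ratio[OF \<epsilon>(1)] a_top])
    have "\<forall>\<^sub>F n in sequentially. 0 < a n" using a_top by (simp add: filterlim_at_top_dense)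
    moreover have "\<forall>\<^sub>F n in sequentially. j \<le> m n" using m by (simp add: filterlim_at_top)
    moreover note ac[unfolded anticluster_def]
    ultimately show "\<forall>\<^sub>F n in sequentially. (\<integral>\<omega>. indicator (exceed (a n)) \<omega> * f j (\<lambda>t. X t \<omega> /\<^sub>R a n) \<partial>M) / tail_prob (a n)
        \<le> \<eta> * (tail_prob (\<epsilon> * a n) / tail_prob (a n))"
    proof eventually_elim
      case (elim n)
      let ?A = "{\<omega> \<in> space M. (\<exists>i\<in>{k..m n}. norm (X (int i) \<omega>) > \<epsilon> * a n) \<and> norm (X 0 \<omega>) > \<epsilon> * a n}"
      have [measurable]: "(\<lambda>\<omega>. f j (\<lambda>t. X t \<omega> /\<^sub>R a n)) \<in> borel_measurable M"
        by (rule window_functional_measurable[OF f]) measurable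
      have "(\<integral>\<omega>. indicator (exceed (a n)) \<omega> * f j (\<lambda>t. X t \<omega> /\<^sub>R a n) \<partial>M) \<le> (\<integral>\<omega>. indicator ?A \<omega> \<partial>M)"
      proof (rule integral_mono)
        show "integrable M (\<lambda>\<omega>. indicator (exceed (a n)) \<omega> * f j (\<lambda>t. X t \<omega> /\<^sub>R a n))"
          using fb by (intro M.integrable_const_bound[where B=1]) (auto simp: indicator_def)
        show "integrable M (\<lambda>\<omega>. indicator ?A \<omega> :: real)"
          by (intro integrable_real_indicator) (auto simp: less_top[symmetric])
        fix \<omega> assume \<omega>: "\<omega> \<in> space M"
        show "indicator (exceed (a n)) \<omega> * f j (\<lambda>t. X t \<omega> /\<^sub>R a n) \<le> indicator ?A \<omega>"
        proof (cases "\<omega> \<in> exceed (a n) \<and> (\<exists>t\<in>{k..j}. \<epsilon> < norm (X (int t) \<omega> /\<^sub>R a n))")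
          case True
          then obtain t where t: "t \<in> {k..j}" "\<epsilon> < norm (X (int t) \<omega> /\<^sub>R a n)" by blast
          have "\<epsilon> * a n < norm (X (int t) \<omega>)" using t(2) elim(1) by (simp add: field_simps)
          moreover have "\<epsilon> * a n \<le> 1 * a n" using \<epsilon> elim(1) by (intro mult_right_mono) auto
          then have "\<epsilon> * a n < norm (X 0 \<omega>)" using True by (simp add: exceed_def)
          ultimately have "\<omega> \<in> ?A" using \<omega> t(1) elim(2) by auto
          then show ?thesis using fb by (simp add: indicator_def)
        next
          case False
          then have "indicator (exceed (a n)) \<omega> * f j (\<lambda>t. X t \<omega> /\<^sub>R a n) = 0"
            using f0[of j "\<lambda>t. X t \<omega> /\<^sub>R a n"] by (auto simp: not_less indicator_def)
          then show ?thesis by (simp only:) (simp add: indicator_def)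
        qed
      qed
      also have "\<dots> = measure M ?A" by simp
      also have "\<dots> \<le> \<eta> * tail_prob (\<epsilon> * a n)" by (rule elim(3))
      finally show ?case using tail_prob_pos[of "a n"] by (simp add: divide_right_mono)
    qed
  qed
  let ?E = "{\<omega> \<in> space Q. \<exists>t\<ge>k. \<epsilon> < norm (Y (int t) \<omega>)}"
  have [measurable]: "(\<lambda>\<omega>. f j (\<lambda>t. Y t \<omega>)) \<in> borel_measurable Q" for j
    by (rule window_functional_measurable[OF f]) measurable
  have "(\<lambda>j. \<integral>\<omega>. f j (\<lambda>t. Y t \<omega>) \<partial>Q) \<longlonglongrightarrow> (\<integral>\<omega>. indicator ?E \<omega> \<partial>Q)"
  proof (rule integral_dominated_convergence[where w="\<lambda>_. 1"])
    show "AE \<omega> in Q. (\<lambda>j. f j (\<lambda>t. Y t \<omega>)) \<longlonglongrightarrow> indicator ?E \<omega>"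
    proof (rule AE_I2)
      fix \<omega> assume \<omega>: "\<omega> \<in> space Q"
      show "(\<lambda>j. f j (\<lambda>t. Y t \<omega>)) \<longlonglongrightarrow> indicator ?E \<omega>"
      proof (cases "\<omega> \<in> ?E")
        case True
        then obtain t where t: "k \<le> t" "\<epsilon> < norm (Y (int t) \<omega>)" by auto
        obtain J :: nat where J: "1 / (norm (Y (int t) \<omega>) - \<epsilon>) < real J" using reals_Archimedean2 by blast
        have "\<forall>\<^sub>F j in sequentially. f j (\<lambda>t. Y t \<omega>) = 1"
          using eventually_ge_at_top[of J] eventually_ge_at_top[of t]
        proof eventually_elim
          case (elim j)
          have "1 / (norm (Y (int t) \<omega>) - \<epsilon>) < real j" using J elim by linarith
          then have "1 < real j * (norm (Y (int t) \<omega>) - \<epsilon>)" using t by (simp add: field_simps)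
          then have "\<rho> j (norm (Y (int t) \<omega>)) = 1" using t by (simp add: \<rho>_def max_def)
          then have "(\<Prod>t\<in>{k..j}. 1 - \<rho> j (norm (Y (int t) \<omega>))) = 0"
            using t(1) elim by (intro prod_zero) auto
          then show ?case by (simp add: f_def)
        qed
        then have "(\<lambda>j. f j (\<lambda>t. Y t \<omega>)) \<longlonglongrightarrow> 1" by (rule tendsto_eventually)
        then show ?thesis using True by simp
      next
        case False
        then have "f j (\<lambda>t. Y t \<omega>) = 0" for j using \<omega> by (intro f0) (auto simp: not_less)
        then show ?thesis using False by simp
      qed
    qed
  qed (use fb in auto)
  then have "(\<lambda>j. \<integral>\<omega>. f j (\<lambda>t. Y t \<omega>) \<partial>Q) \<longlonglongrightarrow> measure Q ?E" by simp
  then show ?thesis by (rule LIMSEQ_le_const2) (use Ef in blast)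
qed

text \<open>This turns the series of the limit formula into finite sums almost surely. Infinitely
  many exceedances of \<epsilon> have probability at most
  \<open>\<eta> * \<epsilon> powr (-\<alpha>)\<close> for every \<eta> > 0, hence 0, and countably
  many thresholds suffice.\<close>

lemma tail_process_tendsto_0:
  assumes a: "(\<lambda>n. real n * tail_prob (a n)) \<longlonglongrightarrow> 1" and m: "filterlim m at_top sequentially"
    and ac: "\<And>\<delta> \<eta>. 0 < \<delta> \<Longrightarrow> 0 < \<eta> \<Longrightarrow> \<forall>\<^sub>F k in sequentially. anticluster a m \<delta> k \<eta>"
  shows "AE \<omega> in Q. (\<lambda>t. Y (int t) \<omega>) \<longlonglongrightarrow> 0"
proof -
  have null: "AE \<omega> in Q. \<not> (\<forall>k. \<exists>t\<ge>k. 1 / real (Suc i) < norm (Y (int t) \<omega>))" for i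
  proof -
    define \<epsilon> where "\<epsilon> = 1 / real (Suc i)"
    have \<epsilon>: "0 < \<epsilon>" "\<epsilon> \<le> 1" by (auto simp: \<epsilon>_def)
    let ?E = "{\<omega> \<in> space Q. \<forall>k. \<exists>t\<ge>k. \<epsilon> < norm (Y (int t) \<omega>)}"
    have "measure Q ?E \<le> 0 + e" if "0 < e" for e
    proof -
      have "0 < e / \<epsilon> powr (-\<alpha>)" using that \<epsilon> by simp
      from eventually_happens[OF ac[OF \<epsilon>(1) this]] obtain k
        where k: "anticluster a m \<epsilon> k (e / \<epsilon> powr (-\<alpha>))" by auto
      have "measure Q ?E \<le> measure Q {\<omega> \<in> space Q. \<exists>t\<ge>k. \<epsilon> < norm (Y (int t) \<omega>)}"
        by (rule Q.finite_measure_mono) auto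
      also have "\<dots> \<le> e / \<epsilon> powr (-\<alpha>) * \<epsilon> powr (-\<alpha>)"
        by (rule tail_exceedance_bound[OF a m \<epsilon> k])
      finally show ?thesis using \<epsilon> by simp
    qed
    then have "measure Q ?E \<le> 0" by (rule field_le_epsilon)
    then have "measure Q ?E = 0" by (simp add: measure_le_0_iff)
    then have "AE \<omega> in Q. \<not> (\<forall>k. \<exists>t\<ge>k. \<epsilon> < norm (Y (int t) \<omega>))"
      by (subst Q.prob_Collect_eq_0[symmetric]) auto
    then show ?thesis by (simp add: \<epsilon>_def)
  qed
  then have "AE \<omega> in Q. \<forall>i. \<not> (\<forall>k. \<exists>t\<ge>k. 1 / real (Suc i) < norm (Y (int t) \<omega>))"
    by (subst AE_all_countable) blast
  then show ?thesis
  proof eventually_elim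
    case (elim \<omega>)
    show ?case
    proof (rule LIMSEQ_I)
      fix r :: real assume "0 < r"
      then obtain i where i: "1 / real (Suc i) < r" using reals_Archimedean by (auto simp: inverse_eq_divide)
      obtain k where "\<forall>t\<ge>k. norm (Y (int t) \<omega>) \<le> 1 / real (Suc i)" using elim by (auto simp: not_less)
      then show "\<exists>no. \<forall>n\<ge>no. norm (Y (int n) \<omega> - 0) < r" using i by (auto intro: le_less_trans)
    qed
  qed
qed

end

text \<open>With x = 1 - s, the quadratic error in K ln (1 - x) is of order K x^2 = (K x) x, which
  vanishes because K x converges while K grows.\<close>

lemma power_tendsto_exp:
  fixes s :: "nat \<Rightarrow> real" and K :: "nat \<Rightarrow> nat"
  assumes K: "filterlim K at_top sequentially" and s: "\<And>n. s n \<le> 1"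
    and lim: "(\<lambda>n. real (K n) * (1 - s n)) \<longlonglongrightarrow> I"
  shows "(\<lambda>n. s n ^ K n) \<longlonglongrightarrow> exp (- I)"
proof -
  have realK: "filterlim (\<lambda>n. real (K n)) at_top sequentially"
    using K by (rule filterlim_compose[OF filterlim_real_sequentially])
  have "(\<lambda>n. (real (K n) * (1 - s n)) * inverse (real (K n))) \<longlonglongrightarrow> I * 0"
    by (intro tendsto_mult lim tendsto_inverse_0_at_top realK)
  moreover have "\<forall>\<^sub>F n in sequentially. (real (K n) * (1 - s n)) * inverse (real (K n)) = 1 - s n"
    using realK[unfolded filterlim_at_top_dense, rule_format, of 0] by eventually_elim simp
  ultimately have x0: "(\<lambda>n. 1 - s n) \<longlonglongrightarrow> 0"
    using Lim_transform_eventually by fastforce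
  have small: "\<forall>\<^sub>F n in sequentially. 1 - s n < 1 / 2"
    using order_tendstoD(2)[OF x0, of "1/2"] by simp
  have err: "(\<lambda>n. real (K n) * ln (s n) + real (K n) * (1 - s n)) \<longlonglongrightarrow> 0"
  proof (rule Lim_null_comparison)
    show "\<forall>\<^sub>F n in sequentially. norm (real (K n) * ln (s n) + real (K n) * (1 - s n)) \<le> 2 * (real (K n) * (1 - s n)) * (1 - s n)"
      using small
    proof eventually_elim
      case (elim n)
      have "\<bar>ln (1 + - (1 - s n)) - - (1 - s n)\<bar> \<le> 2 * (- (1 - s n))\<^sup>2"
        using elim s[of n] by (intro abs_ln_one_plus_x_minus_x_bound) auto
      then have "\<bar>ln (s n) + (1 - s n)\<bar> \<le> 2 * (1 - s n)\<^sup>2" by (simp add: power2_eq_square algebra_simps)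
      then have "real (K n) * \<bar>ln (s n) + (1 - s n)\<bar> \<le> real (K n) * (2 * (1 - s n)\<^sup>2)"
        by (rule mult_left_mono) simp
      moreover have "norm (real (K n) * ln (s n) + real (K n) * (1 - s n)) = real (K n) * \<bar>ln (s n) + (1 - s n)\<bar>"
        by (simp add: abs_mult distrib_left[symmetric])
      moreover have "real (K n) * (2 * (1 - s n)\<^sup>2) = 2 * (real (K n) * (1 - s n)) * (1 - s n)"
        by (simp only: power2_eq_square ac_simps)
      ultimately show ?case by linarith
    qed
    have "(\<lambda>n. 2 * (real (K n) * (1 - s n)) * (1 - s n)) \<longlonglongrightarrow> 2 * I * 0"
      by (intro tendsto_mult tendsto_const lim x0)
    then show "(\<lambda>n. 2 * (real (K n) * (1 - s n)) * (1 - s n)) \<longlonglongrightarrow> 0" by simp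
  qed
  have "(\<lambda>n. (real (K n) * ln (s n) + real (K n) * (1 - s n)) - real (K n) * (1 - s n)) \<longlonglongrightarrow> 0 - I"
    by (intro tendsto_diff err lim)
  then have "(\<lambda>n. exp (real (K n) * ln (s n))) \<longlonglongrightarrow> exp (- I)"
    by (intro tendsto_exp) simp
  moreover have "\<forall>\<^sub>F n in sequentially. exp (real (K n) * ln (s n)) = s n ^ K n"
    using small by eventually_elim (simp add: exp_of_nat_mult)
  ultimately show ?thesis by (rule Lim_transform_eventually)
qed

text \<open>The leftover \<open>n mod m n\<close> is less than \<open>m n\<close>, which is of
  smaller order than n.\<close>

lemma blocks_fill:
  fixes m :: "nat \<Rightarrow> nat"
  assumes m: "filterlim m at_top sequentially" and o: "(\<lambda>n. real (m n)) \<in> o(\<lambda>n. real n)"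
  shows "(\<lambda>n. real (n div m n) * real (m n) / real n) \<longlonglongrightarrow> 1"
    and "filterlim (\<lambda>n. n div m n) at_top sequentially"
proof -
  have mn: "(\<lambda>n. real (m n) / real n) \<longlonglongrightarrow> 0"
    using o by (rule smalloD_tendsto)
  have pos: "\<forall>\<^sub>F n in sequentially. 1 \<le> m n" using m by (simp add: filterlim_at_top)
  have "(\<lambda>n. 1 - real (n mod m n) / real n) \<longlonglongrightarrow> 1 - 0"
  proof (intro tendsto_diff tendsto_const Lim_null_comparison[OF _ mn])
    show "\<forall>\<^sub>F n in sequentially. norm (real (n mod m n) / real n) \<le> real (m n) / real n"
      using pos by eventually_elim (simp add: divide_right_mono less_imp_le)
  qed
  moreover have "\<forall>\<^sub>F n in sequentially. 1 - real (n mod m n) / real n = real (n div m n) * real (m n) / real n"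
    using eventually_gt_at_top[of 0]
  proof eventually_elim
    case (elim n)
    have "real (n div m n * m n + n mod m n) = real n" by (simp only: div_mult_mod_eq)
    then have "real (n div m n) * real (m n) + real (n mod m n) = real n"
      by (simp only: of_nat_add of_nat_mult)
    then show ?case using elim by (simp add: field_simps)
  qed
  ultimately show "(\<lambda>n. real (n div m n) * real (m n) / real n) \<longlonglongrightarrow> 1"
    using Lim_transform_eventually by fastforce
  show "filterlim (\<lambda>n. n div m n) at_top sequentially"
    unfolding filterlim_at_top
  proof
    fix Z :: nat
    have "0 < 1 / (real Z + 1)" by simp
    from order_tendstoD(2)[OF mn this] pos eventually_gt_at_top[of 0]
    show "\<forall>\<^sub>F n in sequentially. Z \<le> n div m n"
    proof eventually_elim
      case (elim n)
      have "(real Z + 1) * real (m n) < real n" using elim by (simp add: field_simps)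
      then have "real (Z * m n) \<le> real n" by (simp add: algebra_simps)
      then have "Z * m n \<le> n" by (simp only: of_nat_le_iff)
      then show ?case using elim by (simp add: less_eq_div_iff_mult_less_eq)
    qed
  qed
qed

text \<open>The dominating function for the limit in k; starting at \<delta> avoids the singularity
  at 0.\<close>

lemma tail_density_integrable:
  assumes "0 < \<alpha>" "0 < \<delta>"
  shows "integrable lborel (\<lambda>s. indicator {\<delta>..} s * (\<alpha> * s powr (-\<alpha> - 1)) :: real)"
proof (rule integrableI_nonneg)
  have deriv: "((\<lambda>y. - (y powr (-\<alpha>))) has_real_derivative \<alpha> * y powr (-\<alpha> - 1)) (at y)" if "\<delta> \<le> y" for y
    using that assms by (auto intro!: derivative_eq_intros)
  have "((\<lambda>y::real. - (y powr (-\<alpha>))) \<longlongrightarrow> - 0) at_top"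
    using assms by (intro tendsto_minus tendsto_neg_powr filterlim_ident) auto
  then have "(\<integral>\<^sup>+y. ennreal (\<alpha> * y powr (-\<alpha> - 1)) * indicator {\<delta>..} y \<partial>lborel) = 0 - (- (\<delta> powr (-\<alpha>)))"
    using assms deriv by (intro nn_integral_FTC_atLeast) auto
  moreover have "ennreal (indicator {\<delta>..} s * (\<alpha> * s powr (-\<alpha> - 1))) = ennreal (\<alpha> * s powr (-\<alpha> - 1)) * indicator {\<delta>..} s" for s
    by (simp add: indicator_def)
  ultimately show "(\<integral>\<^sup>+s. ennreal (indicator {\<delta>..} s * (\<alpha> * s powr (-\<alpha> - 1))) \<partial>lborel) < \<infinity>"
    by simp
qed (use assms in \<open>auto simp: indicator_def\<close>)

section \<open>The Laplace functional of one block\<close>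

context regularly_varying_tail
begin

text \<open>By stationarity, one minus the Laplace functional of a block telescopes into the expectations
  of these functionals.\<close>

definition cluster :: "(real ^ 'd \<Rightarrow> real) \<Rightarrow> nat \<Rightarrow> (int \<Rightarrow> real ^ 'd) \<Rightarrow> real" where
  "cluster G k v = (1 - exp (- G (v 0))) * exp (- (\<Sum>t=1..k. G (v (int t))))"

lemma cluster_bounds:
  assumes "\<And>x. 0 \<le> G x"
  shows "0 \<le> cluster G k v" "cluster G k v \<le> 1"
  using assms by (auto simp: cluster_def sum_nonneg intro!: mult_le_one)

lemma cluster_zero: "G (v 0) = 0 \<Longrightarrow> cluster G k v = 0"
  by (simp add: cluster_def)

lemma cluster_antimono:
  assumes "\<And>x. 0 \<le> G x" "k \<le> l"
  shows "cluster G l v \<le> cluster G k v"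
proof -
  have "(\<Sum>t=1..k. G (v (int t))) \<le> (\<Sum>t=1..l. G (v (int t)))"
    using assms by (intro sum_mono2) auto
  then show ?thesis unfolding cluster_def using assms(1) by (intro mult_left_mono) auto
qed

lemma window_cluster:
  assumes "continuous_on UNIV G"
  shows "window_functional (int k) (cluster G k)"
  unfolding window_functional_def
proof (intro conjI allI impI)
  show "continuous_on UNIV (cluster G k)"
    unfolding cluster_def
    by (intro continuous_intros continuous_on_compose2[OF assms] continuous_coordinate) auto
  fix v w :: "int \<Rightarrow> real ^ 'd" assume vw: "\<forall>t\<in>{- int k..int k}. v t = w t"
  have "(\<Sum>t=1..k. G (v (int t))) = (\<Sum>t=1..k. G (w (int t)))" using vw by (intro sum.cong) auto
  then show "cluster G k v = cluster G k w" using vw by (simp add: cluster_def)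
qed simp

text \<open>\<open>cluster G l\<close> is the exponential of the sum over times 1..l minus that over
  0..l. Stationarity shifts the latter to 1..l + 1, and the differences telescope.\<close>

lemma one_minus_laplace:
  assumes stat: "strictly_stationary M X" and G: "continuous_on UNIV G" "\<And>x. 0 \<le> G x"
  shows "1 - (\<integral>\<omega>. exp (- (\<Sum>t=1..j. G (X (int t) \<omega> /\<^sub>R c))) \<partial>M) =
    (\<Sum>l<j. \<integral>\<omega>. cluster G l (\<lambda>t. X t \<omega> /\<^sub>R c) \<partial>M)"
proof -
  have [measurable]: "G \<in> borel_measurable borel" using G(1) by (rule borel_measurable_continuous_onI)
  define S where "S j = (\<integral>\<omega>. exp (- (\<Sum>t=1..j. G (X (int t) \<omega> /\<^sub>R c))) \<partial>M)" for j :: nat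
  have "(\<integral>\<omega>. cluster G l (\<lambda>t. X t \<omega> /\<^sub>R c) \<partial>M) = S l - S (Suc l)" for l
  proof -
    let ?f = "\<lambda>v :: int \<Rightarrow> real ^ 'd. exp (- (\<Sum>t=0..l. G (v (int t) /\<^sub>R c)))"
    have int1: "integrable M (\<lambda>\<omega>. exp (- (\<Sum>t=1..l. G (X (int t) \<omega> /\<^sub>R c))))"
      and int0: "integrable M (\<lambda>\<omega>. exp (- (\<Sum>t=0..l. G (X (int t) \<omega> /\<^sub>R c))))"
      by (auto intro!: M.integrable_const_bound[where B=1] AE_I2 sum_nonneg G(2))
    have "cluster G l (\<lambda>t. X t \<omega> /\<^sub>R c) = exp (- (\<Sum>t=1..l. G (X (int t) \<omega> /\<^sub>R c))) - exp (- (\<Sum>t=0..l. G (X (int t) \<omega> /\<^sub>R c)))" for \<omega>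
    proof -
      have "(\<Sum>t=0..l. G (X (int t) \<omega> /\<^sub>R c)) = G (X 0 \<omega> /\<^sub>R c) + (\<Sum>t=1..l. G (X (int t) \<omega> /\<^sub>R c))"
        by (simp add: sum.atLeast_Suc_atMost)
      moreover have "exp (- (p + q)) = exp (- p) * exp (- q)" for p q :: real
        by (simp only: minus_add_distrib exp_add)
      ultimately show ?thesis by (simp only: cluster_def left_diff_distrib mult_1)
    qed
    then have "(\<integral>\<omega>. cluster G l (\<lambda>t. X t \<omega> /\<^sub>R c) \<partial>M) = S l - (\<integral>\<omega>. ?f (\<lambda>t. X t \<omega>) \<partial>M)"
      by (simp only: S_def Bochner_Integration.integral_diff[OF int1 int0])
    also have "(\<integral>\<omega>. ?f (\<lambda>t. X t \<omega>) \<partial>M) = (\<integral>\<omega>. ?f (\<lambda>t. X (t + 1) \<omega>) \<partial>M)"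
      by (rule stationary_expectation[OF X stat, symmetric]) measurable
    also have "(\<integral>\<omega>. ?f (\<lambda>t. X (t + 1) \<omega>) \<partial>M) = S (Suc l)"
    proof -
      have "(\<Sum>t=0..l. G (X (int t + 1) \<omega> /\<^sub>R c)) = (\<Sum>t=1..Suc l. G (X (int t) \<omega> /\<^sub>R c))" for \<omega>
        using sum.shift_bounds_cl_Suc_ivl[of "\<lambda>t. G (X (int t) \<omega> /\<^sub>R c)" 0 l] by (simp add: add.commute)
      then show ?thesis by (simp only: S_def)
    qed
    finally show ?thesis .
  qed
  then have "(\<Sum>l<j. \<integral>\<omega>. cluster G l (\<lambda>t. X t \<omega> /\<^sub>R c) \<partial>M) = (\<Sum>l<j. S l - S (Suc l))" by simp
  also have "\<dots> = S 0 - S j" by (rule sum_lessThan_telescope')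
  finally show ?thesis by (simp add: S_def M.prob_space)
qed

text \<open>Each telescoped term is compared with the one of index k. For l < k both lie between 0
  and the tail at \<delta> c, which makes at most k errors of that size. For larger l they differ
  only if, besides time 0, some time between k and j has an exceedance, and \<open>ac\<close> bounds
  that event.\<close>

lemma block_estimate:
  assumes stat: "strictly_stationary M X" and G: "continuous_on UNIV G" "\<And>x. 0 \<le> G x"
    and \<delta>: "0 < \<delta>" "\<And>x. norm x \<le> \<delta> \<Longrightarrow> G x = 0" and c: "0 < c"
    and ac: "measure M {\<omega> \<in> space M. (\<exists>i\<in>{k..j}. norm (X (int i) \<omega>) > \<delta> * c) \<and> norm (X 0 \<omega>) > \<delta> * c}
       \<le> \<eta> * tail_prob (\<delta> * c)" and \<eta>: "0 < \<eta>"
  shows "\<bar>(1 - (\<integral>\<omega>. exp (- (\<Sum>t=1..j. G (X (int t) \<omega> /\<^sub>R c))) \<partial>M)) -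
      real j * (\<integral>\<omega>. cluster G k (\<lambda>t. X t \<omega> /\<^sub>R c) \<partial>M)\<bar> \<le> (real k + real j * \<eta>) * tail_prob (\<delta> * c)"
proof -
  define e where "e l = (\<integral>\<omega>. cluster G l (\<lambda>t. X t \<omega> /\<^sub>R c) \<partial>M)" for l
  let ?p = "tail_prob (\<delta> * c)"
  let ?A = "{\<omega> \<in> space M. (\<exists>i\<in>{k..j}. norm (X (int i) \<omega>) > \<delta> * c) \<and> norm (X 0 \<omega>) > \<delta> * c}"
  have [measurable]: "(\<lambda>\<omega>. cluster G l (\<lambda>t. X t \<omega> /\<^sub>R c)) \<in> borel_measurable M" for l
    by (rule window_functional_measurable[OF window_cluster[OF G(1)]]) measurable
  have int: "integrable M (\<lambda>\<omega>. cluster G l (\<lambda>t. X t \<omega> /\<^sub>R c))" for l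
    using cluster_bounds[of G, OF G(2)] by (intro M.integrable_const_bound[where B=1]) auto
  have Gz: "G (X t \<omega> /\<^sub>R c) = 0" if "\<not> \<delta> * c < norm (X t \<omega>)" for t \<omega>
    using that c by (intro \<delta>(2)) (simp add: field_simps)
  have e0: "0 \<le> e l" for l
    unfolding e_def by (intro Bochner_Integration.integral_nonneg cluster_bounds G)
  have ep: "e l \<le> ?p" for l
  proof -
    have "e l \<le> (\<integral>\<omega>. indicator (exceed (\<delta> * c)) \<omega> \<partial>M)"
      unfolding e_def
    proof (rule integral_mono[OF int])
      show "integrable M (\<lambda>\<omega>. indicator (exceed (\<delta> * c)) \<omega> :: real)"
        by (intro integrable_real_indicator) (auto simp: less_top[symmetric])
      show "cluster G l (\<lambda>t. X t \<omega> /\<^sub>R c) \<le> indicator (exceed (\<delta> * c)) \<omega>" if "\<omega> \<in> space M" for \<omega>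
        using that cluster_bounds[of G, OF G(2)] cluster_zero[of G "\<lambda>t. X t \<omega> /\<^sub>R c" l] Gz[of 0 \<omega>]
        by (cases "\<omega> \<in> exceed (\<delta> * c)") (auto simp: exceed_def)
    qed
    then show ?thesis by (simp add: tail_prob_def)
  qed
  have close: "\<bar>e l - e k\<bar> \<le> \<eta> * ?p" if l: "k \<le> l" "l < j" for l
  proof -
    have "e l \<le> e k" unfolding e_def
      by (intro integral_mono int cluster_antimono G l)
    moreover have "e k - e l \<le> measure M ?A"
    proof -
      have "e k - e l = (\<integral>\<omega>. cluster G k (\<lambda>t. X t \<omega> /\<^sub>R c) - cluster G l (\<lambda>t. X t \<omega> /\<^sub>R c) \<partial>M)"
        unfolding e_def by (rule Bochner_Integration.integral_diff[OF int int, symmetric])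
      also have "\<dots> \<le> (\<integral>\<omega>. indicator ?A \<omega> \<partial>M)"
      proof (rule integral_mono)
        show "integrable M (\<lambda>\<omega>. cluster G k (\<lambda>t. X t \<omega> /\<^sub>R c) - cluster G l (\<lambda>t. X t \<omega> /\<^sub>R c))"
          by (intro Bochner_Integration.integrable_diff int)
        show "integrable M (\<lambda>\<omega>. indicator ?A \<omega> :: real)"
          by (intro integrable_real_indicator) (auto simp: less_top[symmetric])
        fix \<omega> assume \<omega>: "\<omega> \<in> space M"
        show "cluster G k (\<lambda>t. X t \<omega> /\<^sub>R c) - cluster G l (\<lambda>t. X t \<omega> /\<^sub>R c) \<le> indicator ?A \<omega>"
        proof (cases "\<omega> \<in> ?A")
          case True
          moreover have "cluster G k v - cluster G l v \<le> 1" for v :: "int \<Rightarrow> real ^ 'd"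
            using cluster_bounds(2)[of G k v, OF G(2)] cluster_bounds(1)[of G l v, OF G(2)] by linarith
          ultimately show ?thesis by (simp only: indicator_simps)
        next
          case False
          have "cluster G k (\<lambda>t. X t \<omega> /\<^sub>R c) = cluster G l (\<lambda>t. X t \<omega> /\<^sub>R c)"
          proof (cases "\<delta> * c < norm (X 0 \<omega>)")
            case True
            then have "G (X (int t) \<omega> /\<^sub>R c) = 0" if "t \<in> {1..l} - {1..k}" for t
              using that False \<omega> l by (intro Gz) force
            then have "(\<Sum>t=1..k. G (X (int t) \<omega> /\<^sub>R c)) = (\<Sum>t=1..l. G (X (int t) \<omega> /\<^sub>R c))"
              using l by (intro sum.mono_neutral_left) auto
            then show ?thesis by (simp add: cluster_def)
          next
            case False
            then show ?thesis using Gz[of 0 \<omega>] by (simp add: cluster_zero)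
          qed
          then show ?thesis by simp
        qed
      qed
      finally show ?thesis by simp
    qed
    ultimately show ?thesis using ac by linarith
  qed
  have p0: "0 \<le> ?p" by (rule tail_prob_nonneg)
  have "\<bar>(\<Sum>l<j. e l) - real j * e k\<bar> = \<bar>\<Sum>l<j. e l - e k\<bar>" by (simp add: sum_subtractf)
  also have "\<dots> \<le> (\<Sum>l<j. \<bar>e l - e k\<bar>)" by (rule sum_abs)
  also have "\<dots> \<le> (\<Sum>l<j. of_bool (l < k) * ?p + \<eta> * ?p)"
  proof (rule sum_mono)
    fix l assume "l \<in> {..<j}"
    then show "\<bar>e l - e k\<bar> \<le> of_bool (l < k) * ?p + \<eta> * ?p"
      using close[of l] e0[of l] e0[of k] ep[of l] ep[of k] mult_nonneg_nonneg[OF less_imp_le[OF \<eta>] p0]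
      by (cases "l < k") (auto simp: not_less)
  qed
  also have "\<dots> = (\<Sum>l<j. of_bool (l < k)) * ?p + real j * \<eta> * ?p"
    by (simp add: sum.distrib sum_distrib_right)
  also have "(\<Sum>l<j. of_bool (l < k) :: real) \<le> real k"
  proof -
    have "(\<Sum>l<j. of_bool (l < k) :: real) = (\<Sum>l\<in>{..<j} \<inter> {..<k}. 1)"
      by (rule sum.mono_neutral_cong_right) auto
    also have "\<dots> = real (card ({..<j} \<inter> {..<k}))" by simp
    also have "\<dots> \<le> real (card {..<k})" by (intro of_nat_mono card_mono) auto
    finally show ?thesis by simp
  qed
  finally show ?thesis
    using p0 one_minus_laplace[OF stat G, where j=j and c=c] by (simp add: e_def distrib_right mult_right_mono)
qed

text \<open>Number of blocks times block length times the tail at \<delta> \<open>a n\<close> tends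
  to \<open>\<delta> powr (-\<alpha>)\<close>; the cluster expectation divided by this tail is a
  conditional expectation with a known limit. Conditioning at \<delta> \<open>a n\<close> captures
  every point at which G is nonzero.\<close>

lemma blocks_laplace_limit:
  assumes stat: "strictly_stationary M X" and G: "continuous_on UNIV G" "\<And>x. 0 \<le> G x"
    and \<delta>: "0 < \<delta>" "\<And>x. norm x \<le> \<delta> \<Longrightarrow> G x = 0"
    and a: "(\<lambda>n. real n * tail_prob (a n)) \<longlonglongrightarrow> 1"
    and m: "filterlim m at_top sequentially" "(\<lambda>n. real (m n)) \<in> o(\<lambda>n. real n)"
    and ac: "\<And>\<eta>. 0 < \<eta> \<Longrightarrow> \<forall>\<^sub>F k in sequentially. anticluster a m \<delta> k \<eta>"
    and I: "(\<lambda>k. \<delta> powr (-\<alpha>) * (\<integral>\<omega>. cluster G k (\<lambda>t. \<delta> *\<^sub>R Y t \<omega>) \<partial>Q)) \<longlonglongrightarrow> I"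
  shows "(\<lambda>n. real (n div m n) * (1 - (\<integral>\<omega>. exp (- (\<Sum>t=1..m n. G (X (int t) \<omega> /\<^sub>R a n))) \<partial>M))) \<longlonglongrightarrow> I"
proof (rule tendstoI)
  fix \<epsilon> :: real assume \<epsilon>: "0 < \<epsilon>"
  define D where "D = \<delta> powr (-\<alpha>)"
  have D: "0 < D" using \<delta> by (simp add: D_def)
  \<comment> \<open>The block error then tends to D \<eta> = \<epsilon> / 4, within its share
    \<epsilon> / 2; shares of \<epsilon> / 4 are left for the limit in n and for the choice of
    k.\<close>
  define \<eta> where "\<eta> = \<epsilon> / (4 * D)"
  have \<eta>: "0 < \<eta>" using \<epsilon> D by (simp add: \<eta>_def)
  define C where "C k = (\<integral>\<omega>. cluster G k (\<lambda>t. \<delta> *\<^sub>R Y t \<omega>) \<partial>Q)" for k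
  have "\<forall>\<^sub>F k in sequentially. \<bar>D * C k - I\<bar> < \<epsilon> / 4"
    using tendstoD[OF I, of "\<epsilon> / 4"] \<epsilon> by (simp add: D_def C_def dist_real_def)
  from eventually_happens[OF eventually_conj[OF this ac[OF \<eta>]]] obtain k
    where k: "\<bar>D * C k - I\<bar> < \<epsilon> / 4" "anticluster a m \<delta> k \<eta>" by auto
  let ?p = "\<lambda>n. tail_prob (\<delta> * a n)"
  let ?K = "\<lambda>n. real (n div m n)"
  let ?e = "\<lambda>n. \<integral>\<omega>. cluster G k (\<lambda>t. X t \<omega> /\<^sub>R a n) \<partial>M"
  have a_top: "filterlim a at_top sequentially" by (rule normalizing_at_top[OF a])
  then have a_pos: "\<forall>\<^sub>F n in sequentially. 0 < a n" by (simp add: filterlim_at_top_dense)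
  have Kmp: "(\<lambda>n. ?K n * real (m n) * ?p n) \<longlonglongrightarrow> D"
  proof -
    have "(\<lambda>n. (?K n * real (m n) / real n) * (real n * ?p n)) \<longlonglongrightarrow> 1 * D"
      unfolding D_def by (intro tendsto_mult blocks_fill[OF m] normalizing_scaled[OF a \<delta>(1)])
    moreover have "\<forall>\<^sub>F n in sequentially. (?K n * real (m n) / real n) * (real n * ?p n) = ?K n * real (m n) * ?p n"
      using eventually_gt_at_top[of 0] by eventually_elim simp
    ultimately show ?thesis using Lim_transform_eventually by fastforce
  qed
  \<comment> \<open>The indicator of the exceedance can be inserted since \<open>cluster\<close>
    vanishes off it, and the inner factor \<delta> turns normalisation by \<delta>
    \<open>a n\<close> into normalisation by \<open>a n\<close>.\<close>
  have ratio: "(\<lambda>n. ?e n / ?p n) \<longlonglongrightarrow> C k"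
  proof -
    let ?f = "\<lambda>v. cluster G k (\<lambda>t. \<delta> *\<^sub>R v t)"
    have f: "window_functional (int k) ?f"
      by (rule window_functional_compose[OF window_cluster[OF G(1)]]) auto
    have "filterlim (\<lambda>n. \<delta> * a n) at_top sequentially"
      by (rule filterlim_tendsto_pos_mult_at_top[OF tendsto_const \<delta>(1) a_top])
    from filterlim_compose[OF tail_process_limit[OF f, of 1] this]
    have "(\<lambda>n. (\<integral>\<omega>. indicator (exceed (\<delta> * a n)) \<omega> * ?f (\<lambda>t. X t \<omega> /\<^sub>R (\<delta> * a n)) \<partial>M) / ?p n) \<longlonglongrightarrow> C k"
      unfolding C_def using cluster_bounds[of G, OF G(2)] by simp
    moreover have "\<forall>\<^sub>F n in sequentially. (\<integral>\<omega>. indicator (exceed (\<delta> * a n)) \<omega> * ?f (\<lambda>t. X t \<omega> /\<^sub>R (\<delta> * a n)) \<partial>M) / ?p n = ?e n / ?p n"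
      using a_pos
    proof eventually_elim
      case (elim n)
      have sc: "\<delta> *\<^sub>R (v /\<^sub>R (\<delta> * a n)) = v /\<^sub>R a n" for v :: "real ^ 'd"
      proof -
        have "\<delta> * inverse (\<delta> * a n) = inverse (a n)" using \<delta>(1) by simp
        then show ?thesis by (simp only: scaleR_scaleR)
      qed
      have "indicator (exceed (\<delta> * a n)) \<omega> * ?f (\<lambda>t. X t \<omega> /\<^sub>R (\<delta> * a n)) = cluster G k (\<lambda>t. X t \<omega> /\<^sub>R a n)"
        if "\<omega> \<in> space M" for \<omega>
      proof (cases "\<omega> \<in> exceed (\<delta> * a n)")
        case True
        then show ?thesis by (simp only: sc indicator_simps mult_1)
      next
        case False
        then have "norm (X 0 \<omega>) \<le> \<delta> * a n" using that by (simp add: exceed_def)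
        then have "G (X 0 \<omega> /\<^sub>R a n) = 0" using elim by (intro \<delta>(2)) (simp add: field_simps)
        then have "cluster G k (\<lambda>t. X t \<omega> /\<^sub>R a n) = 0" by (rule cluster_zero)
        with False show ?thesis by simp
      qed
      then show ?case by (metis (no_types, lifting) Bochner_Integration.integral_cong)
    qed
    ultimately show ?thesis by (rule Lim_transform_eventually)
  qed
  have main: "(\<lambda>n. ?K n * real (m n) * ?e n) \<longlonglongrightarrow> D * C k"
  proof -
    have "(\<lambda>n. (?K n * real (m n) * ?p n) * (?e n / ?p n)) \<longlonglongrightarrow> D * C k"
      by (intro tendsto_mult Kmp ratio)
    moreover have "tail_prob x \<noteq> 0" for x using tail_prob_pos[of x] by simp
    ultimately show ?thesis by (simp add: mult.assoc)
  qed
  \<comment> \<open>The k terms without anti-clustering are negligible: relative to a block of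
    length \<open>m n\<close> they have weight k / \<open>m n\<close>.\<close>
  have err: "(\<lambda>n. ?K n * ((real k + real (m n) * \<eta>) * ?p n)) \<longlonglongrightarrow> D * (real k * 0 + \<eta>)"
  proof -
    have "filterlim (\<lambda>n. real (m n)) at_top sequentially"
      using m(1) by (rule filterlim_compose[OF filterlim_real_sequentially])
    then have "(\<lambda>n. (?K n * real (m n) * ?p n) * (real k * inverse (real (m n)) + \<eta>)) \<longlonglongrightarrow> D * (real k * 0 + \<eta>)"
      by (intro tendsto_mult Kmp tendsto_add tendsto_const tendsto_inverse_0_at_top)
    moreover have "\<forall>\<^sub>F n in sequentially. 1 \<le> m n" using m(1) by (simp add: filterlim_at_top)
    then have "\<forall>\<^sub>F n in sequentially. (?K n * real (m n) * ?p n) * (real k * inverse (real (m n)) + \<eta>) =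
        ?K n * ((real k + real (m n) * \<eta>) * ?p n)"
      by eventually_elim (simp add: field_simps)
    ultimately show ?thesis by (rule Lim_transform_eventually)
  qed
  have "D * (real k * 0 + \<eta>) < \<epsilon> / 2" using D \<epsilon> by (simp add: \<eta>_def)
  from order_tendstoD(2)[OF err this]
  have ev1: "\<forall>\<^sub>F n in sequentially. ?K n * ((real k + real (m n) * \<eta>) * ?p n) < \<epsilon> / 2" .
  have ev2: "\<forall>\<^sub>F n in sequentially. \<bar>?K n * real (m n) * ?e n - D * C k\<bar> < \<epsilon> / 4"
    using tendstoD[OF main, of "\<epsilon> / 4"] \<epsilon> by (simp add: dist_real_def)
  show "\<forall>\<^sub>F n in sequentially. dist (?K n * (1 - (\<integral>\<omega>. exp (- (\<Sum>t=1..m n. G (X (int t) \<omega> /\<^sub>R a n))) \<partial>M))) I < \<epsilon>"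
    using ev1 ev2 a_pos k(2)[unfolded anticluster_def]
  proof eventually_elim
    case (elim n)
    define L where "L = 1 - (\<integral>\<omega>. exp (- (\<Sum>t=1..m n. G (X (int t) \<omega> /\<^sub>R a n))) \<partial>M)"
    have "\<bar>L - real (m n) * ?e n\<bar> \<le> (real k + real (m n) * \<eta>) * ?p n"
      unfolding L_def by (rule block_estimate[OF stat G \<delta> elim(3,4) \<eta>])
    then have "?K n * \<bar>L - real (m n) * ?e n\<bar> \<le> ?K n * ((real k + real (m n) * \<eta>) * ?p n)"
      by (rule mult_left_mono) simp
    moreover have "?K n * \<bar>L - real (m n) * ?e n\<bar> = \<bar>?K n * L - ?K n * real (m n) * ?e n\<bar>"
    proof -
      have "\<kappa> * \<bar>p - q\<bar> = \<bar>\<kappa> * p - \<kappa> * q\<bar>" if "0 \<le> \<kappa>" for \<kappa> p q :: real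
        using that by (simp only: right_diff_distrib[symmetric] abs_mult abs_of_nonneg)
      from this[of "?K n" L "real (m n) * ?e n"] show ?thesis by (simp only: of_nat_0_le_iff mult.assoc simp_thms)
    qed
    ultimately have "\<bar>?K n * L - ?K n * real (m n) * ?e n\<bar> < \<epsilon> / 2" using elim(1) by linarith
    then show ?case unfolding L_def[symmetric] dist_real_def using elim(2) k(1) by linarith
  qed
qed

end

context regularly_varying_tail
begin

text \<open>Substituting \<delta> y for y moves the Pareto integral to y \<ge> \<delta> and absorbs
  the prefactor. For 0 < y < \<delta> the integrand is 0, because the spectral process has norm 1 at
  time 0, so the integral extends to all y > 0. The limit in k is taken by dominated convergence,
  first on Q and then in y.\<close>

lemma cluster_integral_limit:
  assumes G: "continuous_on UNIV G" "\<And>x. 0 \<le> G x"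
    and \<delta>: "0 < \<delta>" "\<And>x. norm x \<le> \<delta> \<Longrightarrow> G x = 0"
    and Y0: "AE \<omega> in Q. (\<lambda>t. Y (int t) \<omega>) \<longlonglongrightarrow> 0"
  shows "(\<lambda>k. \<delta> powr (-\<alpha>) * (\<integral>\<omega>. cluster G k (\<lambda>t. \<delta> *\<^sub>R Y t \<omega>) \<partial>Q)) \<longlonglongrightarrow>
    (LBINT y:{0<..}. (\<integral>\<omega>. exp (- (\<Sum>j. G (y *\<^sub>R \<Theta> (int (Suc j)) \<omega>)))
        - exp (- (\<Sum>j. G (y *\<^sub>R \<Theta> (int j) \<omega>))) \<partial>Q) * (\<alpha> * y powr (- \<alpha> - 1)))"
proof -
  define h where "h k y = (\<integral>\<omega>. cluster G k (\<lambda>t. y *\<^sub>R \<Theta> t \<omega>) \<partial>Q)" for k y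
  define H where "H y = (\<integral>\<omega>. exp (- (\<Sum>j. G (y *\<^sub>R \<Theta> (int (Suc j)) \<omega>)))
        - exp (- (\<Sum>j. G (y *\<^sub>R \<Theta> (int j) \<omega>))) \<partial>Q)" for y
  define w where "w y = indicator {\<delta>..} y * (\<alpha> * y powr (-\<alpha> - 1))" for y :: real
  have w0: "0 \<le> w y" for y using \<alpha> by (simp add: w_def indicator_def)
  have w_int: "integrable lborel w"
    using tail_density_integrable[OF \<alpha> \<delta>(1)] by (simp add: w_def[abs_def])
  have [measurable]: "w \<in> borel_measurable borel" unfolding w_def[abs_def] by measurable
  have win: "window_functional (int k) (cluster G k)" for k by (rule window_cluster[OF G(1)])
  have h_meas[measurable]: "h k \<in> borel_measurable borel" for k
    unfolding h_def[abs_def]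
    by (rule tail_process_integral(1)[OF win cluster_bounds[OF G(2)]])
  have cl_meas[measurable]: "(\<lambda>\<omega>. cluster G k (\<lambda>t. y *\<^sub>R \<Theta> t \<omega>)) \<in> borel_measurable Q" for k y
    by (rule window_functional_measurable[OF win]) measurable
  have h_bounds: "0 \<le> h k y" "h k y \<le> 1" for k y
  proof -
    show "0 \<le> h k y" unfolding h_def by (intro Bochner_Integration.integral_nonneg cluster_bounds G)
    have "h k y \<le> (\<integral>\<omega>. 1 \<partial>Q)" unfolding h_def
      using cluster_bounds[of G, OF G(2)]
      by (intro integral_mono Q.integrable_const_bound[where B=1]) auto
    then show "h k y \<le> 1" by (simp add: Q.prob_space)
  qed
  have Theta0: "AE \<omega> in Q. norm (\<Theta> 0 \<omega>) = 1"
    using R_gt_1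
  proof eventually_elim
    case (elim \<omega>)
    then have "norm (Y 0 \<omega>) \<noteq> 0" unfolding R_def by linarith
    then show ?case by (simp add: Theta_eq R_def)
  qed
  have Theta_lim: "AE \<omega> in Q. (\<lambda>t. \<Theta> (int t) \<omega>) \<longlonglongrightarrow> 0"
    using Y0
  proof eventually_elim
    case (elim \<omega>)
    have "(\<lambda>t. inverse (R \<omega>) *\<^sub>R Y (int t) \<omega>) \<longlonglongrightarrow> inverse (R \<omega>) *\<^sub>R 0"
      by (rule tendsto_scaleR[OF tendsto_const elim])
    then show ?case by (simp add: Theta_eq)
  qed
  have cluster_lim: "AE \<omega> in Q. (\<lambda>k. cluster G k (\<lambda>t. y *\<^sub>R \<Theta> t \<omega>)) \<longlonglongrightarrow>
      exp (- (\<Sum>j. G (y *\<^sub>R \<Theta> (int (Suc j)) \<omega>))) - exp (- (\<Sum>j. G (y *\<^sub>R \<Theta> (int j) \<omega>)))" for y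
    using Theta_lim
  proof eventually_elim
    case (elim \<omega>)
    define u where "u t = G (y *\<^sub>R \<Theta> (int t) \<omega>)" for t
    have "(\<lambda>t. y *\<^sub>R \<Theta> (int t) \<omega>) \<longlonglongrightarrow> y *\<^sub>R 0" by (rule tendsto_scaleR[OF tendsto_const elim])
    from tendsto_norm[OF this] have "(\<lambda>t. norm (y *\<^sub>R \<Theta> (int t) \<omega>)) \<longlonglongrightarrow> 0"
      by (simp only: scaleR_zero_right norm_zero)
    from order_tendstoD(2)[OF this \<delta>(1)] have ev: "\<forall>\<^sub>F t in sequentially. u t = 0"
      by eventually_elim (simp add: u_def \<delta>(2))
    \<comment> \<open>Only finitely many terms are nonzero, so both series converge, and splitting
      off the term with index 0 gives the difference of exponentials.\<close>
    have summ: "summable u"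
      by (rule summable_cong[THEN iffD2, OF ev summable_zero])
    then have summ': "summable (\<lambda>j. u (Suc j))" by (simp add: summable_Suc_iff)
    have "(\<lambda>k. \<Sum>j<k. u (Suc j)) \<longlonglongrightarrow> (\<Sum>j. u (Suc j))" by (rule summable_LIMSEQ[OF summ'])
    then have "(\<lambda>k. \<Sum>t=1..k. u t) \<longlonglongrightarrow> (\<Sum>j. u (Suc j))"
      by (simp add: sum.atLeast1_atMost_eq)
    then have "(\<lambda>k. (1 - exp (- u 0)) * exp (- (\<Sum>t=1..k. u t))) \<longlonglongrightarrow> (1 - exp (- u 0)) * exp (- (\<Sum>j. u (Suc j)))"
      by (intro tendsto_intros)
    moreover have "(\<Sum>j. u j) = (\<Sum>j. u (Suc j)) + u 0"
      using suminf_split_head[OF summ] by simp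
    then have "(1 - exp (- u 0)) * exp (- (\<Sum>j. u (Suc j))) = exp (- (\<Sum>j. u (Suc j))) - exp (- (\<Sum>j. u j))"
      by (simp add: left_diff_distrib exp_add[symmetric])
    ultimately show ?case by (simp add: cluster_def u_def)
  qed
  have h_lim: "(\<lambda>k. h k y) \<longlonglongrightarrow> H y" for y
    unfolding h_def H_def
  proof (rule integral_dominated_convergence[where w="\<lambda>_. 1"])
    have [measurable]: "(\<lambda>\<omega>. G (y *\<^sub>R \<Theta> t \<omega>)) \<in> borel_measurable Q" for t
      by (rule measurable_compose[OF _ borel_measurable_continuous_onI[OF G(1)]]) measurable
    show "(\<lambda>\<omega>. exp (- (\<Sum>j. G (y *\<^sub>R \<Theta> (int (Suc j)) \<omega>))) - exp (- (\<Sum>j. G (y *\<^sub>R \<Theta> (int j) \<omega>)))) \<in> borel_measurable Q"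
      by measurable
    show "AE \<omega> in Q. norm (cluster G k (\<lambda>t. y *\<^sub>R \<Theta> t \<omega>)) \<le> 1" for k
      using cluster_bounds[of G, OF G(2)] by (intro AE_I2) simp
  qed (use cluster_lim in auto)
  have h_small: "h k y = 0" if "0 \<le> y" "y < \<delta>" for k y
    unfolding h_def
  proof (rule integral_eq_zero_AE)
    show "AE \<omega> in Q. cluster G k (\<lambda>t. y *\<^sub>R \<Theta> t \<omega>) = 0"
      using Theta0
    proof eventually_elim
      case (elim \<omega>)
      then have "G (y *\<^sub>R \<Theta> 0 \<omega>) = 0" using that by (intro \<delta>(2)) simp
      then show ?case by (rule cluster_zero)
    qed
  qed
  have H_small: "H y = 0" if "0 \<le> y" "y < \<delta>" for y
    using h_lim[of y] h_small[OF that] LIMSEQ_unique[OF _ tendsto_const] by simp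
  have H_eq: "(LBINT y:{0<..}. H y * (\<alpha> * y powr (- \<alpha> - 1))) = (\<integral>y. w y * H y \<partial>lborel)"
    unfolding set_lebesgue_integral_def
  proof (rule Bochner_Integration.integral_cong[OF refl])
    fix y
    show "indicator {0<..} y *\<^sub>R (H y * (\<alpha> * y powr (- \<alpha> - 1))) = w y * H y"
      using H_small[of y] \<delta>(1) by (auto simp: w_def indicator_def not_le)
  qed
  have "\<delta> powr (-\<alpha>) * (\<integral>\<omega>. cluster G k (\<lambda>t. \<delta> *\<^sub>R Y t \<omega>) \<partial>Q) = (\<integral>y. w y * h k y \<partial>lborel)" for k
  proof -
    have f: "window_functional (int k) (\<lambda>v. cluster G k (\<lambda>t. \<delta> *\<^sub>R v t))"
      by (rule window_functional_compose[OF win]) auto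
    have "(\<integral>\<omega>. cluster G k (\<lambda>t. \<delta> *\<^sub>R Y t \<omega>) \<partial>Q) =
        (\<integral>y. indicator {1..} y * (\<alpha> * y powr (-\<alpha> - 1)) * (\<integral>\<omega>. cluster G k (\<lambda>t. \<delta> *\<^sub>R (y *\<^sub>R \<Theta> t \<omega>)) \<partial>Q) \<partial>lborel)"
      by (rule tail_process_integral(2)[OF f cluster_bounds[OF G(2)]])
    also have "\<dots> = (\<integral>y. indicator {1..} y * (\<alpha> * y powr (-\<alpha> - 1)) * h k (\<delta> * y) \<partial>lborel)"
      by (simp add: h_def)
    finally have "\<delta> powr (-\<alpha>) * (\<integral>\<omega>. cluster G k (\<lambda>t. \<delta> *\<^sub>R Y t \<omega>) \<partial>Q) =
        (\<integral>y. \<delta> powr (-\<alpha>) * (indicator {1..} y * (\<alpha> * y powr (-\<alpha> - 1)) * h k (\<delta> * y)) \<partial>lborel)"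
      by simp
    \<comment> \<open>The shape 0 + \<delta> y is that of the affine substitution rule; the
      constants match since \<open>\<delta> * \<delta> powr (-\<alpha> - 1) = \<delta> powr
      (-\<alpha>)\<close>.\<close>
    also have "\<dots> = (\<integral>y. \<delta> * (w (0 + \<delta> * y) * h k (0 + \<delta> * y)) \<partial>lborel)"
    proof (rule Bochner_Integration.integral_cong[OF refl])
      fix y :: real
      show "\<delta> powr (-\<alpha>) * (indicator {1..} y * (\<alpha> * y powr (-\<alpha> - 1)) * h k (\<delta> * y)) =
          \<delta> * (w (0 + \<delta> * y) * h k (0 + \<delta> * y))"
      proof (cases "1 \<le> y")
        case True
        have "(\<delta> * y) powr (-\<alpha> - 1) = \<delta> powr (-\<alpha> - 1) * y powr (-\<alpha> - 1)"
          using \<delta>(1) True by (simp add: powr_mult)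
        moreover have "\<delta> * \<delta> powr (-\<alpha> - 1) = \<delta> powr (-\<alpha>)"
          using \<delta>(1) by (simp add: powr_diff)
        moreover have "\<delta> \<le> \<delta> * y" using \<delta>(1) True by simp
        ultimately show ?thesis using True by (simp add: w_def)
      next
        case False
        then have "\<not> \<delta> \<le> \<delta> * y" using \<delta>(1) by simp
        then show ?thesis using False by (simp add: w_def)
      qed
    qed
    also have "\<dots> = (\<integral>y. w y * h k y \<partial>lborel)"
      using lborel_integral_real_affine[of \<delta> "\<lambda>y. w y * h k y" 0] \<delta>(1) by simp
    finally show ?thesis .
  qed
  moreover have "(\<lambda>k. \<integral>y. w y * h k y \<partial>lborel) \<longlonglongrightarrow> (\<integral>y. w y * H y \<partial>lborel)"
  proof (rule integral_dominated_convergence[where w=w])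
    have [measurable]: "H \<in> borel_measurable borel"
      by (rule borel_measurable_LIMSEQ_real[OF h_lim h_meas])
    show "(\<lambda>y. w y * H y) \<in> borel_measurable lborel" by measurable
    show "(\<lambda>y. w y * h k y) \<in> borel_measurable lborel" for k by measurable
    show "AE y in lborel. (\<lambda>k. w y * h k y) \<longlonglongrightarrow> w y * H y"
      by (intro AE_I2 tendsto_mult tendsto_const h_lim)
    show "AE y in lborel. norm (w y * h k y) \<le> w y" for k
      using h_bounds w0 by (intro AE_I2) (simp add: mult_left_le)
  qed (rule w_int)
  ultimately show ?thesis unfolding H_def[symmetric] H_eq by simp
qed

end

lemma CK_plus_emb:
  fixes g :: "ereal ^ 'd \<Rightarrow> real"
  assumes g: "g \<in> CK_plus"
  obtains \<delta> where "0 < \<delta>" "\<And>x :: real ^ 'd. norm x \<le> \<delta> \<Longrightarrow> g (emb x) = 0"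
proof -
  obtain U where U: "open U" "0 \<in> U" "\<And>z. z \<in> U \<Longrightarrow> g z = 0"
    using CK_plus_support[OF g] by blast
  have "open (emb -` U :: (real ^ 'd) set)" using U(1) by (rule open_vimage) (rule continuous_emb)
  moreover have "0 \<in> (emb -` U :: (real ^ 'd) set)"
    using U(2) by (simp add: emb_def vec_eq_iff zero_ereal_def[symmetric] zero_vec_def[symmetric])
  ultimately obtain e where e: "0 < e" "cball (0 :: real ^ 'd) e \<subseteq> emb -` U"
    by (meson open_contains_cball)
  show ?thesis
  proof (rule that[OF e(1)])
    fix x :: "real ^ 'd" assume "norm x \<le> e"
    then have "x \<in> cball 0 e" by (simp only: mem_cball_0)
    then show "g (emb x) = 0" using e(2) U(3) by blast
  qed
qed

theorem theorem4p1:
  fixes M :: "'w measure" and X :: "int \<Rightarrow> 'w \<Rightarrow> real ^ 'd"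
    and Q :: "'v measure" and Y :: "int \<Rightarrow> 'v \<Rightarrow> real ^ 'd"
    and \<alpha> :: real and a :: "nat \<Rightarrow> real" and m :: "nat \<Rightarrow> nat"
  defines "\<Theta> \<equiv> spectral_tail Y"
  assumes "prob_space M"
    and "\<And>t. X t \<in> borel_measurable M"
    and "strictly_stationary M X"
    and "\<alpha> > 0"
    and "regularly_varying M X \<alpha>"
    and "tail_process M X \<alpha> Q Y"
    and "(\<lambda>n. real n * \<P>(\<omega> in M. norm (X 0 \<omega>) > a n)) \<longlonglongrightarrow> 1"
    and "filterlim m at_top sequentially"
    and "(\<lambda>n. real (m n)) \<in> o(\<lambda>n. real n)"
    and mixing: "\<And>g. g \<in> CK_plus \<Longrightarrow>
      (\<lambda>n. laplace_functional M (sample_process X a n n) g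
            - laplace_functional M (sample_process X a n (m n)) g ^ (n div m n)) \<longlonglongrightarrow> 0"
    and anticlustering: "\<And>\<delta>. \<delta> > 0 \<Longrightarrow>
      (\<lambda>k::nat. limsup (\<lambda>n. ereal
         (\<P>(\<omega> in M. Max ((\<lambda>i. norm (X (int i) \<omega>)) ` {k..m n}) > \<delta> * a n
              \<bar> norm (X 0 \<omega>) > \<delta> * a n)))) \<longlonglongrightarrow> 0"
  shows "\<exists>(P :: (ereal ^ 'd) measure measure) N.
      prob_space P \<and> point_process P N \<and>
      converges_in_distribution vague_topology M (\<lambda>n. sample_process X a n n) P N \<and>
      (\<forall>g\<in>CK_plus. laplace_functional P N g =
         exp (- (LBINT y:{0<..}.
           (\<integral>\<omega>. exp (- (\<Sum>j. g (emb (y *\<^sub>R \<Theta> (int (Suc j)) \<omega>))))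
                - exp (- (\<Sum>j. g (emb (y *\<^sub>R \<Theta> (int j) \<omega>)))) \<partial>Q)
           * (\<alpha> * y powr (- \<alpha> - 1)))))"
proof -
  note M = assms(2) and X = assms(3) and stat = assms(4) and \<alpha> = assms(5) and tail = assms(7)
    and m = assms(9,10)
  interpret regularly_varying_tail M X \<alpha> Q Y
    by (rule regularly_varying_tail.intro[OF M X \<alpha> tail])
  have a: "(\<lambda>n. real n * tail_prob (a n)) \<longlonglongrightarrow> 1"
    using assms(8) by (simp add: tail_prob_def exceed_def)
  have a_top: "filterlim a at_top sequentially" by (rule normalizing_at_top[OF a])
  have ac: "\<forall>\<^sub>F k in sequentially. anticluster a m \<delta> k \<eta>" if "0 < \<delta>" "0 < \<eta>" for \<delta> \<eta>
    by (rule anticlusterI[OF m(1) anticlustering[OF that(1)] that(2)])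
  have Y0: "AE \<omega> in Q. (\<lambda>t. Y (int t) \<omega>) \<longlonglongrightarrow> 0"
    by (rule tail_process_tendsto_0[OF a m(1) ac])
  show ?thesis
  proof (rule sample_process_converges[OF M X])
    fix q :: nat
    have X_shift: "measure M {\<omega> \<in> space M. norm (X (int t) \<omega> /\<^sub>R a n) > 1 / (real q + 1)} =
        measure M {\<omega> \<in> space M. norm (X 0 \<omega> /\<^sub>R a n) > 1 / (real q + 1)}" for t n
    proof -
      let ?f = "\<lambda>v :: int \<Rightarrow> real ^ 'd. indicator {x. norm (x /\<^sub>R a n) > 1 / (real q + 1)} (v 0) :: real"
      have [measurable]: "{x :: real ^ 'd. norm (x /\<^sub>R a n) > 1 / (real q + 1)} \<in> sets borel" by measurable
      have "(\<integral>\<omega>. ?f (\<lambda>s. X (s + int t) \<omega>) \<partial>M) = (\<integral>\<omega>. ?f (\<lambda>s. X s \<omega>) \<partial>M)"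
        by (rule stationary_expectation[OF X stat]) measurable
      moreover have "(\<integral>\<omega>. ?f (\<lambda>s. X (s + i) \<omega>) \<partial>M) = measure M {\<omega> \<in> space M. norm (X i \<omega> /\<^sub>R a n) > 1 / (real q + 1)}" for i
      proof -
        have "(\<integral>\<omega>. ?f (\<lambda>s. X (s + i) \<omega>) \<partial>M) =
            (\<integral>\<omega>. indicator {\<omega> \<in> space M. norm (X i \<omega> /\<^sub>R a n) > 1 / (real q + 1)} \<omega> \<partial>M)"
          by (intro Bochner_Integration.integral_cong) (auto simp: indicator_def)
        then show ?thesis by simp
      qed
      from this[of "int t"] this[of 0] have
        "(\<integral>\<omega>. ?f (\<lambda>s. X (s + int t) \<omega>) \<partial>M) = measure M {\<omega> \<in> space M. norm (X (int t) \<omega> /\<^sub>R a n) > 1 / (real q + 1)}"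
        "(\<integral>\<omega>. ?f (\<lambda>s. X s \<omega>) \<partial>M) = measure M {\<omega> \<in> space M. norm (X 0 \<omega> /\<^sub>R a n) > 1 / (real q + 1)}"
        by simp_all
      ultimately show ?thesis by (simp only:)
    qed
    define \<delta> where "\<delta> = 1 / (real q + 1)"
    have \<delta>: "0 < \<delta>" by (simp add: \<delta>_def)
    have sum_eq: "(\<Sum>t=1..n. measure M {\<omega> \<in> space M. norm (X (int t) \<omega> /\<^sub>R a n) > 1 / (real q + 1)}) =
        real n * measure M {\<omega> \<in> space M. norm (X 0 \<omega> /\<^sub>R a n) > \<delta>}" for n
      by (simp only: X_shift) (simp add: \<delta>_def)
    have "\<forall>\<^sub>F n in sequentially. 0 < a n" using a_top by (simp add: filterlim_at_top_dense)
    then have "\<forall>\<^sub>F n in sequentially. real n * tail_prob (\<delta> * a n) =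
        real n * measure M {\<omega> \<in> space M. norm (X 0 \<omega> /\<^sub>R a n) > \<delta>}"
      by eventually_elim (simp add: tail_prob_def exceed_def field_simps)
    \<comment> \<open>The identification with the tail holds only where \<open>a n\<close> is
      positive, so a bound for every n is drawn from boundedness of convergent sequences.\<close>
    from Lim_transform_eventually[OF normalizing_scaled[OF a \<delta>] this]
    have "Bseq (\<lambda>n. real n * measure M {\<omega> \<in> space M. norm (X 0 \<omega> /\<^sub>R a n) > \<delta>})"
      by (intro convergent_imp_Bseq convergentI)
    then obtain C where C: "\<forall>n. norm (real n * measure M {\<omega> \<in> space M. norm (X 0 \<omega> /\<^sub>R a n) > \<delta>}) \<le> C"
      by (rule BseqE)
    have "real n * measure M {\<omega> \<in> space M. norm (X 0 \<omega> /\<^sub>R a n) > \<delta>} \<le> C" for n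
      using spec[OF C, of n] by (simp only: real_norm_def abs_le_D1)
    then show "\<exists>C. \<forall>n. (\<Sum>t=1..n. measure M {\<omega> \<in> space M. norm (X (int t) \<omega> /\<^sub>R a n) > 1 / (real q + 1)}) \<le> C"
      unfolding sum_eq by blast
  next
    fix g :: "ereal ^ 'd \<Rightarrow> real" assume g: "g \<in> CK_plus"
    define G where "G x = g (emb x)" for x
    have G: "continuous_on UNIV G" "\<And>x. 0 \<le> G x"
      unfolding G_def using g
      by (auto intro!: continuous_on_compose2[OF CK_plus_continuous continuous_emb, of g UNIV UNIV] CK_plus_nonneg)
    obtain \<delta> where \<delta>: "0 < \<delta>" "\<And>x. norm x \<le> \<delta> \<Longrightarrow> G x = 0"
      unfolding G_def using CK_plus_emb[OF g] by blast
    let ?I = "LBINT y:{0<..}. (\<integral>\<omega>. exp (- (\<Sum>j. G (y *\<^sub>R spectral_tail Y (int (Suc j)) \<omega>)))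
        - exp (- (\<Sum>j. G (y *\<^sub>R spectral_tail Y (int j) \<omega>))) \<partial>Q) * (\<alpha> * y powr (- \<alpha> - 1))"
    define S where "S n j = (\<integral>\<omega>. exp (- (\<Sum>t=1..j. G (X (int t) \<omega> /\<^sub>R a n))) \<partial>M)" for n j :: nat
    have lap: "laplace_functional M (sample_process X a n j) g = S n j" for n j
    proof -
      have "laplace_functional M (sample_process X a n j) g = (\<integral>\<omega>. exp (- evals (sample_process X a n j \<omega>) g) \<partial>M)"
        using g by (simp add: laplace_functional_def evals_def)
      then show ?thesis by (simp only: evals_sample_process[OF g] S_def G_def)
    qed
    \<comment> \<open>Anti-clustering enters twice: at the level \<delta> given by the support of g,
      and at all levels through the decay of Y.\<close>
    have "(\<lambda>n. real (n div m n) * (1 - S n (m n))) \<longlonglongrightarrow> ?I"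
      unfolding S_def
      by (rule blocks_laplace_limit[OF stat G \<delta> a m ac[OF \<delta>(1)] cluster_integral_limit[OF G \<delta> Y0]])
    moreover have "S n j \<le> 1" for n j
    proof -
      have "S n j \<le> (\<integral>\<omega>. 1 \<partial>M)"
        unfolding S_def using G(2)
        by (intro integral_mono') (auto intro!: sum_nonneg)
      then show ?thesis by (simp add: M.prob_space)
    qed
    ultimately have "(\<lambda>n. S n (m n) ^ (n div m n)) \<longlonglongrightarrow> exp (- ?I)"
      by (intro power_tendsto_exp[OF blocks_fill(2)[OF m]])
    from tendsto_add[OF mixing[OF g, unfolded lap] this]
    have "(\<lambda>n. S n n) \<longlonglongrightarrow> exp (- ?I)" by simp
    then show "(\<lambda>n. laplace_functional M (sample_process X a n n) g) \<longlonglongrightarrow>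
         exp (- (LBINT y:{0<..}.
           (\<integral>\<omega>. exp (- (\<Sum>j. g (emb (y *\<^sub>R \<Theta> (int (Suc j)) \<omega>))))
                - exp (- (\<Sum>j. g (emb (y *\<^sub>R \<Theta> (int j) \<omega>)))) \<partial>Q)
           * (\<alpha> * y powr (- \<alpha> - 1))))"
      unfolding lap G_def \<Theta>_def .
  qed
qed

end
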